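(* Suppose $p$ is a computable real with $p \geq 1$ and $p \neq 2$. Suppose $C\subseteq\mathbb{N}$ is a c.e. (computably enumerable) set. Then there is a computable Banach space $\mathcal{B}$ such that $C$ computes a surjective linear isometry of $\ell^p$ onto $\mathcal{B}$, and such that any oracle that computes a surjective linear isometry of $\ell^p$ onto $\mathcal{B}$ also computes $C$.
   Context: All Banach spaces are over $\mathbb{C}$, and $\mathbb{N}=\{0,1,2,\ldots\}$. $\ell^p$ is the Banach space of all $f:\mathbb{N}\to\mathbb{C}$ with $\|f\|_p=(\sum_n |f(n)|^p)^{1/p}<\infty$. A real $p$ is computable if there is an algorithm that, given $k\in\mathbb{N}$, computes a rational $q$ with $|p-q|<2^{-k}$. Let $\mathcal{B}$ be a Banach space and $F=\{f_0,f_1,\ldots\}\subseteq\mathcal{B}$ an indexed (finite or countable) set. $\mathcal{L}_{\mathbb{Q}(i)}(F)$ is the set of finite linear combinations of elements of $F$ with coefficients in $\mathbb{Q}(i)$; algorithms handle such vectors via codes of the coefficient lists. $F$ is a generating set for $\mathcal{B}$ if its closed linear span is $\mathcal{B}$; it is an effective generating set if moreover there is an algorithm that, given $f\in\mathcal{L}_{\mathbb{Q}(i)}(F)$ and $k\in\mathbb{N}$, computes a rational $q$ with $|\|f\|-q|<2^{-k}$. A computable Banach space is a pair $(\mathcal{B},F)$ where $F$ is an effective generating set for $\mathcal{B}$ ($F$ is usually suppressed). The space $\ell^p$ itself is regarded as a computable Banach space with its standard effective generating set $E=\{e_0,e_1,\ldots\}$, where $e_n=\chi_{\{n\}}$. A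 rational ball with respect to $F$ is an open ball $B(f;r)$ with $f\in\mathcal{L}_{\mathbb{Q}(i)}(F)$ and $r$ a positive rational. A map $T:\mathcal{B}_0\to\mathcal{B}_1$ between computable Banach spaces $(\mathcal{B}_0,F_0)$, $(\mathcal{B}_1,F_1)$ is computable (with respect to $(F_0,F_1)$) if there is an algorithm $P$ such that: (1) given (a code of) a rational ball with respect to $F_0$, $P$ either does not halt or outputs (a code of) a rational ball with respect to $F_1$; (2) if $P$ outputs $B'$ on input $B$, then $T(f)\in B'$ for all $f\in B$; (3) if $V$ is a neighborhood of $T(f)$ and $U$ is a neighborhood of $f$, then $f$ belongs to a rational ball $B\subseteq U$ on which $P$ halts and outputs a rational ball included in $V$. An oracle $X$ computes $T$ if such a $P$ exists among algorithms with oracle $X$. A linear isometry is a linear map $T$ with $\|T(x)-T(y)\|=\|x-y\|$ for all $x,y$. *)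

theory Defs
  imports
    "HOL-Analysis.Analysis"
    "HOL-Algebra.Module"
    "HOL-Library.Countable"
    "HOL-Library.Nat_Bijection"
begin

section \<open>Algorithms with an oracle\<close>

text \<open>
  The programs are those of the partial recursive functions with one additional basic
  function, the characteristic function of the oracle.  The relation \<open>runs X P xs y\<close>
  says that \<open>P\<close> with oracle \<open>X\<close> halts on the input \<open>xs\<close> with output \<open>y\<close>.  Programs carry no
  arity: a program denotes a partial function of each number of arguments.
\<close>

datatype program =
    Zero
  | Succ
  | Proj nat
  | Query
  | Comp program "program list"
  | PrimRec program program
  | Mu program

inductive runs :: "nat set \<Rightarrow> program \<Rightarrow> nat list \<Rightarrow> nat \<Rightarrow> bool" for X :: "nat set" where
  zero: "runs X Zero xs 0"
| succ: "runs X Succ (x # xs) (Suc x)"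
| proj: "i < length xs \<Longrightarrow> runs X (Proj i) xs (xs ! i)"
| query: "runs X Query (x # xs) (if x \<in> X then 1 else 0)"
| comp: "list_all2 (\<lambda>g y. runs X g xs y) gs ys \<Longrightarrow> runs X f ys z \<Longrightarrow> runs X (Comp f gs) xs z"
| rec_0: "runs X f xs y \<Longrightarrow> runs X (PrimRec f g) (0 # xs) y"
| rec_Suc: "runs X (PrimRec f g) (n # xs) r \<Longrightarrow> runs X g (n # r # xs) y
    \<Longrightarrow> runs X (PrimRec f g) (Suc n # xs) y"
| mu: "runs X f (n # xs) 0 \<Longrightarrow> (\<And>m. m < n \<Longrightarrow> \<exists>k. runs X f (m # xs) (Suc k))
    \<Longrightarrow> runs X (Mu f) xs n"

inductive_cases runs_basic: "runs X Zero xs y" "runs X Succ xs y" "runs X (Proj i) xs y"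
  "runs X Query xs y" "runs X (PrimRec f g) (0 # xs) y"
inductive_cases runs_Comp: "runs X (Comp f gs) xs y"
inductive_cases runs_PrimRec_Suc: "runs X (PrimRec f g) (Suc n # xs) y"
inductive_cases runs_Mu: "runs X (Mu f) xs y"

lemma runs_deterministic:
  assumes "runs X P xs y" and "runs X P xs z"
  shows "y = z"
  using assms
proof (induction arbitrary: z rule: runs.induct)
  case (comp xs gs ys f y)
  from comp.prems obtain zs where zs: "list_all2 (\<lambda>g y. runs X g xs y) gs zs" "runs X f zs z"
    by (auto elim: runs_Comp)
  have "ys = zs"
    using comp.IH(1) zs(1) by (auto simp: list_all2_conv_all_nth intro!: nth_equalityI)
  then show ?case
    using comp.IH(2) zs(2) by blast
next
  case (rec_Suc f g n xs r y)
  from rec_Suc.prems obtain r' where "runs X (PrimRec f g) (n # xs) r'" "runs X g (n # r' # xs) z"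
    by (auto elim: runs_PrimRec_Suc)
  then show ?case
    using rec_Suc.IH by blast
next
  case (mu f n xs)
  from mu.prems have z: "runs X f (z # xs) 0"
    and below: "\<And>m. m < z \<Longrightarrow> \<exists>k. runs X f (m # xs) (Suc k)"
    by (auto elim: runs_Mu)
  show ?case
  proof (rule linorder_cases[of n z])
    assume "n < z"
    then show ?thesis
      using below mu.IH(1) by (metis nat.distinct(1))
  next
    assume "z < n"
    then show ?thesis
      using z mu.IH(2) by (metis nat.distinct(1))
  qed
next
  case (rec_0 f xs y g)
  from rec_0.prems have "runs X f xs z"
    by (rule runs_basic(5))
  then show ?case
    by (rule rec_0.IH)
qed (erule runs_basic; simp)+

definition oracle_computes_set :: "nat set \<Rightarrow> nat set \<Rightarrow> bool" where
  "oracle_computes_set X C \<longleftrightarrow> (\<exists>P. \<forall>n. runs X P [n] (if n \<in> C then 1 else 0))"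

text \<open>Algorithms without an oracle are algorithms whose oracle is the empty set.\<close>

definition ce_set :: "nat set \<Rightarrow> bool" where
  "ce_set C \<longleftrightarrow> (\<exists>P. C = {n. \<exists>y. runs {} P [n] y})"


section \<open>Codes\<close>

definition decode_rat :: "nat \<Rightarrow> real" where
  "decode_rat n = of_rat (nat_to_rat_surj n)"

definition decode_pos_rat :: "nat \<Rightarrow> real" where
  "decode_pos_rat n = (case prod_decode n of (a, b) \<Rightarrow> real (Suc a) / real (Suc b))"

definition decode_gauss_rat :: "nat \<Rightarrow> complex" where
  "decode_gauss_rat n = (case prod_decode n of (a, b) \<Rightarrow> Complex (decode_rat a) (decode_rat b))"

definition computable_real :: "real \<Rightarrow> bool" where
  "computable_real p \<longleftrightarrow>
     (\<exists>P. \<forall>k. \<exists>q. runs {} P [k] q \<and> \<bar>p - decode_rat q\<bar> < 1 / 2 ^ k)"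


section \<open>Complex Banach spaces\<close>

text \<open>
  A complex normed space is a module over the field of complex numbers together with a norm.
  The fields \<open>mult\<close> and \<open>one\<close> which the module record inherits from rings play no role.
\<close>

record 'v normed_space = "(complex, 'v) module" +
  vnorm :: "'v \<Rightarrow> real"

definition complex_ring :: "complex ring" where
  "complex_ring = \<lparr>carrier = UNIV, mult = (*), one = 1, zero = 0, add = (+)\<rparr>"

text \<open>The theory of metric spaces requires the distance to be symmetric and nonnegative also
  outside the carrier, whence the value 0 there.\<close>

definition vdist :: "('v, 'm) normed_space_scheme \<Rightarrow> 'v \<Rightarrow> 'v \<Rightarrow> real" where
  "vdist V x y = (if x \<in> carrier V \<and> y \<in> carrier V then vnorm V (x \<ominus>\<^bsub>V\<^esub> y) else 0)"

abbreviation vball :: "('v, 'm) normed_space_scheme \<Rightarrow> 'v \<Rightarrow> real \<Rightarrow> 'v set" where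
  "vball V \<equiv> Metric_space.mball (carrier V) (vdist V)"

abbreviation vtopology :: "('v, 'm) normed_space_scheme \<Rightarrow> 'v topology" where
  "vtopology V \<equiv> Metric_space.mtopology (carrier V) (vdist V)"

locale complex_normed_space = module complex_ring V for V (structure) +
  assumes vnorm_nonneg: "x \<in> carrier V \<Longrightarrow> 0 \<le> vnorm V x"
    and vnorm_eq_0_iff: "x \<in> carrier V \<Longrightarrow> vnorm V x = 0 \<longleftrightarrow> x = \<zero>"
    and vnorm_smult: "x \<in> carrier V \<Longrightarrow> vnorm V (a \<odot> x) = cmod a * vnorm V x"
    and vnorm_triangle:
      "\<lbrakk>x \<in> carrier V; y \<in> carrier V\<rbrakk> \<Longrightarrow> vnorm V (x \<oplus> y) \<le> vnorm V x + vnorm V y"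

locale complex_banach_space = complex_normed_space +
  assumes complete: "Metric_space.mcomplete (carrier V) (vdist V)"

lemma cring_complex_ring: "cring complex_ring"
proof (rule cringI)
  show "abelian_group complex_ring"
  proof (rule abelian_groupI)
    fix x assume "x \<in> carrier complex_ring"
    show "\<exists>y\<in>carrier complex_ring. y \<oplus>\<^bsub>complex_ring\<^esub> x = \<zero>\<^bsub>complex_ring\<^esub>"
      by (rule bexI[of _ "- x"]) (auto simp: complex_ring_def)
  qed (auto simp: complex_ring_def)
  show "comm_monoid complex_ring"
    by (rule comm_monoidI) (auto simp: complex_ring_def)
qed (auto simp: complex_ring_def algebra_simps)

lemma (in complex_normed_space) Metric_space_vdist: "Metric_space (carrier V) (vdist V)"
proof -
  have minus: "vnorm V (\<ominus> x) = vnorm V x" if x: "x \<in> carrier V" for x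
  proof -
    have one: "(1::complex) \<odot> x = x"
      using smult_one[OF x] by (simp add: complex_ring_def)
    have "(- 1) \<odot> x \<oplus> x = (- 1) \<odot> x \<oplus> 1 \<odot> x"
      by (simp add: one)
    also have "\<dots> = (- 1 + 1) \<odot> x"
      using smult_l_distr[of "- 1" 1 x] x by (simp add: complex_ring_def)
    also have "\<dots> = \<zero>"
      using smult_l_null[OF x] by (simp add: complex_ring_def)
    finally have "\<ominus> x = (- 1) \<odot> x"
      using x smult_closed[of "- 1" x] minus_equality by (simp add: complex_ring_def)
    then show ?thesis
      using vnorm_smult[OF x, of "- 1"] by simp
  qed
  have diff_commute: "y \<ominus> x = \<ominus> (x \<ominus> y)" if "x \<in> carrier V" "y \<in> carrier V" for x y
    using that by (simp add: a_minus_def minus_add a_comm)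
  have diff_split: "x \<ominus> z = (x \<ominus> y) \<oplus> (y \<ominus> z)"
    if "x \<in> carrier V" "y \<in> carrier V" "z \<in> carrier V" for x y z
    using that by (simp add: a_minus_def a_assoc r_neg2 r_neg1)
  show ?thesis
  proof
    fix x y
    show "0 \<le> vdist V x y"
      by (simp add: vdist_def vnorm_nonneg)
    show "vdist V x y = vdist V y x"
      using diff_commute[of x y] minus[of "x \<ominus> y"] by (simp add: vdist_def)
  next
    fix x y assume "x \<in> carrier V" "y \<in> carrier V"
    then show "vdist V x y = 0 \<longleftrightarrow> x = y"
      using minus_equality[of x "\<ominus> y"] r_neg
      by (auto simp: vdist_def vnorm_eq_0_iff a_minus_def)
  next
    fix x y z assume "x \<in> carrier V" "y \<in> carrier V" "z \<in> carrier V"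
    then show "vdist V x z \<le> vdist V x y + vdist V y z"
      using diff_split[of x y z] vnorm_triangle[of "x \<ominus> y" "y \<ominus> z"] by (simp add: vdist_def)
  qed
qed

definition linear_isometry ::
    "('v, 'm) normed_space_scheme \<Rightarrow> ('w, 'n) normed_space_scheme \<Rightarrow> ('v \<Rightarrow> 'w) \<Rightarrow> bool" where
  "linear_isometry V W T \<longleftrightarrow>
     T \<in> carrier V \<rightarrow> carrier W \<and>
     (\<forall>x\<in>carrier V. \<forall>y\<in>carrier V. T (x \<oplus>\<^bsub>V\<^esub> y) = T x \<oplus>\<^bsub>W\<^esub> T y) \<and>
     (\<forall>a. \<forall>x\<in>carrier V. T (a \<odot>\<^bsub>V\<^esub> x) = a \<odot>\<^bsub>W\<^esub> T x) \<and>
     (\<forall>x\<in>carrier V. \<forall>y\<in>carrier V.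
        vnorm W (T x \<ominus>\<^bsub>W\<^esub> T y) = vnorm V (x \<ominus>\<^bsub>V\<^esub> y))"

definition surjective_linear_isometry ::
    "('v, 'm) normed_space_scheme \<Rightarrow> ('w, 'n) normed_space_scheme \<Rightarrow> ('v \<Rightarrow> 'w) \<Rightarrow> bool" where
  "surjective_linear_isometry V W T \<longleftrightarrow> linear_isometry V W T \<and> T ` carrier V = carrier W"


section \<open>Computable Banach spaces\<close>

text \<open>
  An indexed set of vectors is a sequence \<open>F :: nat \<Rightarrow> 'v\<close>, possibly with repetitions; a finite
  indexed set is continued by zero vectors, which changes neither its linear combinations nor
  what can be computed from their codes.
\<close>

definition lin_comb :: "('v, 'm) normed_space_scheme \<Rightarrow> (nat \<Rightarrow> 'v) \<Rightarrow> complex list \<Rightarrow> 'v" where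
  "lin_comb V F cs = (\<Oplus>\<^bsub>V\<^esub>i\<in>{..<length cs}. cs ! i \<odot>\<^bsub>V\<^esub> F i)"

definition generating_set :: "('v, 'm) normed_space_scheme \<Rightarrow> (nat \<Rightarrow> 'v) \<Rightarrow> bool" where
  "generating_set V F \<longleftrightarrow>
     range F \<subseteq> carrier V \<and> vtopology V closure_of range (lin_comb V F) = carrier V"

definition decode_vec :: "('v, 'm) normed_space_scheme \<Rightarrow> (nat \<Rightarrow> 'v) \<Rightarrow> nat \<Rightarrow> 'v" where
  "decode_vec V F n = lin_comb V F (map decode_gauss_rat (list_decode n))"

definition effective_generating_set ::
    "('v, 'm) normed_space_scheme \<Rightarrow> (nat \<Rightarrow> 'v) \<Rightarrow> bool" where
  "effective_generating_set V F \<longleftrightarrow>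
     generating_set V F \<and>
     (\<exists>P. \<forall>n k. \<exists>q. runs {} P [n, k] q \<and>
        \<bar>vnorm V (decode_vec V F n) - decode_rat q\<bar> < 1 / 2 ^ k)"

text \<open>
  A space with a countable generating set has at most continuum many elements, so up to renaming
  of its elements every computable Banach space has a carrier of type \<open>(nat \<Rightarrow> complex) set\<close>.
\<close>

definition computable_banach_space ::
    "('v, 'm) normed_space_scheme \<Rightarrow> (nat \<Rightarrow> 'v) \<Rightarrow> bool" where
  "computable_banach_space V F \<longleftrightarrow> complex_banach_space V \<and> effective_generating_set V F"

text \<open>Every natural number is the code of a rational ball.\<close>

definition decode_ball :: "('v, 'm) normed_space_scheme \<Rightarrow> (nat \<Rightarrow> 'v) \<Rightarrow> nat \<Rightarrow> 'v set" where
  "decode_ball V F n =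
     (case prod_decode n of (c, r) \<Rightarrow> vball V (decode_vec V F c) (decode_pos_rat r))"

definition oracle_computes_map ::
    "nat set \<Rightarrow> ('v, 'm) normed_space_scheme \<Rightarrow> (nat \<Rightarrow> 'v) \<Rightarrow>
     ('w, 'n) normed_space_scheme \<Rightarrow> (nat \<Rightarrow> 'w) \<Rightarrow> ('v \<Rightarrow> 'w) \<Rightarrow> bool" where
  "oracle_computes_map X V F W G T \<longleftrightarrow>
     (\<exists>P.
        (\<forall>b b'. runs X P [b] b' \<longrightarrow> T ` decode_ball V F b \<subseteq> decode_ball W G b') \<and>
        (\<forall>f\<in>carrier V. \<forall>N M.
           openin (vtopology V) N \<longrightarrow> f \<in> N \<longrightarrow> openin (vtopology W) M \<longrightarrow> T f \<in> M \<longrightarrow>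
           (\<exists>b b'. f \<in> decode_ball V F b \<and> decode_ball V F b \<subseteq> N \<and>
              runs X P [b] b' \<and> decode_ball W G b' \<subseteq> M)))"


section \<open>The spaces of p-summable sequences\<close>

definition lp_space :: "real \<Rightarrow> (nat \<Rightarrow> complex) normed_space" where
  "lp_space p =
     \<lparr>carrier = {f. summable (\<lambda>n. cmod (f n) powr p)},
      mult = undefined, one = undefined,
      zero = (\<lambda>n. 0), add = (\<lambda>f g n. f n + g n),
      smult = (\<lambda>a f n. a * f n),
      vnorm = (\<lambda>f. (\<Sum>n. cmod (f n) powr p) powr (1 / p))\<rparr>"

definition std_basis :: "nat \<Rightarrow> nat \<Rightarrow> complex" where
  "std_basis n = indicator {n}"

end

theory Submission
  imports Defs
begin

text \<open>
  The space is the space of \<open>p\<close>-summable sequences itself, with a generating set that hides the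
  set \<open>C\<close>. Fix an enumeration of \<open>C\<close> and put \<open>\<delta> = 2 powr (- 1 / p)\<close>. The generator of index
  \<open>2 c\<close> is the basis vector \<open>e\<^bsub>2c\<^esub>\<close> if \<open>c\<close> is not in \<open>C\<close>. If \<open>c\<close> is enumerated, at a step with
  the odd number \<open>k\<close>, it is \<open>\<delta> (e\<^bsub>2c\<^esub> + e\<^sub>k)\<close>, a vector of the same norm 1, and the generator of
  index \<open>k\<close> is \<open>\<delta> e\<^sub>k\<close>. All other generators are basis vectors.

  A combination of generators in which the index \<open>k\<close> does not occur has the same norm in both
  cases, because \<open>\<delta> powr p + \<delta> powr p = 1\<close>. So the norm of a rational combination depends only
  on the enumeration steps below its length, and it is computable without an oracle
  (\<open>split_comb_mem_norm\<close>, \<open>computable_banach_space_split\<close>).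

  The identity is an onto isometry. In terms of the generators the basis vectors have as
  coefficients 0, 1 and \<open>\<plusminus>1 / \<delta>\<close>; the last is a computable real number, and \<open>C\<close> as an oracle
  tells for which \<open>c\<close> the step \<open>k\<close> exists and has to be searched for. Hence \<open>C\<close> computes the
  identity (\<open>oracle_computes_id\<close>).

  Conversely, let an oracle compute some onto isometry \<open>T\<close>. As \<open>p \<noteq> 2\<close>, the equality case of
  Clarkson's inequality shows that \<open>T\<close> permutes the basis vectors up to unimodular factors
  (\<open>disjoint_support_iff_norms\<close> and the locale \<open>lp_isometry\<close>). If \<open>c\<close> is not in \<open>C\<close>, some
  \<open>T e\<^sub>j\<close> is a unimodular multiple of the generator of index \<open>2 c\<close>; if \<open>c\<close> is in \<open>C\<close>, then every
  multiple of this generator of comparable size stays away from all multiples of single basis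
  vectors. A search through the outputs of the program for \<open>T\<close> therefore confirms that \<open>c\<close> is
  not in \<open>C\<close>, so the complement of \<open>C\<close> is semidecidable with the oracle. As \<open>C\<close> is semidecidable
  too, the oracle decides it (\<open>decidable_active_if_computes_isometry\<close>).

  Programs are never written down. Functions on tuples that are computable are closed under the
  usual operations, and predicates with a decidable confirmation at a stage are closed under
  existential and bounded universal quantification; halting of a program with a given output is
  such a predicate (\<open>semidecidable_runs\<close>). Real numbers enter only through confirmable strict
  inequalities, and these reduce to inequalities between natural numbers
  (\<open>approximable_nat_powr\<close>, \<open>semidecidable_norm_less\<close>).
\<close>

section \<open>Computable functions of tuples\<close>

text \<open>
  A function of several arguments is a function on nested pairs; a program sees the pair as the
  flat list of its components. Projections, pairing and composition then take over all
  bookkeeping of argument positions, and recursion only has to mention its own two new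
  arguments.
\<close>

class tuple =
  fixes entries :: "'a \<Rightarrow> nat list" and arity :: "'a itself \<Rightarrow> nat"
  assumes length_entries: "length (entries x) = arity TYPE('a)"

instantiation nat :: tuple
begin
definition entries_nat :: "nat \<Rightarrow> nat list" where "entries_nat n = [n]"
definition arity_nat :: "nat itself \<Rightarrow> nat" where "arity_nat _ = 1"
instance by standard (simp add: entries_nat_def arity_nat_def)
end

instantiation prod :: (tuple, tuple) tuple
begin
definition entries_prod :: "'a \<times> 'b \<Rightarrow> nat list" where
  "entries_prod z = entries (fst z) @ entries (snd z)"
definition arity_prod :: "('a \<times> 'b) itself \<Rightarrow> nat" where
  "arity_prod _ = arity TYPE('a) + arity TYPE('b)"
instance by standard (simp add: entries_prod_def arity_prod_def length_entries)
end

text \<open>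
  One program for each component of the result: this is the form of the second argument of
  \<^const>\<open>Comp\<close>, so that composition of functions is composition of programs.
\<close>

definition computable :: "nat set \<Rightarrow> ('a::tuple \<Rightarrow> 'b::tuple) \<Rightarrow> bool" where
  "computable X f \<longleftrightarrow>
     (\<exists>Ps. \<forall>x. list_all2 (\<lambda>P y. runs X P (entries x) y) Ps (entries (f x)))"

definition decidable :: "nat set \<Rightarrow> ('a::tuple \<Rightarrow> bool) \<Rightarrow> bool" where
  "decidable X R \<longleftrightarrow> computable X (\<lambda>x. of_bool (R x) :: nat)"

named_theorems computable_intros

lemma computable_nat_iff:
  fixes f :: "'a::tuple \<Rightarrow> nat"
  shows "computable X f \<longleftrightarrow> (\<exists>P. \<forall>x. runs X P (entries x) (f x))"
proof
  assume "computable X f"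
  then obtain Ps where Ps: "list_all2 (\<lambda>P y. runs X P (entries x) y) Ps [f x]" for x
    unfolding computable_def entries_nat_def by blast
  then obtain P where "Ps = [P]"
    by (metis (no_types, lifting) list_all2_Cons2 list_all2_Nil2)
  with Ps show "\<exists>P. \<forall>x. runs X P (entries x) (f x)"
    by auto
next
  assume "\<exists>P. \<forall>x. runs X P (entries x) (f x)"
  then obtain P where "\<And>x. runs X P (entries x) (f x)"
    by blast
  then have "\<forall>x. list_all2 (\<lambda>P y. runs X P (entries x) y) [P] (entries (f x))"
    by (simp add: entries_nat_def)
  then show "computable X f"
    unfolding computable_def by blast
qed

lemma computable_compose:
  fixes f :: "'b::tuple \<Rightarrow> 'c::tuple" and g :: "'a::tuple \<Rightarrow> 'b"
  assumes "computable X f" and "computable X g"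
  shows "computable X (\<lambda>x. f (g x))"
proof -
  obtain Ps where Ps: "\<And>y. list_all2 (\<lambda>P z. runs X P (entries y) z) Ps (entries (f y))"
    using assms(1) unfolding computable_def by blast
  obtain Qs where Qs: "\<And>x. list_all2 (\<lambda>P y. runs X P (entries x) y) Qs (entries (g x))"
    using assms(2) unfolding computable_def by blast
  have "list_all2 (\<lambda>P z. runs X P (entries x) z) (map (\<lambda>P. Comp P Qs) Ps) (entries (f (g x)))" for x
    unfolding list_all2_map1 using Ps
    by (rule list_all2_mono) (rule runs.comp[OF Qs])
  then show ?thesis
    unfolding computable_def by blast
qed

lemma computable_select:
  fixes f :: "'a::tuple \<Rightarrow> 'b::tuple"
  assumes "\<And>x. entries (f x) = take n (drop m (entries x))" and "m + n \<le> arity TYPE('a)"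
  shows "computable X f"
proof -
  have "list_all2 (\<lambda>P y. runs X P (entries x) y) (map Proj [m..<m + n]) (entries (f x))" for x
    unfolding list_all2_conv_all_nth assms(1)
  proof (intro conjI allI impI)
    show "length (map Proj [m..<m + n]) = length (take n (drop m (entries x)))"
      using assms(2) by (simp add: length_entries)
    fix i assume "i < length (map Proj [m..<m + n])"
    then have i: "i < n"
      by simp
    then have "runs X (Proj (m + i)) (entries x) (entries x ! (m + i))"
      using assms(2) by (intro runs.proj) (simp add: length_entries)
    then show "runs X (map Proj [m..<m + n] ! i) (entries x) (take n (drop m (entries x)) ! i)"
      using i assms(2) by (simp add: length_entries)
  qed
  then show ?thesis
    unfolding computable_def by blast
qed

lemma computable_id [computable_intros]: "computable X (\<lambda>x::'a::tuple. x)"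
  by (rule computable_select[where m = 0 and n = "arity TYPE('a)"]) (simp_all add: length_entries)

lemma computable_fst [computable_intros]:
  fixes f :: "'a::tuple \<Rightarrow> 'b::tuple \<times> 'c::tuple"
  assumes "computable X f"
  shows "computable X (\<lambda>x. fst (f x))"
proof (rule computable_compose[OF _ assms])
  show "computable X (fst :: 'b \<times> 'c \<Rightarrow> 'b)"
    by (rule computable_select[where m = 0 and n = "arity TYPE('b)"])
      (simp_all add: entries_prod_def length_entries arity_prod_def)
qed

lemma computable_snd [computable_intros]:
  fixes f :: "'a::tuple \<Rightarrow> 'b::tuple \<times> 'c::tuple"
  assumes "computable X f"
  shows "computable X (\<lambda>x. snd (f x))"
proof (rule computable_compose[OF _ assms])
  show "computable X (snd :: 'b \<times> 'c \<Rightarrow> 'c)"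
    by (rule computable_select[where m = "arity TYPE('b)" and n = "arity TYPE('c)"])
      (simp_all add: entries_prod_def length_entries arity_prod_def)
qed

lemma computable_Pair [computable_intros]:
  fixes f :: "'a::tuple \<Rightarrow> 'b::tuple" and g :: "'a \<Rightarrow> 'c::tuple"
  assumes "computable X f" and "computable X g"
  shows "computable X (\<lambda>x. (f x, g x))"
proof -
  obtain Ps where Ps: "\<And>x. list_all2 (\<lambda>P y. runs X P (entries x) y) Ps (entries (f x))"
    using assms(1) unfolding computable_def by blast
  obtain Qs where Qs: "\<And>x. list_all2 (\<lambda>P y. runs X P (entries x) y) Qs (entries (g x))"
    using assms(2) unfolding computable_def by blast
  have "list_all2 (\<lambda>P y. runs X P (entries x) y) (Ps @ Qs) (entries (f x, g x))" for x
    by (simp add: entries_prod_def list_all2_appendI Ps Qs)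
  then show ?thesis
    unfolding computable_def by blast
qed

lemma computable2:
  assumes "computable X (\<lambda>z. h (fst z) (snd z))" and "computable X f" and "computable X g"
  shows "computable X (\<lambda>x. h (f x) (g x))"
  using computable_compose[OF assms(1) computable_Pair[OF assms(2,3)]] by simp

lemma computable_Suc [computable_intros]:
  assumes "computable X f"
  shows "computable X (\<lambda>x. Suc (f x))"
proof (rule computable_compose[OF _ assms])
  show "computable X Suc"
    unfolding computable_nat_iff entries_nat_def using runs.succ[of X] by blast
qed

lemma computable_const [computable_intros]:
  fixes c :: nat
  shows "computable X (\<lambda>x. c)"
proof (induction c)
  case 0
  show ?case
    unfolding computable_nat_iff using runs.zero[of X] by blast
qed (rule computable_Suc)

lemma decidable_oracle [computable_intros]:
  assumes "computable X f"
  shows "decidable X (\<lambda>x. f x \<in> X)"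
  unfolding decidable_def
proof (rule computable_compose[OF _ assms])
  have "runs X Query (entries n) (of_bool (n \<in> X))" for n
    using runs.query[of X n "[]"] by (cases "n \<in> X") (simp_all add: entries_nat_def)
  then show "computable X (\<lambda>n. of_bool (n \<in> X) :: nat)"
    unfolding computable_nat_iff by blast
qed

text \<open>
  The step function of \<^const>\<open>PrimRec\<close> receives the counter and the previous value in front of the
  parameters; hence its argument is a triple with the parameters as the last component.
\<close>

lemma computable_rec_nat [computable_intros]:
  fixes a :: "'a::tuple \<Rightarrow> nat"
  assumes "computable X a" and "computable X n"
    and "computable X (\<lambda>z. g (fst z) (fst (snd z)) (snd (snd z)))"
  shows "computable X (\<lambda>x. rec_nat (a x) (\<lambda>k r. g k r x) (n x))"
proof -
  have "computable X (\<lambda>z. rec_nat (a (snd z)) (\<lambda>k r. g k r (snd z)) (fst z))"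
  proof -
    obtain P where P: "\<And>x. runs X P (entries x) (a x)"
      using assms(1) unfolding computable_nat_iff by blast
    obtain Q where Q: "\<And>z. runs X Q (entries z) (g (fst z) (fst (snd z)) (snd (snd z)))"
      using assms(3) unfolding computable_nat_iff by blast
    have "runs X (PrimRec P Q) (n # entries x) (rec_nat (a x) (\<lambda>k r. g k r x) n)" for n x
    proof (induction n)
      case (Suc n)
      then show ?case
        using Q[of "(n, rec_nat (a x) (\<lambda>k r. g k r x) n, x)"]
        by (auto simp: entries_prod_def entries_nat_def intro: runs.rec_Suc)
    qed (simp add: P runs.rec_0)
    then show ?thesis
      unfolding computable_nat_iff entries_prod_def entries_nat_def by auto
  qed
  from computable_compose[OF this computable_Pair[OF assms(2) computable_id]]
  show ?thesis by simp
qed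

lemma computable_cong: "computable X f \<Longrightarrow> (\<And>x. f x = g x) \<Longrightarrow> computable X g"
  by (erule back_subst[where P = "computable X"]) (rule ext)

lemma decidable_cong: "decidable X f \<Longrightarrow> (\<And>x. f x = g x) \<Longrightarrow> decidable X g"
  by (erule back_subst[where P = "decidable X"]) (rule ext)

lemma computable_add [computable_intros]:
  fixes f g :: "'a::tuple \<Rightarrow> nat"
  assumes "computable X f" and "computable X g"
  shows "computable X (\<lambda>x. f x + g x)"
proof (rule computable_cong)
  show "computable X (\<lambda>x. rec_nat (f x) (\<lambda>k r. Suc r) (g x))"
    by (intro computable_intros assms)
  have "rec_nat a (\<lambda>k r. Suc r) b = a + b" for a b :: nat
    by (induction b) auto
  then show "rec_nat (f x) (\<lambda>k r. Suc r) (g x) = f x + g x" for x .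
qed

lemma computable_mult [computable_intros]:
  fixes f g :: "'a::tuple \<Rightarrow> nat"
  assumes "computable X f" and "computable X g"
  shows "computable X (\<lambda>x. f x * g x)"
proof (rule computable_cong)
  show "computable X (\<lambda>x. rec_nat 0 (\<lambda>k r. r + f x) (g x))"
    by (intro computable_intros computable_compose[OF assms(1)] assms)
  have "rec_nat 0 (\<lambda>k r. r + a) b = a * b" for a b :: nat
    by (induction b) auto
  then show "rec_nat 0 (\<lambda>k r. r + f x) (g x) = f x * g x" for x .
qed

lemma computable_power [computable_intros]:
  fixes f g :: "'a::tuple \<Rightarrow> nat"
  assumes "computable X f" and "computable X g"
  shows "computable X (\<lambda>x. f x ^ g x)"
proof (rule computable_cong)
  show "computable X (\<lambda>x. rec_nat 1 (\<lambda>k r. r * f x) (g x))"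
    by (intro computable_intros computable_compose[OF assms(1)] assms)
  have "rec_nat 1 (\<lambda>k r. r * a) b = a ^ b" for a b :: nat
    by (induction b) (auto simp: mult.commute)
  then show "rec_nat 1 (\<lambda>k r. r * f x) (g x) = f x ^ g x" for x .
qed

text \<open>
  Truncated subtraction iterates the predecessor, which is itself a recursion that returns its
  counter.
\<close>

lemma computable_diff [computable_intros]:
  fixes f g :: "'a::tuple \<Rightarrow> nat"
  assumes "computable X f" and "computable X g"
  shows "computable X (\<lambda>x. f x - g x)"
proof (rule computable_cong)
  show "computable X (\<lambda>x. rec_nat (f x) (\<lambda>k r. rec_nat 0 (\<lambda>i _. i) r) (g x))"
    by (intro computable_intros assms)
  have pred: "rec_nat 0 (\<lambda>i _. i) n = n - 1" for n
    by (cases n) auto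
  have "rec_nat a (\<lambda>k r. rec_nat 0 (\<lambda>i _. i) r) b = a - b" for a b :: nat
    by (induction b) (auto simp: pred)
  then show "rec_nat (f x) (\<lambda>k r. rec_nat 0 (\<lambda>i _. i) r) (g x) = f x - g x" for x .
qed

lemma computable_sum [computable_intros]:
  fixes f :: "nat \<Rightarrow> 'a::tuple \<Rightarrow> nat"
  assumes "computable X (\<lambda>z. f (fst z) (snd z))" and "computable X n"
  shows "computable X (\<lambda>x. \<Sum>i<n x. f i x)"
proof (rule computable_cong)
  show "computable X (\<lambda>x. rec_nat 0 (\<lambda>k r. r + f k x) (n x))"
    by (intro computable_intros assms computable2[OF assms(1)])
  have "rec_nat 0 (\<lambda>k r. r + f k x) m = (\<Sum>i<m. f i x)" for m x
    by (induction m) auto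
  then show "rec_nat 0 (\<lambda>k r. r + f k x) (n x) = (\<Sum>i<n x. f i x)" for x .
qed

lemma computable_prod [computable_intros]:
  fixes f :: "nat \<Rightarrow> 'a::tuple \<Rightarrow> nat"
  assumes "computable X (\<lambda>z. f (fst z) (snd z))" and "computable X n"
  shows "computable X (\<lambda>x. \<Prod>i<n x. f i x)"
proof (rule computable_cong)
  show "computable X (\<lambda>x. rec_nat 1 (\<lambda>k r. r * f k x) (n x))"
    by (intro computable_intros assms computable2[OF assms(1)])
  have "rec_nat 1 (\<lambda>k r. r * f k x) m = (\<Prod>i<m. f i x)" for m x
    by (induction m) auto
  then show "rec_nat 1 (\<lambda>k r. r * f k x) (n x) = (\<Prod>i<n x. f i x)" for x .
qed

lemma decidable_le [computable_intros]:
  fixes f g :: "'a::tuple \<Rightarrow> nat"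
  assumes "computable X f" and "computable X g"
  shows "decidable X (\<lambda>x. f x \<le> g x)"
  unfolding decidable_def
  by (rule computable_cong[where f = "\<lambda>x. 1 - (f x - g x)"]) (intro computable_intros assms, simp)

lemma decidable_not [computable_intros]:
  assumes "decidable X R"
  shows "decidable X (\<lambda>x. \<not> R x)"
  unfolding decidable_def
  by (rule computable_cong[where f = "\<lambda>x. 1 - of_bool (R x)"])
    (intro computable_intros assms[unfolded decidable_def], simp)

lemma decidable_conj [computable_intros]:
  assumes "decidable X R" and "decidable X S"
  shows "decidable X (\<lambda>x. R x \<and> S x)"
  using computable_mult[OF assms[unfolded decidable_def]]
  unfolding decidable_def by (simp add: of_bool_conj)

lemma decidable_disj [computable_intros]:
  assumes "decidable X R" and "decidable X S"
  shows "decidable X (\<lambda>x. R x \<or> S x)"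
  using decidable_not[OF decidable_conj[OF assms[THEN decidable_not]]] by simp

lemma decidable_less [computable_intros]:
  fixes f g :: "'a::tuple \<Rightarrow> nat"
  assumes "computable X f" and "computable X g"
  shows "decidable X (\<lambda>x. f x < g x)"
  using decidable_le[OF computable_Suc[OF assms(1)] assms(2)] by (simp add: Suc_le_eq)

lemma decidable_eq [computable_intros]:
  fixes f g :: "'a::tuple \<Rightarrow> nat"
  assumes "computable X f" and "computable X g"
  shows "decidable X (\<lambda>x. f x = g x)"
  by (rule decidable_cong[OF decidable_conj[OF decidable_le[OF assms] decidable_le[OF assms(2,1)]]])
    auto

lemma decidable_bex [computable_intros]:
  fixes R :: "nat \<Rightarrow> 'a::tuple \<Rightarrow> bool"
  assumes "decidable X (\<lambda>z. R (fst z) (snd z))" and "computable X n"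
  shows "decidable X (\<lambda>x. \<exists>i<n x. R i x)"
proof (rule decidable_cong)
  show "decidable X (\<lambda>x. 0 < (\<Sum>i<n x. of_bool (R i x) :: nat))"
    by (intro computable_intros assms(2) assms(1)[unfolded decidable_def])
  show "(0 < (\<Sum>i<n x. of_bool (R i x) :: nat)) = (\<exists>i<n x. R i x)" for x
    by (auto simp: sum_pos2 simp flip: neq0_conv)
qed

lemma decidable_ball [computable_intros]:
  fixes R :: "nat \<Rightarrow> 'a::tuple \<Rightarrow> bool"
  assumes "decidable X (\<lambda>z. R (fst z) (snd z))" and "computable X n"
  shows "decidable X (\<lambda>x. \<forall>i<n x. R i x)"
  using decidable_not[OF decidable_bex[OF decidable_not[OF assms(1)] assms(2)]] by simp

lemma computable_of_bool [computable_intros]: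
  "decidable X R \<Longrightarrow> computable X (\<lambda>x. of_bool (R x) :: nat)"
  by (simp add: decidable_def)

lemma computable_if [computable_intros]:
  fixes f g :: "'a::tuple \<Rightarrow> nat"
  assumes "decidable X R" and "computable X f" and "computable X g"
  shows "computable X (\<lambda>x. if R x then f x else g x)"
  by (rule computable_cong[where f = "\<lambda>x. of_bool (R x) * f x + of_bool (\<not> R x) * g x"])
    (intro computable_intros assms, simp)

lemma decidable_compose:
  assumes "decidable X R" and "computable X g"
  shows "decidable X (\<lambda>x. R (g x))"
  using computable_compose[OF assms(1)[unfolded decidable_def] assms(2)] by (simp add: decidable_def)

lemma decidable2:
  assumes "decidable X (\<lambda>z. R (fst z) (snd z))" and "computable X f" and "computable X g"
  shows "decidable X (\<lambda>x. R (f x) (g x))"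
  using decidable_compose[OF assms(1) computable_Pair[OF assms(2,3)]] by simp

text \<open>
  All unbounded search goes through this lemma.
\<close>

lemma computable_Least:
  fixes R :: "nat \<Rightarrow> 'a::tuple \<Rightarrow> bool"
  assumes "decidable X (\<lambda>z. R (fst z) (snd z))" and "\<And>x. \<exists>n. R n x"
  shows "computable X (\<lambda>x. LEAST n. R n x)"
proof -
  have "computable X (\<lambda>z. of_bool (\<not> R (fst z) (snd z)) :: nat)"
    by (intro computable_intros assms)
  then obtain P where P: "\<And>z. runs X P (entries z) (of_bool (\<not> R (fst z) (snd z)))"
    unfolding computable_nat_iff by blast
  have P': "runs X P (n # entries x) (of_bool (\<not> R n x))" for n x
    using P[of "(n, x)"] by (simp add: entries_prod_def entries_nat_def)
  have "runs X (Mu P) (entries x) (LEAST n. R n x)" for x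
  proof (rule runs.mu)
    show "runs X P ((LEAST n. R n x) # entries x) 0"
      using P'[of "LEAST n. R n x" x] LeastI_ex[OF assms(2)[of x]] by simp
    fix m assume "m < (LEAST n. R n x)"
    then show "\<exists>k. runs X P (m # entries x) (Suc k)"
      using P'[of m x] not_less_Least[of m "\<lambda>n. R n x"] by auto
  qed
  then show ?thesis
    unfolding computable_nat_iff by blast
qed

lemma computable_div [computable_intros]:
  fixes f g :: "'a::tuple \<Rightarrow> nat"
  assumes "computable X f" and "computable X g"
  shows "computable X (\<lambda>x. f x div g x)"
proof -
  have *: "\<exists>q. b = 0 \<or> a < b * Suc q" "(LEAST q. b = 0 \<or> a < b * Suc q) = a div b" for a b :: nat
  proof -
    show ex: "\<exists>q. b = 0 \<or> a < b * Suc q"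
      by (metis div_less_iff_less_mult lessI mult.commute neq0_conv)
    show "(LEAST q. b = 0 \<or> a < b * Suc q) = a div b"
    proof (rule Least_equality)
      show "b = 0 \<or> a < b * Suc (a div b)"
        using dividend_less_times_div[of b a] by auto
      fix q assume "b = 0 \<or> a < b * Suc q"
      then show "a div b \<le> q"
        by (auto simp: less_mult_imp_div_less mult.commute simp flip: less_Suc_eq_le)
    qed
  qed
  show ?thesis
    by (intro computable_cong[where f = "\<lambda>x. LEAST q. g x = 0 \<or> f x < g x * Suc q",
          OF computable_Least] computable_intros computable_compose[OF assms(1)]
        computable_compose[OF assms(2)] *)
qed

lemma computable_mod [computable_intros]:
  fixes f g :: "'a::tuple \<Rightarrow> nat"
  assumes "computable X f" and "computable X g"
  shows "computable X (\<lambda>x. f x mod g x)"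
  unfolding minus_mult_div_eq_mod[symmetric] by (intro computable_intros assms)

lemma computable_prod_encode [computable_intros]:
  assumes "computable X f" and "computable X g"
  shows "computable X (\<lambda>x. prod_encode (f x, g x))"
  unfolding prod_encode_def triangle_def split_conv by (intro computable_intros assms)

lemma computable_fst_prod_decode [computable_intros]:
  assumes "computable X f"
  shows "computable X (\<lambda>x. fst (prod_decode (f x)))"
proof -
  have *: "\<exists>b<Suc n. prod_encode (fst (prod_decode n), b) = n" for n
    using le_prod_encode_2[of "snd (prod_decode n)" "fst (prod_decode n)"]
    by (intro exI[of _ "snd (prod_decode n)"]) simp
  have "(LEAST a. \<exists>b<Suc n. prod_encode (a, b) = n) = fst (prod_decode n)" for n
    using * by (rule Least_equality) (metis fst_conv order_refl prod_encode_inverse)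
  then show ?thesis
    by (intro computable_cong[where f = "\<lambda>x. LEAST a. \<exists>b<Suc (f x). prod_encode (a, b) = f x",
          OF computable_Least] computable_intros computable_compose[OF assms])
      (use * in blast)+
qed

lemma computable_snd_prod_decode [computable_intros]:
  assumes "computable X f"
  shows "computable X (\<lambda>x. snd (prod_decode (f x)))"
proof -
  have *: "\<exists>a<Suc n. prod_encode (a, snd (prod_decode n)) = n" for n
    using le_prod_encode_1[of "fst (prod_decode n)" "snd (prod_decode n)"]
    by (intro exI[of _ "fst (prod_decode n)"]) simp
  have "(LEAST b. \<exists>a<Suc n. prod_encode (a, b) = n) = snd (prod_decode n)" for n
    using * by (rule Least_equality) (metis snd_conv order_refl prod_encode_inverse)
  then show ?thesis
    by (intro computable_cong[where f = "\<lambda>x. LEAST b. \<exists>a<Suc (f x). prod_encode (a, b) = f x",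
          OF computable_Least] computable_intros computable_compose[OF assms])
      (use * in blast)+
qed

section \<open>Coded lists\<close>

text \<open>
  A code is 0 or the successor of the code of a pair of head and tail. Since
  \<open>prod_decode 0 = (0, 0)\<close>, the tail of the empty list is empty again and its head reads as 0.
\<close>

definition code_drop :: "nat \<Rightarrow> nat \<Rightarrow> nat" where
  "code_drop c i = rec_nat c (\<lambda>_ r. snd (prod_decode (r - 1))) i"

text \<open>
  Positions beyond the end of the list read as 0. As 0 is also the code of the Gaussian
  rational 0, a coded vector extends by zero coefficients, and every bound on the length of the
  list can serve as the number of its entries.
\<close>

definition code_nth :: "nat \<Rightarrow> nat \<Rightarrow> nat" where
  "code_nth c i = fst (prod_decode (code_drop c i - 1))"

lemma prod_decode_0: "prod_decode 0 = (0, 0)"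
  by (simp add: prod_decode_def prod_decode_aux.simps)

lemma list_decode_tl: "list_decode (snd (prod_decode (c - 1))) = tl (list_decode c)"
  by (cases c) (simp_all add: prod_decode_0 split: prod.split)

lemma list_decode_drop: "list_decode (code_drop c i) = drop i (list_decode c)"
  unfolding code_drop_def
  by (induction i) (simp_all add: list_decode_tl[unfolded One_nat_def] drop_Suc tl_drop)

lemma list_decode_eq_Nil: "list_decode c = [] \<longleftrightarrow> c = 0"
  by (cases c) (simp_all split: prod.split)

lemma code_drop_eq_0: "code_drop c i = 0 \<longleftrightarrow> length (list_decode c) \<le> i"
  using list_decode_eq_Nil[of "code_drop c i"] by (simp add: list_decode_drop)

lemma code_nth_eq:
  "code_nth c i = (if i < length (list_decode c) then list_decode c ! i else 0)"
proof (cases "code_drop c i")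
  case 0
  then show ?thesis
    using code_drop_eq_0[of c i] by (simp add: code_nth_def prod_decode_0)
next
  case (Suc m)
  then have "list_decode c ! i = fst (prod_decode m)" and "i < length (list_decode c)"
    using list_decode_drop[of c i] code_drop_eq_0[of c i]
    by (simp_all split: prod.splits add: not_le) (metis nth_via_drop)
  then show ?thesis
    using Suc by (simp add: code_nth_def)
qed

lemma length_list_decode_le: "length (list_decode c) \<le> c"
proof (induction c rule: less_induct)
  case (less c)
  show ?case
  proof (cases c)
    case (Suc m)
    have "snd (prod_decode m) \<le> m"
      using le_prod_encode_2[of "snd (prod_decode m)" "fst (prod_decode m)"] by simp
    then show ?thesis
      using less.IH[of "snd (prod_decode m)"] Suc by (auto split: prod.split)
  qed simp
qed

lemma computable_code_drop [computable_intros]: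
  assumes "computable X c" and "computable X i"
  shows "computable X (\<lambda>x. code_drop (c x) (i x))"
  unfolding code_drop_def by (intro computable_intros assms)

lemma computable_code_nth [computable_intros]:
  assumes "computable X c" and "computable X i"
  shows "computable X (\<lambda>x. code_nth (c x) (i x))"
  unfolding code_nth_def by (intro computable_intros assms)

text \<open>
  The list is built from its last entry on, which is entry \<open>n - Suc k\<close> at step \<open>k\<close>.
\<close>

lemma computable_list_encode_map [computable_intros]:
  fixes n :: "'a::tuple \<Rightarrow> nat"
  assumes "computable X (\<lambda>z. f (fst z) (snd z))" and "computable X n"
  shows "computable X (\<lambda>x. list_encode (map (\<lambda>i. f i x) [0..<n x]))"
proof (rule computable_cong)
  show "computable X (\<lambda>x. rec_nat 0 (\<lambda>k r. Suc (prod_encode (f (n x - Suc k) x, r))) (n x))"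
    by (intro computable_intros assms computable2[OF assms(1)] computable_compose[OF assms(2)])
  have "rec_nat 0 (\<lambda>k r. Suc (prod_encode (f (n x - Suc k) x, r))) m
      = list_encode (map (\<lambda>i. f i x) [n x - m..<n x])" if "m \<le> n x" for m x
    using that
  proof (induction m)
    case (Suc m)
    then have "[n x - Suc m..<n x] = (n x - Suc m) # [n x - m..<n x]"
      by (metis Suc_diff_Suc Suc_le_lessD diff_less upt_conv_Cons zero_less_Suc less_le_trans)
    then show ?case
      using Suc by simp
  qed simp
  then show "rec_nat 0 (\<lambda>k r. Suc (prod_encode (f (n x - Suc k) x, r))) (n x)
      = list_encode (map (\<lambda>i. f i x) [0..<n x])" for x
    by simp
qed

lemma code_nth_list_encode_map:
  "code_nth (list_encode (map s [0..<n])) i = (if i < n then s i else 0)"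
  by (simp add: code_nth_eq)

section \<open>Semidecidable predicates\<close>

text \<open>
  The number \<open>s\<close> is a stage at which \<open>R x\<close> has been confirmed. Predicates of this form are
  easier to compose than partial programs, because every program that occurs is total.
\<close>

definition semidecidable :: "nat set \<Rightarrow> ('a::tuple \<Rightarrow> bool) \<Rightarrow> bool" where
  "semidecidable X R \<longleftrightarrow> (\<exists>Q. decidable X (\<lambda>z. Q (fst z) (snd z)) \<and> (\<forall>x. R x \<longleftrightarrow> (\<exists>s::nat. Q s x)))"

named_theorems semidecidable_intros

lemma semidecidable_cong: "semidecidable X f \<Longrightarrow> (\<And>x. f x = g x) \<Longrightarrow> semidecidable X g"
  by (erule back_subst[where P = "semidecidable X"]) (rule ext)

lemma semidecidable_decidable:
  assumes "decidable X R"
  shows "semidecidable X R"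
  unfolding semidecidable_def
  by (rule exI[of _ "\<lambda>_. R"]) (simp add: decidable_compose[OF assms] computable_intros)

lemma semidecidable_compose:
  assumes "semidecidable X R" and "computable X g"
  shows "semidecidable X (\<lambda>x. R (g x))"
proof -
  obtain Q where Q: "decidable X (\<lambda>z. Q (fst z) (snd z))" "\<And>x. R x \<longleftrightarrow> (\<exists>s::nat. Q s x)"
    using assms(1) unfolding semidecidable_def by blast
  have "decidable X (\<lambda>z. Q (fst z) (g (snd z)))"
    by (intro decidable2[OF Q(1)] computable_compose[OF assms(2)] computable_intros)
  with Q(2) show ?thesis
    unfolding semidecidable_def by (intro exI[of _ "\<lambda>s x. Q s (g x)"]) simp
qed

lemma semidecidable2:
  assumes "semidecidable X (\<lambda>z. R (fst z) (snd z))" and "computable X f" and "computable X g"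
  shows "semidecidable X (\<lambda>x. R (f x) (g x))"
  using semidecidable_compose[OF assms(1) computable_Pair[OF assms(2,3)]] by simp

lemma semidecidable_ex [semidecidable_intros]:
  fixes R :: "nat \<Rightarrow> 'a::tuple \<Rightarrow> bool"
  assumes "semidecidable X (\<lambda>z. R (fst z) (snd z))"
  shows "semidecidable X (\<lambda>x. \<exists>n. R n x)"
proof -
  obtain Q where Q: "decidable X (\<lambda>z. Q (fst z) (snd z))"
    "\<And>z. R (fst z) (snd z) \<longleftrightarrow> (\<exists>s::nat. Q s z)"
    using assms unfolding semidecidable_def by blast
  let ?Q = "\<lambda>s x. Q (fst (prod_decode s)) (snd (prod_decode s), x)"
  have "decidable X (\<lambda>z. ?Q (fst z) (snd z))"
    by (intro decidable2[OF Q(1)] computable_intros)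
  moreover have "(\<exists>n. R n x) \<longleftrightarrow> (\<exists>s. ?Q s x)" for x
    using Q(2)[of "(n, x)" for n] by (metis fst_conv prod_encode_inverse snd_conv)
  ultimately show ?thesis
    unfolding semidecidable_def by (intro exI[of _ ?Q]) simp
qed

lemma semidecidable_conj [semidecidable_intros]:
  assumes "semidecidable X R" and "semidecidable X S"
  shows "semidecidable X (\<lambda>x. R x \<and> S x)"
proof -
  obtain Q where Q: "decidable X (\<lambda>z. Q (fst z) (snd z))" "\<And>x. R x \<longleftrightarrow> (\<exists>s::nat. Q s x)"
    using assms(1) unfolding semidecidable_def by blast
  obtain Q' where Q': "decidable X (\<lambda>z. Q' (fst z) (snd z))" "\<And>x. S x \<longleftrightarrow> (\<exists>s::nat. Q' s x)"
    using assms(2) unfolding semidecidable_def by blast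
  let ?Q = "\<lambda>s x. Q (fst (prod_decode s)) x \<and> Q' (snd (prod_decode s)) x"
  have "decidable X (\<lambda>z. ?Q (fst z) (snd z))"
    by (intro decidable2[OF Q(1)] decidable2[OF Q'(1)] computable_intros)
  moreover have "R x \<and> S x \<longleftrightarrow> (\<exists>s. ?Q s x)" for x
    unfolding Q(2) Q'(2) by (metis fst_conv prod_encode_inverse snd_conv)
  ultimately show ?thesis
    unfolding semidecidable_def by (intro exI[of _ ?Q]) simp
qed

lemma semidecidable_disj [semidecidable_intros]:
  assumes "semidecidable X R" and "semidecidable X S"
  shows "semidecidable X (\<lambda>x. R x \<or> S x)"
proof -
  obtain Q where Q: "decidable X (\<lambda>z. Q (fst z) (snd z))" "\<And>x. R x \<longleftrightarrow> (\<exists>s::nat. Q s x)"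
    using assms(1) unfolding semidecidable_def by blast
  obtain Q' where Q': "decidable X (\<lambda>z. Q' (fst z) (snd z))" "\<And>x. S x \<longleftrightarrow> (\<exists>s::nat. Q' s x)"
    using assms(2) unfolding semidecidable_def by blast
  have "decidable X (\<lambda>z. Q (fst z) (snd z) \<or> Q' (fst z) (snd z))"
    by (intro decidable_disj Q(1) Q'(1))
  with Q(2) Q'(2) show ?thesis
    unfolding semidecidable_def by (intro exI[of _ "\<lambda>s x. Q s x \<or> Q' s x"]) auto
qed

text \<open>
  Finitely many confirmations happen before a common stage, so the bounded quantifier moves
  inside the search for a stage.
\<close>

lemma semidecidable_ball [semidecidable_intros]:
  fixes R :: "nat \<Rightarrow> 'a::tuple \<Rightarrow> bool"
  assumes "semidecidable X (\<lambda>z. R (fst z) (snd z))" and "computable X n"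
  shows "semidecidable X (\<lambda>x. \<forall>i<n x. R i x)"
proof -
  obtain Q where Q: "decidable X (\<lambda>z. Q (fst z) (snd z))"
    "\<And>z. R (fst z) (snd z) \<longleftrightarrow> (\<exists>s::nat. Q s z)"
    using assms unfolding semidecidable_def by blast
  let ?Q = "\<lambda>S x. \<forall>i<n x. \<exists>s<S. Q s (i, x)"
  have "decidable X (\<lambda>z. ?Q (fst z) (snd z))"
    by (intro computable_intros decidable2[OF Q(1)] computable_compose[OF assms(2)])
  moreover have "(\<forall>i<n x. R i x) \<longleftrightarrow> (\<exists>S. ?Q S x)" for x
  proof
    assume "\<forall>i<n x. R i x"
    then have "\<forall>i<n x. \<exists>s. Q s (i, x)"
      using Q(2)[of "(i, x)" for i] by simp
    then obtain s where s: "\<forall>i<n x. Q (s i) (i, x)"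
      by metis
    have "s i < Suc (\<Sum>i<n x. s i)" if "i < n x" for i
      using that by (simp add: less_Suc_eq_le member_le_sum)
    with s show "\<exists>S. ?Q S x"
      by blast
  next
    assume "\<exists>S. ?Q S x"
    then show "\<forall>i<n x. R i x"
      using Q(2)[of "(i, x)" for i] by auto
  qed
  ultimately show ?thesis
    unfolding semidecidable_def by (intro exI[of _ ?Q]) simp
qed

text \<open>
  The search runs over pairs of a stage and a witness and returns the witness.
\<close>

lemma semidecidable_select:
  fixes R :: "nat \<Rightarrow> 'a::tuple \<Rightarrow> bool"
  assumes "semidecidable X (\<lambda>z. R (fst z) (snd z))" and "\<And>x. \<exists>y. R y x"
  obtains g where "computable X g" and "\<And>x. R (g x) x"
proof -
  obtain Q where Q: "decidable X (\<lambda>z. Q (fst z) (snd z))"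
    "\<And>z. R (fst z) (snd z) \<longleftrightarrow> (\<exists>s::nat. Q s z)"
    using assms unfolding semidecidable_def by blast
  let ?Q = "\<lambda>s x. Q (fst (prod_decode s)) (snd (prod_decode s), x)"
  have ex: "\<exists>s. ?Q s x" for x
    using assms(2)[of x] Q(2)[of "(y, x)" for y] by (metis fst_conv prod_encode_inverse snd_conv)
  show thesis
  proof
    show "computable X (\<lambda>x. snd (prod_decode (LEAST s. ?Q s x)))"
      by (intro computable_snd_prod_decode computable_Least decidable2[OF Q(1)] computable_intros ex)
    show "R (snd (prod_decode (LEAST s. ?Q s x))) x" for x
      using LeastI_ex[OF ex[of x]] Q(2)[of "(snd (prod_decode (LEAST s. ?Q s x)), x)"] by auto
  qed
qed

text \<open>
  Post's theorem: searching for a confirmation of either \<open>R x\<close> or its negation always succeeds.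
\<close>

lemma decidable_if_semidecidable:
  fixes R :: "'a::tuple \<Rightarrow> bool"
  assumes "semidecidable X R" and "semidecidable X (\<lambda>x. \<not> R x)"
  shows "decidable X R"
proof -
  let ?S = "\<lambda>(y::nat) x. y = 0 \<and> R x \<or> 0 < y \<and> \<not> R x"
  have S: "semidecidable X (\<lambda>z::nat \<times> 'a. ?S (fst z) (snd z))"
    by (intro semidecidable_intros semidecidable_decidable[OF decidable_eq]
        semidecidable_decidable[OF decidable_less] computable_intros
        semidecidable_compose[OF assms(1)] semidecidable_compose[OF assms(2)])
  have ex: "\<exists>y. ?S y x" for x
    by (cases "R x") auto
  obtain g where g: "computable X g" "\<And>x. ?S (g x) x"
    by (rule semidecidable_select[of X ?S, OF S ex]) blast
  show ?thesis
  proof (rule decidable_cong)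
    show "decidable X (\<lambda>x. g x = 0)"
      by (intro computable_intros g(1))
    show "(g x = 0) = R x" for x
      using g(2)[of x] by auto
  qed
qed

text \<open>
  The sequence \<open>s\<close> of intermediate values turns the recursion into a statement with
  quantifiers, to which the closure properties of semidecidable predicates apply.
\<close>

lemma runs_PrimRec_iff:
  "runs X (PrimRec f g) (n # xs) y \<longleftrightarrow>
     (\<exists>s. runs X f xs (s 0) \<and> (\<forall>k<n. runs X g (k # s k # xs) (s (Suc k))) \<and> y = s n)"
proof (induction n arbitrary: y)
  case 0
  show ?case
    by (auto intro: runs.rec_0 elim: runs_basic exI[of _ "\<lambda>_. y"])
next
  case (Suc n)
  show ?case
  proof
    assume "runs X (PrimRec f g) (Suc n # xs) y"
    then obtain r where r: "runs X (PrimRec f g) (n # xs) r" "runs X g (n # r # xs) y"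
      by (auto elim: runs_PrimRec_Suc)
    then obtain s where "runs X f xs (s 0)" "\<forall>k<n. runs X g (k # s k # xs) (s (Suc k))" "r = s n"
      using Suc.IH by blast
    with r(2) show "\<exists>s. runs X f xs (s 0) \<and> (\<forall>k<Suc n. runs X g (k # s k # xs) (s (Suc k))) \<and> y = s (Suc n)"
      by (intro exI[of _ "s(Suc n := y)"]) (auto simp: less_Suc_eq)
  next
    assume "\<exists>s. runs X f xs (s 0) \<and> (\<forall>k<Suc n. runs X g (k # s k # xs) (s (Suc k))) \<and> y = s (Suc n)"
    then obtain s where "runs X f xs (s 0)" "\<forall>k<Suc n. runs X g (k # s k # xs) (s (Suc k))"
      "y = s (Suc n)"
      by blast
    then show "runs X (PrimRec f g) (Suc n # xs) y"
      using Suc.IH[of "s n"] by (intro runs.rec_Suc[where r = "s n"]) auto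
  qed
qed

lemma runs_Mu_iff:
  "runs X (Mu f) xs n \<longleftrightarrow> runs X f (n # xs) 0 \<and> (\<forall>m<n. \<exists>k. runs X f (m # xs) (Suc k))"
  by (auto intro: runs.mu elim: runs_Mu)

lemma runs_PrimRec_code_iff:
  "runs X (PrimRec f g) xs y \<longleftrightarrow> xs \<noteq> [] \<and>
     (\<exists>d. runs X f (tl xs) (code_nth d 0) \<and>
        (\<forall>k<hd xs. runs X g (k # code_nth d k # tl xs) (code_nth d (Suc k))) \<and>
        y = code_nth d (hd xs))"
proof (cases xs)
  case Nil
  have False if "runs X (PrimRec f g) [] y"
    using that by cases
  with Nil show ?thesis by auto
next
  case (Cons n ys)
  show ?thesis
    unfolding Cons runs_PrimRec_iff
  proof (simp, intro iffI; elim exE conjE)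
    fix s assume "runs X f ys (s 0)" "\<forall>k<n. runs X g (k # s k # ys) (s (Suc k))" "y = s n"
    then show "\<exists>d. runs X f ys (code_nth d 0) \<and>
        (\<forall>k<n. runs X g (k # code_nth d k # ys) (code_nth d (Suc k))) \<and> y = code_nth d n"
      by (intro exI[of _ "list_encode (map s [0..<Suc n])"])
        (simp add: code_nth_list_encode_map del: upt_Suc)
  qed blast
qed

text \<open>
  Halting with a given output is expressed by existential and bounded universal quantifiers
  over numbers, by induction on the program. The subprograms of a program have different numbers
  of arguments, so the argument list is passed as a single code and one type serves all of them.
\<close>

lemma semidecidable_runs_code:
  "semidecidable X (\<lambda>z. runs X P (list_decode (fst z)) (snd z))"
proof (induction P)
  case Zero
  show ?case
    by (rule semidecidable_cong[OF semidecidable_decidable[of X "\<lambda>z. snd z = 0"]], intro computable_intros)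
      (auto intro: runs.zero elim: runs_basic)
next
  case Succ
  have "runs X Succ xs y \<longleftrightarrow> xs \<noteq> [] \<and> y = Suc (hd xs)" for xs y
    by (cases xs) (auto intro: runs.succ elim: runs_basic)
  then have *: "runs X Succ (list_decode c) y \<longleftrightarrow> \<not> c = 0 \<and> y = Suc (code_nth c 0)" for c y
    by (simp add: code_nth_eq list_decode_eq_Nil hd_conv_nth)
  show ?case
    unfolding * by (intro semidecidable_decidable computable_intros)
next
  case (Proj i)
  have "runs X (Proj i) xs y \<longleftrightarrow> i < length xs \<and> y = xs ! i" for xs y
    by (auto intro: runs.proj elim: runs_basic)
  then have *: "runs X (Proj i) (list_decode c) y \<longleftrightarrow> \<not> code_drop c i = 0 \<and> y = code_nth c i" for c y
    by (auto simp: code_nth_eq code_drop_eq_0)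
  show ?case
    unfolding * by (intro semidecidable_decidable computable_intros)
next
  case Query
  have "runs X Query xs y \<longleftrightarrow> xs \<noteq> [] \<and> y = of_bool (hd xs \<in> X)" for xs y
    using runs.query[of X "hd xs" "tl xs"] by (cases xs) (auto elim: runs_basic split: if_splits)
  then have *: "runs X Query (list_decode c) y \<longleftrightarrow> \<not> c = 0 \<and> y = of_bool (code_nth c 0 \<in> X)" for c y
    by (simp add: code_nth_eq list_decode_eq_Nil hd_conv_nth)
  show ?case
    unfolding * by (intro semidecidable_decidable computable_intros)
next
  case (Comp f gs)
  let ?A = "\<lambda>hs c d. list_all2 (\<lambda>g y. runs X g (list_decode c) y) hs (list_decode d)"
  have all: "semidecidable X (\<lambda>z. ?A hs (fst z) (snd z))" if "set hs \<subseteq> set gs" for hs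
    using that
  proof (induction hs)
    case Nil
    show ?case
      by (rule semidecidable_cong[OF semidecidable_decidable[of X "\<lambda>z. snd z = 0"]], intro computable_intros)
        (simp add: list_decode_eq_Nil)
  next
    case (Cons h hs)
    have *: "?A (h # hs) c d \<longleftrightarrow> \<not> d = 0 \<and> runs X h (list_decode c) (code_nth d 0) \<and> ?A hs c (code_drop d 1)"
      for c d
    proof (cases "list_decode d")
      case Nil
      then show ?thesis
        by (simp add: list_decode_eq_Nil)
    next
      case (Cons y ys)
      then have "d \<noteq> 0"
        using list_decode_eq_Nil[of d] by simp
      with Cons show ?thesis
        by (simp add: code_nth_eq list_decode_drop)
    qed
    show ?case
      unfolding *
      by (intro semidecidable_intros semidecidable_decidable[OF decidable_not] computable_intros
          semidecidable2[OF Comp.IH(2)] semidecidable2[OF Cons.IH])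
        (use Cons.prems in auto)
  qed
  have *: "runs X (Comp f gs) (list_decode c) y \<longleftrightarrow> (\<exists>d. ?A gs c d \<and> runs X f (list_decode d) y)" for c y
    by (metis list_encode_inverse runs.comp runs_Comp)
  show ?case
    unfolding * by (intro semidecidable_intros computable_intros semidecidable2[OF all] semidecidable2[OF Comp.IH(1)] order_refl)
next
  case (PrimRec f g)
  have cons: "k # code_nth d k # tl (list_decode c) =
      list_decode (Suc (prod_encode (k, Suc (prod_encode (code_nth d k, code_drop c 1)))))" for k d c
    by (simp add: list_decode_drop drop_Suc)
  have *: "runs X (PrimRec f g) (list_decode c) y \<longleftrightarrow> \<not> c = 0 \<and>
     (\<exists>d. runs X f (list_decode (code_drop c 1)) (code_nth d 0) \<and>
        (\<forall>k<code_nth c 0. runs X g (list_decode (Suc (prod_encode (k, Suc (prod_encode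
           (code_nth d k, code_drop c 1)))))) (code_nth d (Suc k))) \<and>
        y = code_nth d (code_nth c 0))" for c y
    unfolding runs_PrimRec_code_iff cons
    by (auto simp: list_decode_eq_Nil code_nth_eq hd_conv_nth list_decode_drop drop_Suc)
  show ?case
    unfolding *
    by (intro semidecidable_intros semidecidable_decidable[OF decidable_not] semidecidable_decidable[OF decidable_eq]
        computable_intros semidecidable2[OF PrimRec.IH(1)] semidecidable2[OF PrimRec.IH(2)])
next
  case (Mu f)
  have cons: "k # list_decode c = list_decode (Suc (prod_encode (k, c)))" for k c
    by simp
  show ?case
    unfolding runs_Mu_iff cons by (intro semidecidable_intros computable_intros semidecidable2[OF Mu.IH])
qed

lemma semidecidable_runs:
  "semidecidable X (\<lambda>z. runs X P [fst z] (snd z))"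
proof -
  have *: "[n] = list_decode (Suc (prod_encode (n, 0)))" for n
    by simp
  show ?thesis
    unfolding * by (intro semidecidable2[OF semidecidable_runs_code] computable_intros)
qed

section \<open>From the empty oracle to any oracle\<close>

text \<open>
  A query to the empty oracle is answered by 0, but it halts only if there is an argument; the
  projection keeps this.
\<close>

fun without_oracle :: "program \<Rightarrow> program" where
  "without_oracle Query = Comp Zero [Proj 0]"
| "without_oracle (Comp f gs) = Comp (without_oracle f) (map without_oracle gs)"
| "without_oracle (PrimRec f g) = PrimRec (without_oracle f) (without_oracle g)"
| "without_oracle (Mu f) = Mu (without_oracle f)"
| "without_oracle P = P"

lemma runs_without_oracle: "runs {} P xs y \<Longrightarrow> runs X (without_oracle P) xs y"
proof (induction rule: runs.induct)
  case (query x xs)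
  have "runs X (Comp Zero [Proj 0]) (x # xs) 0"
    using runs.proj[of 0 "x # xs" X] by (auto intro!: runs.comp[where ys = "[x]"] runs.zero)
  then show ?case by simp
next
  case (comp xs gs ys f z)
  then show ?case
    by (auto intro!: runs.comp[where ys = ys] simp: list_all2_conv_all_nth)
next
  case (mu f n xs)
  then show ?case
    by (auto intro!: runs.mu)
qed (auto intro: runs.intros)

lemma computable_any_oracle: "computable {} f \<Longrightarrow> computable X f"
proof -
  assume "computable {} f"
  then obtain Ps where Ps: "\<And>x. list_all2 (\<lambda>P y. runs {} P (entries x) y) Ps (entries (f x))"
    unfolding computable_def by blast
  have "list_all2 (\<lambda>P y. runs X P (entries x) y) (map without_oracle Ps) (entries (f x))" for x
    unfolding list_all2_map1 using Ps by (rule list_all2_mono) (rule runs_without_oracle)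
  then show ?thesis
    unfolding computable_def by blast
qed

lemma decidable_any_oracle: "decidable {} R \<Longrightarrow> decidable X R"
  unfolding decidable_def by (rule computable_any_oracle)

lemma semidecidable_any_oracle: "semidecidable {} R \<Longrightarrow> semidecidable X R"
  unfolding semidecidable_def using decidable_any_oracle by blast

section \<open>Integers, rationals and coded vectors\<close>

text \<open>
  Differences of natural numbers make integer arithmetic a matter of addition and
  multiplication.
\<close>

definition computable_int :: "nat set \<Rightarrow> ('a::tuple \<Rightarrow> int) \<Rightarrow> bool" where
  "computable_int X f \<longleftrightarrow>
     (\<exists>g h. computable X g \<and> computable X h \<and> (\<forall>x. f x = int (g x) - int (h x)))"

lemma computable_intI:
  assumes "computable X g" and "computable X h" and "\<And>x. f x = int (g x) - int (h x)"
  shows "computable_int X f"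
  using assms unfolding computable_int_def by blast

lemma computable_intE:
  assumes "computable_int X f"
  obtains g h where "computable X g" and "computable X h" and "f = (\<lambda>x. int (g x) - int (h x))"
  using assms unfolding computable_int_def by (metis ext)

lemma computable_int_of_nat [computable_intros]:
  assumes "computable X f"
  shows "computable_int X (\<lambda>x. int (f x))"
  using assms computable_const by (rule computable_intI) simp

lemma computable_int_0 [computable_intros]: "computable_int X (\<lambda>x. 0)"
  using computable_int_of_nat[OF computable_const[of X 0]] by simp

lemma computable_int_cong: "computable_int X f \<Longrightarrow> (\<And>x. f x = g x) \<Longrightarrow> computable_int X g"
  by (erule back_subst[where P = "computable_int X"]) (rule ext)

lemma computable_int_compose:
  assumes "computable_int X f" and "computable X g"
  shows "computable_int X (\<lambda>x. f (g x))"
proof -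
  obtain a b where f: "computable X a" "computable X b" "f = (\<lambda>x. int (a x) - int (b x))"
    using assms(1) by (rule computable_intE)
  show ?thesis
    using computable_compose[OF f(1) assms(2)] computable_compose[OF f(2) assms(2)]
    by (rule computable_intI) (simp add: f(3))
qed

lemma computable_int2:
  assumes "computable_int X (\<lambda>z. h (fst z) (snd z))" and "computable X f" and "computable X g"
  shows "computable_int X (\<lambda>x. h (f x) (g x))"
  using computable_int_compose[OF assms(1) computable_Pair[OF assms(2,3)]] by simp

lemma computable_int_diff [computable_intros]:
  assumes "computable_int X f" and "computable_int X g"
  shows "computable_int X (\<lambda>x. f x - g x)"
proof -
  obtain a b where f: "computable X a" "computable X b" "f = (\<lambda>x. int (a x) - int (b x))"
    using assms(1) by (rule computable_intE)
  obtain c d where g: "computable X c" "computable X d" "g = (\<lambda>x. int (c x) - int (d x))"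
    using assms(2) by (rule computable_intE)
  show ?thesis
    by (rule computable_intI[where g = "\<lambda>x. a x + d x" and h = "\<lambda>x. b x + c x"])
      (auto intro!: computable_intros f(1,2) g(1,2) simp: f(3) g(3))
qed

lemma computable_int_uminus [computable_intros]:
  assumes "computable_int X f"
  shows "computable_int X (\<lambda>x. - f x)"
  using computable_int_diff[OF computable_int_0 assms] by simp

lemma computable_int_add [computable_intros]:
  assumes "computable_int X f" and "computable_int X g"
  shows "computable_int X (\<lambda>x. f x + g x)"
  using computable_int_diff[OF assms(1) computable_int_diff[OF computable_int_0 assms(2)]] by simp

lemma computable_int_mult [computable_intros]:
  assumes "computable_int X f" and "computable_int X g"
  shows "computable_int X (\<lambda>x. f x * g x)"
proof -
  obtain a b where f: "computable X a" "computable X b" "f = (\<lambda>x. int (a x) - int (b x))"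
    using assms(1) by (rule computable_intE)
  obtain c d where g: "computable X c" "computable X d" "g = (\<lambda>x. int (c x) - int (d x))"
    using assms(2) by (rule computable_intE)
  show ?thesis
    by (rule computable_intI[where g = "\<lambda>x. a x * c x + b x * d x" and h = "\<lambda>x. a x * d x + b x * c x"])
      (auto intro!: computable_intros f(1,2) g(1,2) simp: f(3) g(3) algebra_simps)
qed

lemma computable_nat [computable_intros]:
  assumes "computable_int X f"
  shows "computable X (\<lambda>x. nat (f x))"
  using assms
proof (rule computable_intE)
  fix g h assume "computable X g" "computable X h" and f: "f = (\<lambda>x. int (g x) - int (h x))"
  then have "computable X (\<lambda>x. g x - h x)"
    by (intro computable_intros)
  then show ?thesis
    by (rule computable_cong) (simp add: f nat_diff_distrib)
qed

lemma computable_nat_abs [computable_intros]: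
  assumes "computable_int X f"
  shows "computable X (\<lambda>x. nat \<bar>f x\<bar>)"
  by (rule computable_cong[where f = "\<lambda>x. nat (f x) + nat (0 - f x)"])
    (intro computable_intros assms, simp)

lemma decidable_int_le [computable_intros]:
  assumes "computable_int X f" and "computable_int X g"
  shows "decidable X (\<lambda>x. f x \<le> g x)"
  by (rule decidable_cong[where f = "\<lambda>x. nat (f x - g x) = 0"]) (intro computable_intros assms, simp)

lemma computable_int_if [computable_intros]:
  assumes "decidable X R" and "computable_int X f" and "computable_int X g"
  shows "computable_int X (\<lambda>x. if R x then f x else g x)"
proof (rule computable_int_cong)
  show "computable_int X (\<lambda>x. int (of_bool (R x)) * f x + int (of_bool (\<not> R x)) * g x)"
    by (intro computable_intros assms)
qed simp

lemma int_decode_parity: "int_decode n = (if even n then int (n div 2) else - int (Suc (n div 2)))"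
  by (simp add: int_decode_def sum_decode_def)

lemma computable_int_decode [computable_intros]:
  assumes "computable X f"
  shows "computable_int X (\<lambda>x. int_decode (f x))"
  unfolding int_decode_parity even_iff_mod_2_eq_zero by (intro computable_intros assms)

lemma computable_int_encode [computable_intros]:
  assumes "computable_int X f"
  shows "computable X (\<lambda>x. int_encode (f x))"
proof (rule computable_cong)
  show "computable X (\<lambda>x. if 0 \<le> f x then 2 * nat (f x) else Suc (2 * nat (- f x - int 1)))"
    by (intro computable_intros assms)
qed (simp add: int_encode_def sum_encode_def)

text \<open>
  A code stands for 0 if its denominator is 0, and its denominator may be negative; the
  numerator takes the sign.
\<close>

definition rat_num :: "nat \<Rightarrow> int" where
  "rat_num n = (let a = int_decode (fst (prod_decode n)); b = int_decode (snd (prod_decode n))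
     in if b \<le> 0 then if 0 \<le> b then 0 else - a else a)"

definition rat_den :: "nat \<Rightarrow> nat" where
  "rat_den n = (let b = nat \<bar>int_decode (snd (prod_decode n))\<bar> in if b = 0 then 1 else b)"

lemma rat_den_pos: "0 < rat_den n"
  by (simp add: rat_den_def Let_def)

lemma decode_rat_eq: "decode_rat n = real_of_int (rat_num n) / real (rat_den n)"
  by (auto simp: decode_rat_def nat_to_rat_surj_def rat_num_def rat_den_def Let_def
      case_prod_unfold Fract_of_int_quotient of_rat_divide)

lemma decode_rat_encode:
  "decode_rat (prod_encode (int_encode a, int_encode b)) = real_of_int a / real_of_int b"
  by (simp add: decode_rat_def nat_to_rat_surj_def Fract_of_int_quotient of_rat_divide)

lemma computable_rat_num [computable_intros]:
  assumes "computable X f"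
  shows "computable_int X (\<lambda>x. rat_num (f x))"
  unfolding rat_num_def Let_def by (intro computable_intros assms)

lemma computable_rat_den [computable_intros]:
  assumes "computable X f"
  shows "computable X (\<lambda>x. rat_den (f x))"
  unfolding rat_den_def Let_def by (intro computable_intros assms)

lemma decode_pos_rat_eq:
  "decode_pos_rat r = real (Suc (fst (prod_decode r))) / real (Suc (snd (prod_decode r)))"
  by (simp add: decode_pos_rat_def case_prod_unfold)

lemma decode_pos_rat_pos: "0 < decode_pos_rat r"
  by (simp add: decode_pos_rat_eq)

text \<open>
  A coded vector is written over one common denominator: its coefficients are Gaussian integers
  with parts \<open>vec_re\<close> and \<open>vec_im\<close>, divided by \<open>vec_den\<close>.
\<close>

definition vec_den :: "nat \<Rightarrow> nat" where
  "vec_den c = (\<Prod>i<c. rat_den (fst (prod_decode (code_nth c i))) * rat_den (snd (prod_decode (code_nth c i))))"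

definition vec_re :: "nat \<Rightarrow> nat \<Rightarrow> int" where
  "vec_re c i = rat_num (fst (prod_decode (code_nth c i))) *
     int (vec_den c div rat_den (fst (prod_decode (code_nth c i))))"

definition vec_im :: "nat \<Rightarrow> nat \<Rightarrow> int" where
  "vec_im c i = rat_num (snd (prod_decode (code_nth c i))) *
     int (vec_den c div rat_den (snd (prod_decode (code_nth c i))))"

lemma computable_vec_den [computable_intros]:
  assumes "computable X c"
  shows "computable X (\<lambda>x. vec_den (c x))"
  unfolding vec_den_def by (intro computable_intros computable_compose[OF assms(1)] assms)

lemma computable_vec_re [computable_intros]:
  assumes "computable X c" and "computable X i"
  shows "computable_int X (\<lambda>x. vec_re (c x) (i x))"
  unfolding vec_re_def by (intro computable_intros assms)

lemma computable_vec_im [computable_intros]: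
  assumes "computable X c" and "computable X i"
  shows "computable_int X (\<lambda>x. vec_im (c x) (i x))"
  unfolding vec_im_def by (intro computable_intros assms)

lemma vec_den_pos: "0 < vec_den c"
  by (simp add: vec_den_def rat_den_pos prod_pos)

lemma rat_num_0: "rat_num 0 = 0"
  by (simp add: rat_num_def prod_decode_0 int_decode_parity)

lemma code_nth_beyond: "c \<le> i \<Longrightarrow> code_nth c i = 0"
  using length_list_decode_le[of c] by (simp add: code_nth_eq)

lemma decode_gauss_rat_code_nth:
  "decode_gauss_rat (code_nth c i) =
     Complex (real_of_int (vec_re c i)) (real_of_int (vec_im c i)) / of_nat (vec_den c)"
proof -
  let ?a = "fst (prod_decode (code_nth c i))" and ?b = "snd (prod_decode (code_nth c i))"
  have scale: "real_of_int (z * int (vec_den c div d)) / real (vec_den c) = real_of_int z / real d"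
    if "d dvd vec_den c" for z d
    using that vec_den_pos[of c] by (auto simp: real_of_nat_div field_simps)
  have *: "i < c \<Longrightarrow> rat_den ?a * rat_den ?b dvd vec_den c"
    unfolding vec_den_def by (rule dvd_prodI) auto
  have "decode_rat ?a = real_of_int (vec_re c i) / real (vec_den c)"
  proof (cases "i < c")
    case True
    then show ?thesis
      unfolding vec_re_def decode_rat_eq by (subst scale) (use dvd_mult_left[OF *] in auto)
  qed (simp add: decode_rat_eq vec_re_def code_nth_beyond prod_decode_0 rat_num_0)
  moreover have "decode_rat ?b = real_of_int (vec_im c i) / real (vec_den c)"
  proof (cases "i < c")
    case True
    then show ?thesis
      unfolding vec_im_def decode_rat_eq by (subst scale) (use dvd_mult_right[OF *] in auto)
  qed (simp add: decode_rat_eq vec_im_def code_nth_beyond prod_decode_0 rat_num_0)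
  ultimately show ?thesis
    by (simp add: decode_gauss_rat_def case_prod_unfold complex_eq_iff)
qed

lemma vec_re_beyond: "c \<le> i \<Longrightarrow> vec_re c i = 0"
  by (simp add: vec_re_def code_nth_beyond prod_decode_0 rat_num_0)

lemma vec_im_beyond: "c \<le> i \<Longrightarrow> vec_im c i = 0"
  by (simp add: vec_im_def code_nth_beyond prod_decode_0 rat_num_0)

lemma decode_gauss_rat_0: "decode_gauss_rat 0 = 0"
  by (simp add: decode_gauss_rat_def prod_decode_0 decode_rat_eq rat_num_0 complex_eq_iff)

section \<open>Approximable real functions\<close>

text \<open>
  The error may depend on the parameter but not on \<open>k\<close>. This leniency makes sums and multiples
  free of rescaling, and it suffices to confirm strict inequalities.
\<close>

definition approximable :: "nat set \<Rightarrow> ('a::tuple \<Rightarrow> real) \<Rightarrow> bool" where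
  "approximable X f \<longleftrightarrow> (\<exists>F D. computable X (\<lambda>z. F (fst z) (snd z)) \<and> computable X D \<and>
     (\<forall>k x. \<bar>real (F k x) - 2 ^ k * f x\<bar> \<le> real (D x)))"

lemma approximableE:
  assumes "approximable X f"
  obtains F D where "computable X (\<lambda>z. F (fst z) (snd z))" and "computable X D"
    and "\<And>k x. \<bar>real (F k x) - 2 ^ k * f x\<bar> \<le> real (D x)"
  using assms unfolding approximable_def by blast

lemma approximableI:
  assumes "computable X (\<lambda>z. F (fst z) (snd z))" and "computable X D"
    and "\<And>k x. \<bar>real (F k x) - 2 ^ k * f x\<bar> \<le> real (D x)"
  shows "approximable X f"
  using assms unfolding approximable_def by blast

lemma approximable_compose:
  assumes "approximable X f" and "computable X g"
  shows "approximable X (\<lambda>x. f (g x))"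
proof -
  obtain F D where F: "computable X (\<lambda>z. F (fst z) (snd z))" "computable X D"
    "\<And>k x. \<bar>real (F k x) - 2 ^ k * f x\<bar> \<le> real (D x)"
    using assms(1) by (rule approximableE) blast
  show ?thesis
    by (rule approximableI[where F = "\<lambda>k x. F k (g x)" and D = "\<lambda>x. D (g x)"])
      (intro computable2[OF F(1)] computable_intros computable_compose[OF assms(2)] computable_compose[OF F(2)] assms(2) F(3))+
qed

lemma approximable_sum:
  fixes f :: "nat \<Rightarrow> 'a::tuple \<Rightarrow> real"
  assumes "approximable X (\<lambda>z. f (fst z) (snd z))" and "computable X n"
  shows "approximable X (\<lambda>x. \<Sum>i<n x. f i x)"
proof -
  obtain F D where F: "computable X (\<lambda>z. F (fst z) (snd z))" "computable X D"
    "\<And>k z. \<bar>real (F k z) - 2 ^ k * f (fst z) (snd z)\<bar> \<le> real (D z)"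
    using assms(1) by (rule approximableE) blast
  show ?thesis
  proof (rule approximableI)
    show "computable X (\<lambda>z. \<Sum>i<n (snd z). F (fst z) (i, snd z))"
      by (intro computable_intros computable2[OF F(1)] computable_compose[OF assms(2)])
    show "computable X (\<lambda>x. \<Sum>i<n x. D (i, x))"
      by (intro computable_intros computable_compose[OF F(2)] assms(2))
    fix k x
    have "\<bar>real (\<Sum>i<n x. F k (i, x)) - 2 ^ k * (\<Sum>i<n x. f i x)\<bar>
        = \<bar>\<Sum>i<n x. real (F k (i, x)) - 2 ^ k * f i x\<bar>"
      by (simp add: sum_subtractf sum_distrib_left)
    also have "\<dots> \<le> (\<Sum>i<n x. \<bar>real (F k (i, x)) - 2 ^ k * f i x\<bar>)"
      by (rule sum_abs)
    also have "\<dots> \<le> (\<Sum>i<n x. real (D (i, x)))"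
      using F(3)[of k "(i, x)" for i] by (intro sum_mono) auto
    finally show "\<bar>real (\<Sum>i<n x. F k (i, x)) - 2 ^ k * (\<Sum>i<n x. f i x)\<bar> \<le> real (\<Sum>i<n x. D (i, x))"
      by simp
  qed
qed

lemma approximable_mult_nat:
  assumes "computable X c" and "approximable X f"
  shows "approximable X (\<lambda>x. real (c x) * f x)"
proof -
  obtain F D where F: "computable X (\<lambda>z. F (fst z) (snd z))" "computable X D"
    "\<And>k x. \<bar>real (F k x) - 2 ^ k * f x\<bar> \<le> real (D x)"
    using assms(2) by (rule approximableE) blast
  show ?thesis
  proof (rule approximableI)
    show "computable X (\<lambda>z. c (snd z) * F (fst z) (snd z))"
      by (intro computable_intros computable_compose[OF assms(1)] F(1))
    show "computable X (\<lambda>x. c x * D x)"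
      by (intro computable_intros assms(1) F(2))
    fix k x
    have "real (c x * F k x) - 2 ^ k * (real (c x) * f x) = real (c x) * (real (F k x) - 2 ^ k * f x)"
      by (simp add: algebra_simps)
    then have "\<bar>real (c x * F k x) - 2 ^ k * (real (c x) * f x)\<bar>
        = real (c x) * \<bar>real (F k x) - 2 ^ k * f x\<bar>"
      by (simp add: abs_mult)
    also have "\<dots> \<le> real (c x) * real (D x)"
      by (intro mult_left_mono F(3)) simp
    finally show "\<bar>real (c x * F k x) - 2 ^ k * (real (c x) * f x)\<bar> \<le> real (c x * D x)"
      by simp
  qed
qed

text \<open>
  The difference of the values, scaled by \<open>2 ^ k\<close>, eventually exceeds the fixed errors if and
  only if it is positive.
\<close>

lemma semidecidable_less_approximable:
  assumes "approximable X f" and "approximable X g"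
  shows "semidecidable X (\<lambda>x. f x < g x)"
proof -
  obtain F D where F: "computable X (\<lambda>z. F (fst z) (snd z))" "computable X D"
    "\<And>k x. \<bar>real (F k x) - 2 ^ k * f x\<bar> \<le> real (D x)"
    using assms(1) by (rule approximableE) blast
  obtain G E where G: "computable X (\<lambda>z. G (fst z) (snd z))" "computable X E"
    "\<And>k x. \<bar>real (G k x) - 2 ^ k * g x\<bar> \<le> real (E x)"
    using assms(2) by (rule approximableE) blast
  have "semidecidable X (\<lambda>x. \<exists>k. F k x + D x + E x < G k x)"
    by (intro semidecidable_intros semidecidable_decidable computable_intros F(1) G(1)
        computable_compose[OF F(2)] computable_compose[OF G(2)])
  moreover have "(\<exists>k. F k x + D x + E x < G k x) \<longleftrightarrow> f x < g x" for x
  proof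
    assume "\<exists>k. F k x + D x + E x < G k x"
    then obtain k where k: "F k x + D x + E x < G k x" ..
    then have "real (F k x) + real (D x) + real (E x) < real (G k x)"
      by linarith
    then have "2 ^ k * f x < 2 ^ k * g x"
      using F(3)[of k x] G(3)[of k x] by linarith
    then show "f x < g x"
      by simp
  next
    assume less: "f x < g x"
    obtain k where "(2 * real (D x) + 2 * real (E x)) / (g x - f x) < 2 ^ k"
      using real_arch_pow[of 2] by auto
    then have "2 * real (D x) + 2 * real (E x) < 2 ^ k * g x - 2 ^ k * f x"
      using less by (simp add: field_simps)
    then have "real (F k x) + real (D x) + real (E x) < real (G k x)"
      using F(3)[of k x] G(3)[of k x] by linarith
    then show "\<exists>k. F k x + D x + E x < G k x"
      by (intro exI[of _ k]) linarith
  qed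
  ultimately show ?thesis
    by (rule semidecidable_cong)
qed

text \<open>
  An approximation is found by searching for a natural number \<open>a\<close> such that \<open>2 ^ k * f x\<close> is
  confirmed to lie between \<open>a - 1\<close> and \<open>a + 1\<close>; the integer part is one.
\<close>

lemma approximable_of_cuts:
  assumes nonneg: "\<And>x. 0 \<le> f x"
    and less: "semidecidable X (\<lambda>z. real (fst z) * f (snd (snd z)) < real (fst (snd z)))"
    and greater: "semidecidable X (\<lambda>z. real (fst (snd z)) < real (fst z) * f (snd (snd z)))"
  shows "approximable X f"
proof -
  let ?R = "\<lambda>a z. real (2 ^ fst z) * f (snd z) < real (Suc a) \<and>
    (a = 0 \<or> real (a - 1) < real (2 ^ fst z) * f (snd z))"
  have "semidecidable X (\<lambda>z. real (2 ^ fst (snd z)) * f (snd (snd z)) < real (Suc (fst z)))"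
    using semidecidable_compose[OF less, of "\<lambda>z. (2 ^ fst (snd z), Suc (fst z), snd (snd z))"]
    by (simp add: computable_intros del: of_nat_Suc)
  moreover have "semidecidable X (\<lambda>z. real (fst z - 1) < real (2 ^ fst (snd z)) * f (snd (snd z)))"
    using semidecidable_compose[OF greater, of "\<lambda>z. (2 ^ fst (snd z), fst z - 1, snd (snd z))"]
    by (simp add: computable_intros)
  ultimately have R: "semidecidable X (\<lambda>z. ?R (fst z) (snd z))"
    by (intro semidecidable_intros semidecidable_decidable[OF decidable_eq] computable_intros)
  have ex: "\<exists>a. ?R a z" for z
  proof (rule exI[of _ "nat \<lfloor>real (2 ^ fst z) * f (snd z)\<rfloor>"])
    have "0 \<le> real (2 ^ fst z) * f (snd z)"
      using nonneg by simp
    then show "?R (nat \<lfloor>real (2 ^ fst z) * f (snd z)\<rfloor>) z"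
      by linarith
  qed
  obtain F where F: "computable X F" "\<And>z. ?R (F z) z"
    by (rule semidecidable_select[of X ?R, OF R ex]) blast
  show ?thesis
  proof (rule approximableI[where F = "\<lambda>k x. F (k, x)" and D = "\<lambda>_. 1"])
    show "computable X (\<lambda>z. F (fst z, snd z))"
      using F(1) by simp
    show "\<bar>real (F (k, x)) - 2 ^ k * f x\<bar> \<le> real 1" for k x
      using F(2)[of "(k, x)"] nonneg[of x] by auto
  qed (intro computable_intros)
qed

section \<open>Real powers of natural numbers\<close>

lemma ex_fraction_between:
  fixes a b :: real
  assumes "0 \<le> a" and "a < b"
  obtains u v :: nat where "0 < v" and "a < real u / real v" and "real u / real v < b"
proof -
  obtain r where r: "r \<in> \<rat>" "a < r" "r < b"
    using Rats_dense_in_real[OF assms(2)] by blast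
  obtain u v :: nat where "v \<noteq> 0" "\<bar>r\<bar> = real u / real v"
    using r(1) by (rule Rats_abs_nat_div_natE)
  moreover have "\<bar>r\<bar> = r"
    using r assms(1) by linarith
  ultimately show ?thesis
    using r that[of v u] by simp
qed

lemma nat_mult_powr_less_iff:
  fixes a b y u v :: nat
  assumes "0 < v" and "0 < y"
  shows "real b * real y powr (real u / real v) < real a \<longleftrightarrow> b ^ v * y ^ u < a ^ v"
    and "real a < real b * real y powr (real u / real v) \<longleftrightarrow> a ^ v < b ^ v * y ^ u"
proof -
  let ?t = "real b * real y powr (real u / real v)"
  have "(real y powr (real u / real v)) ^ v = real y ^ u"
  proof -
    have "(real y powr (real u / real v)) ^ v = (real y powr (real u / real v)) powr real v"
      using assms by (subst powr_realpow) auto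
    also have "\<dots> = real y powr real u"
      using assms by (subst powr_powr) simp
    also have "\<dots> = real y ^ u"
      using assms by (subst powr_realpow) auto
    finally show ?thesis .
  qed
  then have t: "?t ^ v = real (b ^ v * y ^ u)"
    by (simp add: power_mult_distrib)
  have less_iff: "s < r \<longleftrightarrow> s ^ v < r ^ v" if "0 \<le> s" "0 \<le> r" for s r :: real
    using that assms(1) power_less_imp_less_base power_strict_mono by blast
  have "?t < real a \<longleftrightarrow> ?t ^ v < real a ^ v"
    by (intro less_iff) simp_all
  then show "?t < real a \<longleftrightarrow> b ^ v * y ^ u < a ^ v"
    unfolding t of_nat_power[symmetric] of_nat_less_iff .
  have "real a < ?t \<longleftrightarrow> real a ^ v < ?t ^ v"
    by (intro less_iff) simp_all
  then show "real a < ?t \<longleftrightarrow> a ^ v < b ^ v * y ^ u"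
    unfolding t of_nat_power[symmetric] of_nat_less_iff .
qed

text \<open>
  Since \<open>y \<ge> 1\<close>, the power is continuous and increasing in the exponent. A strict inequality
  therefore persists for some rational exponent \<open>u / v\<close> above \<open>\<rho>\<close>, where it is an inequality
  between natural numbers.
\<close>

lemma mult_powr_less_iff_fraction:
  fixes a b y :: nat
  assumes "0 \<le> \<rho>" and "0 < y"
  shows "real b * real y powr \<rho> < real a \<longleftrightarrow>
      (\<exists>u v. 0 < v \<and> \<rho> * real v < real u \<and> b ^ v * y ^ u < a ^ v)"
proof
  assume less: "real b * real y powr \<rho> < real a"
  have "((\<lambda>t. real b * real y powr t) \<longlongrightarrow> real b * real y powr \<rho>) (at_right \<rho>)"
    using assms(2) by (intro tendsto_intros) auto
  then have "\<forall>\<^sub>F t in at_right \<rho>. real b * real y powr t < real a"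
    using less by (rule order_tendstoD)
  then obtain d where d: "\<rho> < d" "\<And>t. \<rho> < t \<Longrightarrow> t < d \<Longrightarrow> real b * real y powr t < real a"
    by (auto simp: eventually_at_right_field)
  obtain u v :: nat where uv: "0 < v" "\<rho> < real u / real v" "real u / real v < d"
    using ex_fraction_between[OF assms(1) d(1)] .
  then have "b ^ v * y ^ u < a ^ v"
    using d(2) assms(2) by (simp flip: nat_mult_powr_less_iff)
  with uv show "\<exists>u v. 0 < v \<and> \<rho> * real v < real u \<and> b ^ v * y ^ u < a ^ v"
    by (auto simp: field_simps)
next
  assume "\<exists>u v. 0 < v \<and> \<rho> * real v < real u \<and> b ^ v * y ^ u < a ^ v"
  then obtain u v where uv: "0 < v" "\<rho> * real v < real u" "b ^ v * y ^ u < a ^ v"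
    by blast
  then have "\<rho> \<le> real u / real v"
    by (simp add: field_simps)
  then have "real b * real y powr \<rho> \<le> real b * real y powr (real u / real v)"
    using assms(2) by (intro mult_left_mono powr_mono) auto
  also have "\<dots> < real a"
    using uv(1,3) assms(2) by (simp add: nat_mult_powr_less_iff)
  finally show "real b * real y powr \<rho> < real a" .
qed

lemma less_mult_powr_iff_fraction:
  fixes a b y :: nat
  assumes "0 < \<rho>" and "0 < y"
  shows "real a < real b * real y powr \<rho> \<longleftrightarrow>
      (\<exists>u v. 0 < v \<and> real u < \<rho> * real v \<and> a ^ v < b ^ v * y ^ u)"
proof
  assume less: "real a < real b * real y powr \<rho>"
  have "((\<lambda>t. real b * real y powr t) \<longlongrightarrow> real b * real y powr \<rho>) (at_left \<rho>)"
    using assms(2) by (intro tendsto_intros) auto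
  then have "\<forall>\<^sub>F t in at_left \<rho>. real a < real b * real y powr t"
    using less by (rule order_tendstoD)
  then obtain d where d: "d < \<rho>" "\<And>t. d < t \<Longrightarrow> t < \<rho> \<Longrightarrow> real a < real b * real y powr t"
    by (auto simp: eventually_at_left_field)
  have "0 \<le> max 0 d" "max 0 d < \<rho>"
    using d(1) assms(1) by auto
  then obtain u v :: nat where uv: "0 < v" "max 0 d < real u / real v" "real u / real v < \<rho>"
    by (rule ex_fraction_between)
  then have "a ^ v < b ^ v * y ^ u"
    using d(2) assms(2) by (simp flip: nat_mult_powr_less_iff)
  with uv show "\<exists>u v. 0 < v \<and> real u < \<rho> * real v \<and> a ^ v < b ^ v * y ^ u"
    by (auto simp: field_simps)
next
  assume "\<exists>u v. 0 < v \<and> real u < \<rho> * real v \<and> a ^ v < b ^ v * y ^ u"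
  then obtain u v where uv: "0 < v" "real u < \<rho> * real v" "a ^ v < b ^ v * y ^ u"
    by blast
  then have le: "real u / real v \<le> \<rho>"
    by (simp add: field_simps)
  have "real a < real b * real y powr (real u / real v)"
    using uv(1,3) assms(2) by (simp add: nat_mult_powr_less_iff)
  also have "\<dots> \<le> real b * real y powr \<rho>"
    using assms(2) le by (intro mult_left_mono powr_mono) auto
  finally show "real a < real b * real y powr \<rho>" .
qed

lemma abs_decode_rat: "\<bar>decode_rat q\<bar> = real (nat \<bar>rat_num q\<bar>) / real (rat_den q)"
  by (simp add: decode_rat_eq abs_divide)

text \<open>
  The exponent \<open>p / 2\<close> occurs because \<open>\<bar>z\<bar> powr p\<close> is the power with this exponent of \<open>\<bar>z\<bar>\<^sup>2\<close>,
  which is a natural number for a Gaussian integer \<open>z\<close>.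
\<close>

lemma computable_real_half_cuts:
  assumes "computable_real p" and "0 \<le> p"
  shows "semidecidable {} (\<lambda>z. p / 2 * real (snd z) < real (fst z))"
    and "semidecidable {} (\<lambda>z. real (fst z) < p / 2 * real (snd z))"
proof -
  obtain P where "\<forall>k. \<exists>q. runs {} P [k] q \<and> \<bar>p - decode_rat q\<bar> < 1 / 2 ^ k"
    using assms(1) unfolding computable_real_def by blast
  then obtain q where q: "\<And>k. runs {} P [k] (q k)" "\<And>k. \<bar>p - decode_rat (q k)\<bar> < 1 / 2 ^ k"
    by metis
  have comp_q: "computable {} q"
    unfolding computable_nat_iff entries_nat_def using q(1) by blast
  define a where "a k = nat \<bar>rat_num (q k)\<bar>" for k
  define b where "b k = rat_den (q k)" for k
  have comp_a: "computable {} a" and comp_b: "computable {} b"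
    unfolding a_def b_def by (intro computable_intros comp_q)+
  have b_pos: "0 < b k" for k
    by (simp add: b_def rat_den_pos)
  have "real (a k) / real (b k) = \<bar>decode_rat (q k)\<bar>" for k
    by (simp add: a_def b_def abs_decode_rat)
  then have approx: "\<bar>p - real (a k) / real (b k)\<bar> < 1 / 2 ^ k" for k
    using q(2)[of k] assms(2) abs_triangle_ineq3[of "p" "decode_rat (q k)"]
    by simp
  have to_nat: "2 ^ k * real (a k) * real v + real v * real (b k) < 2 * real u * 2 ^ k * real (b k) \<longleftrightarrow>
      2 ^ k * a k * v + v * b k < 2 * u * 2 ^ k * b k"
    "2 * real u * 2 ^ k * real (b k) + real v * real (b k) < 2 ^ k * real (a k) * real v \<longleftrightarrow>
      2 * u * 2 ^ k * b k + v * b k < 2 ^ k * a k * v" for u v k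
    by (subst of_nat_less_iff[symmetric, where 'a = real], simp)+
  have clear: "(real (a k) / real (b k) + 1 / 2 ^ k) * real v < 2 * real u \<longleftrightarrow>
      2 ^ k * a k * v + v * b k < 2 * u * 2 ^ k * b k"
    "2 * real u < (real (a k) / real (b k) - 1 / 2 ^ k) * real v \<longleftrightarrow>
      2 * u * 2 ^ k * b k + v * b k < 2 ^ k * a k * v" for u v k
  proof -
    have b: "0 < real (b k)" "0 < 2 ^ k * real (b k)"
      using b_pos[of k] by simp_all
    have "(real (a k) / real (b k) + 1 / 2 ^ k) * real v =
        (2 ^ k * real (a k) * real v + real v * real (b k)) / (2 ^ k * real (b k))"
      using b(1) by (simp add: field_simps)
    then show "(real (a k) / real (b k) + 1 / 2 ^ k) * real v < 2 * real u \<longleftrightarrow>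
        2 ^ k * a k * v + v * b k < 2 * u * 2 ^ k * b k"
      unfolding to_nat(1)[symmetric] using b(2) by (simp add: pos_divide_less_eq mult.assoc)
    have "(real (a k) / real (b k) - 1 / 2 ^ k) * real v =
        (2 ^ k * real (a k) * real v - real v * real (b k)) / (2 ^ k * real (b k))"
      using b(1) by (simp add: field_simps)
    then show "2 * real u < (real (a k) / real (b k) - 1 / 2 ^ k) * real v \<longleftrightarrow>
        2 * u * 2 ^ k * b k + v * b k < 2 ^ k * a k * v"
      unfolding to_nat(2)[symmetric] using b(2)
      by (simp add: pos_less_divide_eq mult.assoc less_diff_eq)
  qed
  have tendsto: "(\<lambda>k. real (a k) / real (b k)) \<longlonglongrightarrow> p" "(\<lambda>k. 1 / 2 ^ k :: real) \<longlonglongrightarrow> 0"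
  proof -
    show 0: "(\<lambda>k. 1 / 2 ^ k :: real) \<longlonglongrightarrow> 0"
      by (rule LIMSEQ_divide_realpow_zero) simp
    have "(\<lambda>k. real (a k) / real (b k) - p) \<longlonglongrightarrow> 0"
      by (rule Lim_null_comparison[OF _ 0])
        (use approx in \<open>auto intro!: always_eventually less_imp_le simp: abs_minus_commute\<close>)
    then show "(\<lambda>k. real (a k) / real (b k)) \<longlonglongrightarrow> p"
      by (simp add: LIM_zero_iff)
  qed
  have less_iff: "p / 2 * real v < real u \<longleftrightarrow> (\<exists>k. 2 ^ k * a k * v + v * b k < 2 * u * 2 ^ k * b k)" for u v
    unfolding clear(1)[symmetric]
  proof
    assume "p / 2 * real v < real u"
    moreover have "(\<lambda>k. (real (a k) / real (b k) + 1 / 2 ^ k) * real v) \<longlonglongrightarrow> (p + 0) * real v"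
      by (intro tendsto_intros tendsto)
    ultimately have "\<forall>\<^sub>F k in sequentially. (real (a k) / real (b k) + 1 / 2 ^ k) * real v < 2 * real u"
      by (intro order_tendstoD) auto
    then show "\<exists>k. (real (a k) / real (b k) + 1 / 2 ^ k) * real v < 2 * real u"
      by (auto simp: eventually_sequentially)
  next
    assume "\<exists>k. (real (a k) / real (b k) + 1 / 2 ^ k) * real v < 2 * real u"
    then obtain k where k: "(real (a k) / real (b k) + 1 / 2 ^ k) * real v < 2 * real u" ..
    have "p * real v \<le> (real (a k) / real (b k) + 1 / 2 ^ k) * real v"
      using approx[of k] by (intro mult_right_mono) linarith+
    with k show "p / 2 * real v < real u"
      by linarith
  qed
  have greater_iff: "real u < p / 2 * real v \<longleftrightarrow> (\<exists>k. 2 * u * 2 ^ k * b k + v * b k < 2 ^ k * a k * v)" for u v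
    unfolding clear(2)[symmetric]
  proof
    assume "real u < p / 2 * real v"
    moreover have "(\<lambda>k. (real (a k) / real (b k) - 1 / 2 ^ k) * real v) \<longlonglongrightarrow> (p - 0) * real v"
      by (intro tendsto_intros tendsto)
    ultimately have "\<forall>\<^sub>F k in sequentially. 2 * real u < (real (a k) / real (b k) - 1 / 2 ^ k) * real v"
      by (intro order_tendstoD) auto
    then show "\<exists>k. 2 * real u < (real (a k) / real (b k) - 1 / 2 ^ k) * real v"
      by (auto simp: eventually_sequentially)
  next
    assume "\<exists>k. 2 * real u < (real (a k) / real (b k) - 1 / 2 ^ k) * real v"
    then obtain k where k: "2 * real u < (real (a k) / real (b k) - 1 / 2 ^ k) * real v" ..
    have "(real (a k) / real (b k) - 1 / 2 ^ k) * real v \<le> p * real v"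
      using approx[of k] by (intro mult_right_mono) linarith+
    with k show "real u < p / 2 * real v"
      by linarith
  qed
  show "semidecidable {} (\<lambda>z. p / 2 * real (snd z) < real (fst z))"
    unfolding less_iff
    by (intro semidecidable_intros semidecidable_decidable computable_intros computable_compose[OF comp_a] computable_compose[OF comp_b])
  show "semidecidable {} (\<lambda>z. real (fst z) < p / 2 * real (snd z))"
    unfolding greater_iff
    by (intro semidecidable_intros semidecidable_decidable computable_intros computable_compose[OF comp_a] computable_compose[OF comp_b])
qed

lemma approximable_nat_powr:
  assumes "0 < \<rho>"
    and "semidecidable {} (\<lambda>z. \<rho> * real (snd z) < real (fst z))"
    and "semidecidable {} (\<lambda>z. real (fst z) < \<rho> * real (snd z))"
  shows "approximable X (\<lambda>y. real y powr \<rho>)"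
proof (rule approximable_of_cuts)
  have less: "real b * real y powr \<rho> < real a \<longleftrightarrow> y = 0 \<and> 0 < a \<or>
      0 < y \<and> (\<exists>u v. 0 < v \<and> \<rho> * real v < real u \<and> b ^ v * y ^ u < a ^ v)" for a b y :: nat
    using mult_powr_less_iff_fraction[of \<rho> y b a] assms(1) by (cases "y = 0") auto
  have greater: "real a < real b * real y powr \<rho> \<longleftrightarrow>
      0 < y \<and> (\<exists>u v. 0 < v \<and> real u < \<rho> * real v \<and> a ^ v < b ^ v * y ^ u)" for a b y :: nat
    using less_mult_powr_iff_fraction[of \<rho> y a b] assms(1) by (cases "y = 0") auto
  note cuts = assms(2,3)[THEN semidecidable_any_oracle, of X]
  show "semidecidable X (\<lambda>z. real (fst z) * real (snd (snd z)) powr \<rho> < real (fst (snd z)))"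
    unfolding less
    by (intro semidecidable_intros semidecidable2[OF cuts(1)] semidecidable_decidable[OF decidable_less]
        semidecidable_decidable[OF decidable_eq] computable_intros)
  show "semidecidable X (\<lambda>z. real (fst (snd z)) < real (fst z) * real (snd (snd z)) powr \<rho>)"
    unfolding greater
    by (intro semidecidable_intros semidecidable2[OF cuts(2)] semidecidable_decidable[OF decidable_less] computable_intros)
qed simp

section \<open>The Banach space of p-summable sequences\<close>

abbreviation lp_carrier :: "real \<Rightarrow> (nat \<Rightarrow> complex) set" where
  "lp_carrier p \<equiv> carrier (lp_space p)"

abbreviation lp_norm :: "real \<Rightarrow> (nat \<Rightarrow> complex) \<Rightarrow> real" where
  "lp_norm p \<equiv> vnorm (lp_space p)"

lemma lp_carrier_iff: "f \<in> lp_carrier p \<longleftrightarrow> summable (\<lambda>n. cmod (f n) powr p)"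
  by (simp add: lp_space_def)

lemma lp_norm_def: "lp_norm p f = (\<Sum>n. cmod (f n) powr p) powr (1 / p)"
  by (simp add: lp_space_def)

lemma lp_norm_powr:
  assumes "1 \<le> p" and "f \<in> lp_carrier p"
  shows "lp_norm p f powr p = (\<Sum>n. cmod (f n) powr p)"
  using assms suminf_nonneg[of "\<lambda>n. cmod (f n) powr p"]
  by (simp add: lp_norm_def lp_carrier_iff powr_powr)

lemma lp_norm_nonneg: "0 \<le> lp_norm p f"
  by (simp add: lp_norm_def)

text \<open>
  The norm is compared through its \<open>p\<close>-th power, which is additive over coordinates.
\<close>

lemma lp_norm_le_iff:
  assumes "1 \<le> p" and "f \<in> lp_carrier p" and "0 \<le> r"
  shows "lp_norm p f \<le> r \<longleftrightarrow> (\<Sum>n. cmod (f n) powr p) \<le> r powr p"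
  unfolding lp_norm_powr[OF assms(1,2), symmetric]
proof
  show "lp_norm p f powr p \<le> r powr p" if "lp_norm p f \<le> r"
    using that assms by (intro powr_mono2) (auto simp: lp_norm_nonneg)
  show "lp_norm p f \<le> r" if "lp_norm p f powr p \<le> r powr p"
  proof (rule ccontr)
    assume "\<not> lp_norm p f \<le> r"
    then have "r powr p < lp_norm p f powr p"
      using assms by (intro powr_less_mono2) auto
    with that show False
      by simp
  qed
qed

lemma partial_sum_le_lp_norm:
  assumes "1 \<le> p" and "f \<in> lp_carrier p" and "finite I"
  shows "(\<Sum>n\<in>I. cmod (f n) powr p) \<le> lp_norm p f powr p"
  unfolding lp_norm_powr[OF assms(1,2)]
  using assms by (intro sum_le_suminf) (simp_all add: lp_carrier_iff)

text \<open>
  Membership and norm are controlled by the finite partial sums alone; this is how limits and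
  sums of sequences are shown to belong to the space.
\<close>

lemma lp_memI:
  assumes "1 \<le> p" and "0 \<le> r" and "\<And>M. (\<Sum>n<M. cmod (f n) powr p) \<le> r powr p"
  shows "f \<in> lp_carrier p" and "lp_norm p f \<le> r"
proof -
  show f: "f \<in> lp_carrier p"
    unfolding lp_carrier_iff
  proof (rule summableI_nonneg_bounded)
    show "(\<Sum>n<M. cmod (f n) powr p) \<le> r powr p" for M
      using assms(3)[of M] .
  qed simp
  have "(\<Sum>n. cmod (f n) powr p) \<le> r powr p"
    using f assms(3) by (intro suminf_le_const) (simp_all add: lp_carrier_iff)
  then show "lp_norm p f \<le> r"
    using f assms by (simp add: lp_norm_le_iff)
qed

lemma cmod_le_lp_norm:
  assumes "1 \<le> p" and "f \<in> lp_carrier p"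
  shows "cmod (f n) \<le> lp_norm p f"
proof -
  have "cmod (f n) powr p \<le> lp_norm p f powr p"
    using partial_sum_le_lp_norm[OF assms, of "{n}"] by simp
  then show ?thesis
    using assms(1) lp_norm_nonneg[of p f] powr_less_mono2[of p "lp_norm p f" "cmod (f n)"]
    by linarith
qed

lemma lp_norm_le_scaled:
  assumes p: "1 \<le> p" and f: "f \<in> lp_carrier p" and "0 \<le> c"
    and le: "\<And>n. cmod (g n) \<le> c * cmod (f n)"
  shows "lp_norm p g \<le> c * lp_norm p f"
proof (rule lp_memI(2)[OF p])
  show "0 \<le> c * lp_norm p f"
    using assms by (simp add: lp_norm_nonneg)
  fix M
  have "(\<Sum>n<M. cmod (g n) powr p) \<le> (\<Sum>n<M. (c * cmod (f n)) powr p)"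
    using p le by (intro sum_mono powr_mono2) auto
  also have "\<dots> = c powr p * (\<Sum>n<M. cmod (f n) powr p)"
    using assms by (simp add: powr_mult sum_distrib_left)
  also have "\<dots> \<le> c powr p * lp_norm p f powr p"
    by (intro mult_left_mono partial_sum_le_lp_norm[OF p f]) auto
  finally show "(\<Sum>n<M. cmod (g n) powr p) \<le> (c * lp_norm p f) powr p"
    using assms by (simp add: powr_mult lp_norm_nonneg)
qed

text \<open>
  At 0, convexity comes down to \<open>t powr p \<le> t\<close> for \<open>0 \<le> t \<le> 1\<close>.
\<close>

lemma convex_powr_nonneg:
  fixes x y u p :: real
  assumes "1 \<le> p" and "0 \<le> x" and "0 \<le> y" and "0 \<le> u" and "u \<le> 1"
  shows "((1 - u) * x + u * y) powr p \<le> (1 - u) * x powr p + u * y powr p"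
proof -
  have scale: "(t * z) powr p \<le> t * z powr p" if "0 \<le> t" "t \<le> 1" "0 \<le> z" for t z :: real
  proof -
    have "t powr p \<le> t"
      using powr_mono'[of 1 p t] that assms(1) by simp
    then show ?thesis
      using that by (simp add: powr_mult mult_right_mono)
  qed
  consider "x = 0" | "y = 0" | "0 < x" "0 < y"
    using assms by linarith
  then show ?thesis
  proof cases
    case 3
    then show ?thesis
      using convex_onD[OF powr_convex[OF assms(1)], of u x y] assms by simp
  qed (use assms scale[of u y] scale[of "1 - u" x] in auto)
qed

text \<open>
  Convexity applied to \<open>a / A\<close> and \<open>b / B\<close> with weights proportional to \<open>A\<close> and \<open>B\<close>.
\<close>

lemma powr_add_le_weighted:
  fixes a b A B p :: real
  assumes "1 \<le> p" and "0 \<le> a" and "0 \<le> b" and "0 < A" and "0 < B"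
  shows "(a + b) powr p \<le> (A + B) powr p * (A / (A + B) * (a powr p / A powr p) + B / (A + B) * (b powr p / B powr p))"
proof -
  have u: "1 - B / (A + B) = A / (A + B)"
    using assms by (simp add: field_simps)
  have "A / (A + B) * (a / A) = a / (A + B)" "B / (A + B) * (b / B) = b / (A + B)"
    using assms by simp_all
  then have "a + b = (A + B) * (A / (A + B) * (a / A) + B / (A + B) * (b / B))"
    using assms by (simp flip: add_divide_distrib)
  then have "(a + b) powr p = (A + B) powr p * (A / (A + B) * (a / A) + B / (A + B) * (b / B)) powr p"
    using assms by (simp add: powr_mult)
  also have "\<dots> \<le> (A + B) powr p * (A / (A + B) * (a / A) powr p + B / (A + B) * (b / B) powr p)"
    using convex_powr_nonneg[of p "a / A" "b / B" "B / (A + B)"] assms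
    unfolding u by (intro mult_left_mono) auto
  finally show ?thesis
    using assms by (simp add: powr_divide)
qed

text \<open>
  Minkowski's inequality. The weighted bound is summed with \<open>A\<close> and \<open>B\<close> slightly larger than
  the two norms, so that no norm has to be nonzero.
\<close>

lemma lp_add:
  assumes p: "1 \<le> p" and f: "f \<in> lp_carrier p" and g: "g \<in> lp_carrier p"
  shows "(\<lambda>n. f n + g n) \<in> lp_carrier p"
    and "lp_norm p (\<lambda>n. f n + g n) \<le> lp_norm p f + lp_norm p g"
proof -
  have *: "(\<Sum>n<M. cmod (f n + g n) powr p) \<le> (A + B) powr p"
    if A: "lp_norm p f < A" and B: "lp_norm p g < B" for A B M
  proof -
    have pos: "0 < A" "0 < B"
      using A B lp_norm_nonneg[of p f] lp_norm_nonneg[of p g] by linarith+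
    have unit: "(\<Sum>n<M. cmod (h n) powr p) / D powr p \<le> 1"
      if "h \<in> lp_carrier p" "lp_norm p h < D" for h D
    proof -
      have "(\<Sum>n<M. cmod (h n) powr p) \<le> lp_norm p h powr p"
        using partial_sum_le_lp_norm[OF p that(1)] by simp
      also have "\<dots> \<le> D powr p"
        using that p lp_norm_nonneg by (intro powr_mono2) auto
      finally show ?thesis
        using that(2) lp_norm_nonneg[of p h] by (subst divide_le_eq_1) auto
    qed
    have "(\<Sum>n<M. cmod (f n + g n) powr p) \<le> (\<Sum>n<M. (cmod (f n) + cmod (g n)) powr p)"
      using p by (intro sum_mono powr_mono2 norm_triangle_ineq) auto
    also have "\<dots> \<le> (\<Sum>n<M. (A + B) powr p * (A / (A + B) * (cmod (f n) powr p / A powr p)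
        + B / (A + B) * (cmod (g n) powr p / B powr p)))"
      using p pos by (intro sum_mono powr_add_le_weighted) auto
    also have "\<dots> = (A + B) powr p * (A / (A + B) * ((\<Sum>n<M. cmod (f n) powr p) / A powr p)
        + B / (A + B) * ((\<Sum>n<M. cmod (g n) powr p) / B powr p))"
      by (simp add: sum_distrib_left sum.distrib sum_divide_distrib distrib_left)
    also have "\<dots> \<le> (A + B) powr p * (A / (A + B) * 1 + B / (A + B) * 1)"
      using pos unit[OF f A] unit[OF g B]
      by (intro mult_left_mono add_mono) auto
    also have "\<dots> = (A + B) powr p"
      using pos by (simp flip: add_divide_distrib)
    finally show ?thesis .
  qed
  have nonneg: "0 \<le> lp_norm p f + lp_norm p g"
    by (simp add: lp_norm_nonneg)
  have *: "(\<lambda>n. f n + g n) \<in> lp_carrier p \<and>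
      lp_norm p (\<lambda>n. f n + g n) \<le> (lp_norm p f + e) + (lp_norm p g + e)" if "0 < e" for e
    using lp_memI[OF p _ *[of "lp_norm p f + e" "lp_norm p g + e"]] that nonneg by simp
  then show "(\<lambda>n. f n + g n) \<in> lp_carrier p"
    using zero_less_one by blast
  show "lp_norm p (\<lambda>n. f n + g n) \<le> lp_norm p f + lp_norm p g"
  proof (rule field_le_epsilon)
    fix e :: real assume "0 < e"
    then show "lp_norm p (\<lambda>n. f n + g n) \<le> lp_norm p f + lp_norm p g + e"
      using *[of "e / 2"] by simp
  qed
qed

lemma lp_scale:
  assumes p: "1 \<le> p" and f: "f \<in> lp_carrier p"
  shows "(\<lambda>n. a * f n) \<in> lp_carrier p"
    and "lp_norm p (\<lambda>n. a * f n) = cmod a * lp_norm p f"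
proof -
  have eq: "(\<lambda>n. cmod (a * f n) powr p) = (\<lambda>n. cmod a powr p * cmod (f n) powr p)"
    by (simp add: norm_mult powr_mult)
  show "(\<lambda>n. a * f n) \<in> lp_carrier p"
    using f unfolding lp_carrier_iff eq by (rule summable_mult)
  have "(\<Sum>n. cmod (a * f n) powr p) = cmod a powr p * (\<Sum>n. cmod (f n) powr p)"
    using f unfolding lp_carrier_iff eq by (rule suminf_mult)
  moreover have "0 \<le> (\<Sum>n. cmod (f n) powr p)"
    using f by (intro suminf_nonneg) (simp_all add: lp_carrier_iff)
  ultimately show "lp_norm p (\<lambda>n. a * f n) = cmod a * lp_norm p f"
    using p by (simp add: lp_norm_def powr_mult powr_powr)
qed

lemma lp_diff:
  assumes p: "1 \<le> p" and f: "f \<in> lp_carrier p" and g: "g \<in> lp_carrier p"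
  shows "(\<lambda>n. f n - g n) \<in> lp_carrier p"
    and "lp_norm p (\<lambda>n. f n - g n) \<le> lp_norm p f + lp_norm p g"
  using lp_add[OF p f lp_scale(1)[OF p g, of "-1"]] lp_scale(2)[OF p g, of "-1"] by auto

lemma lp_space_simps:
  "\<zero>\<^bsub>lp_space p\<^esub> = (\<lambda>n. 0)"
  "x \<oplus>\<^bsub>lp_space p\<^esub> y = (\<lambda>n. x n + y n)"
  "a \<odot>\<^bsub>lp_space p\<^esub> x = (\<lambda>n. a * x n)"
  by (simp_all add: lp_space_def)

lemma lp_zero: "(\<lambda>n. 0) \<in> lp_carrier p" "lp_norm p (\<lambda>n. 0) = 0"
  by (simp_all add: lp_carrier_iff lp_norm_def)

lemma complex_normed_space_lp:
  assumes p: "1 \<le> p"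
  shows "complex_normed_space (lp_space p)"
proof (rule complex_normed_space.intro)
  show "module complex_ring (lp_space p)"
  proof (rule moduleI[OF cring_complex_ring])
    show "abelian_group (lp_space p)"
    proof (rule abelian_groupI)
      fix x assume "x \<in> lp_carrier p"
      then show "\<exists>y\<in>lp_carrier p. y \<oplus>\<^bsub>lp_space p\<^esub> x = \<zero>\<^bsub>lp_space p\<^esub>"
        using lp_scale(1)[OF p, of x "-1"] by (intro bexI[of _ "\<lambda>n. - 1 * x n"]) (auto simp: lp_space_simps)
    qed (auto simp: lp_space_simps add_ac lp_zero intro: lp_add(1)[OF p])
  qed (auto simp: complex_ring_def lp_space_simps algebra_simps lp_scale(1)[OF p])
  show "complex_normed_space_axioms (lp_space p)"
  proof
    fix x assume x: "x \<in> lp_carrier p"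
    show "lp_norm p x = 0 \<longleftrightarrow> x = \<zero>\<^bsub>lp_space p\<^esub>"
    proof
      assume "lp_norm p x = 0"
      then have "cmod (x n) \<le> 0" for n
        using cmod_le_lp_norm[OF p x, of n] by simp
      then show "x = \<zero>\<^bsub>lp_space p\<^esub>"
        by (auto simp: lp_space_simps)
    qed (simp add: lp_space_simps lp_zero)
  qed (auto simp: lp_space_simps lp_norm_nonneg lp_scale(2)[OF p] lp_add(2)[OF p])
qed

lemma lp_minus:
  assumes p: "1 \<le> p" and x: "x \<in> lp_carrier p" and y: "y \<in> lp_carrier p"
  shows "x \<ominus>\<^bsub>lp_space p\<^esub> y = (\<lambda>n. x n - y n)"
proof -
  interpret complex_normed_space "lp_space p"
    by (rule complex_normed_space_lp[OF p])
  have neg: "(\<lambda>n. - 1 * y n) \<in> lp_carrier p"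
    by (rule lp_scale(1)[OF p y])
  have "\<ominus>\<^bsub>lp_space p\<^esub> y = (\<lambda>n. - 1 * y n)"
    by (rule minus_equality) (use neg y in \<open>simp_all add: lp_space_simps\<close>)
  then show ?thesis
    by (simp add: a_minus_def lp_space_simps)
qed

lemma Metric_space_lp: "1 \<le> p \<Longrightarrow> Metric_space (lp_carrier p) (vdist (lp_space p))"
  by (rule complex_normed_space.Metric_space_vdist[OF complex_normed_space_lp])

lemma vdist_lp:
  assumes "1 \<le> p" and "x \<in> lp_carrier p" and "y \<in> lp_carrier p"
  shows "vdist (lp_space p) x y = lp_norm p (\<lambda>n. x n - y n)"
  using assms by (simp add: vdist_def lp_minus)

text \<open>
  A Cauchy sequence converges in each coordinate, and its partial sums of \<open>p\<close>-th powers pass to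
  the limit.
\<close>

lemma complex_banach_space_lp:
  assumes p: "1 \<le> p"
  shows "complex_banach_space (lp_space p)"
proof (rule complex_banach_space.intro[OF complex_normed_space_lp[OF p]], unfold_locales)
  interpret Metric_space "lp_carrier p" "vdist (lp_space p)"
    by (rule Metric_space_lp[OF p])
  show mcomplete
    unfolding mcomplete_def
  proof (intro allI impI)
    fix s assume "MCauchy s"
    then have s: "\<And>k. s k \<in> lp_carrier p"
      and Cauchy: "\<And>e. 0 < e \<Longrightarrow> \<exists>N. \<forall>k l. N \<le> k \<longrightarrow> N \<le> l \<longrightarrow> vdist (lp_space p) (s k) (s l) < e"
      by (auto simp: MCauchy_def)
    have "Cauchy (\<lambda>k. s k n)" for n
    proof (rule metric_CauchyI)
      fix e :: real assume "0 < e"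
      then obtain N where N: "\<And>k l. N \<le> k \<Longrightarrow> N \<le> l \<Longrightarrow> vdist (lp_space p) (s k) (s l) < e"
        using Cauchy by meson
      have "dist (s k n) (s l n) < e" if "N \<le> k" "N \<le> l" for k l
        using N[OF that] cmod_le_lp_norm[OF p lp_diff(1)[OF p s[of k] s[of l]], of n] vdist_lp[OF p s s, of k l]
        by (simp add: dist_norm)
      then show "\<exists>M. \<forall>m\<ge>M. \<forall>n'\<ge>M. dist (s m n) (s n' n) < e"
        by blast
    qed
    then have "\<exists>z. (\<lambda>k. s k n) \<longlonglongrightarrow> z" for n
      by (simp add: Cauchy_convergent_iff convergent_def)
    then obtain f where f: "\<And>n. (\<lambda>k. s k n) \<longlonglongrightarrow> f n"
      by metis
    have close: "\<exists>N. \<forall>k\<ge>N. (\<lambda>n. s k n - f n) \<in> lp_carrier p \<and> lp_norm p (\<lambda>n. s k n - f n) \<le> e"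
      if "0 < e" for e
    proof -
      obtain N where N: "\<And>k l. N \<le> k \<Longrightarrow> N \<le> l \<Longrightarrow> vdist (lp_space p) (s k) (s l) < e"
        using Cauchy[OF \<open>0 < e\<close>] by meson
      have "(\<Sum>n<M. cmod (s k n - f n) powr p) \<le> e powr p" if "N \<le> k" for k M
      proof (rule LIMSEQ_le_const2)
        show "(\<lambda>l. \<Sum>n<M. cmod (s k n - s l n) powr p) \<longlonglongrightarrow> (\<Sum>n<M. cmod (s k n - f n) powr p)"
          using p by (intro tendsto_intros f) auto
        have "(\<Sum>n<M. cmod (s k n - s l n) powr p) \<le> e powr p" if "N \<le> l" for l
        proof -
          have "(\<Sum>n<M. cmod (s k n - s l n) powr p) \<le> lp_norm p (\<lambda>n. s k n - s l n) powr p"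
            by (rule partial_sum_le_lp_norm[OF p lp_diff(1)[OF p s s]]) simp
          also have "\<dots> \<le> e powr p"
            using N[OF \<open>N \<le> k\<close> that] p by (intro powr_mono2) (auto simp: lp_norm_nonneg vdist_lp[OF p s s])
          finally show ?thesis .
        qed
        then show "\<exists>N. \<forall>l\<ge>N. (\<Sum>n<M. cmod (s k n - s l n) powr p) \<le> e powr p"
          by blast
      qed
      then have "(\<lambda>n. s k n - f n) \<in> lp_carrier p \<and> lp_norm p (\<lambda>n. s k n - f n) \<le> e" if "N \<le> k" for k
        using lp_memI[OF p less_imp_le[OF \<open>0 < e\<close>], of "\<lambda>n. s k n - f n"] that by auto
      then show ?thesis
        by blast
    qed
    have fp: "f \<in> lp_carrier p"
    proof -
      obtain N where "(\<lambda>n. s N n - f n) \<in> lp_carrier p"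
        using close[OF zero_less_one] by blast
      from lp_diff(1)[OF p s[of N] this] show ?thesis
        by simp
    qed
    have "limitin mtopology s f sequentially"
      unfolding limit_metric_sequentially
    proof (intro conjI allI impI)
      fix e :: real assume "0 < e"
      then have "0 < e / 2"
        by simp
      from close[OF this] obtain N where N: "\<forall>k\<ge>N. lp_norm p (\<lambda>n. s k n - f n) \<le> e / 2"
        by blast
      have "vdist (lp_space p) (s k) f < e" if "N \<le> k" for k
      proof -
        have "lp_norm p (\<lambda>n. s k n - f n) \<le> e / 2"
          using N that by blast
        then show ?thesis
          using \<open>0 < e\<close> by (simp add: vdist_lp[OF p s fp])
      qed
      then show "\<exists>N. \<forall>n\<ge>N. s n \<in> lp_carrier p \<and> vdist (lp_space p) (s n) f < e"
        using s by blast
    qed (rule fp)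
    then show "\<exists>x. limitin mtopology s x sequentially"
      by blast
  qed
qed

lemma lp_truncate:
  assumes p: "1 \<le> p" and f: "f \<in> lp_carrier p" and e: "0 < e"
  obtains M where "lp_norm p (\<lambda>n. f n - (if n < M then f n else 0)) < e"
proof -
  have sum: "summable (\<lambda>n. cmod (f n) powr p)"
    using f by (simp add: lp_carrier_iff)
  have "0 < (e / 2) powr p"
    using e by simp
  then obtain M where M: "norm (\<Sum>i. cmod (f (i + M)) powr p) < (e / 2) powr p"
    using suminf_exist_split[OF _ sum] by blast
  let ?g = "\<lambda>n. f n - (if n < M then f n else 0)"
  have "(\<Sum>n<K. cmod (?g n) powr p) \<le> (e / 2) powr p" for K
  proof -
    have "(\<Sum>n<K. cmod (?g n) powr p) \<le> (\<Sum>n<K + M. cmod (?g n) powr p)"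
      by (rule sum_mono2) auto
    also have "\<dots> = (\<Sum>i<K. cmod (f (i + M)) powr p)"
      by (induction K) auto
    also have "\<dots> \<le> (\<Sum>i. cmod (f (i + M)) powr p)"
      by (rule sum_le_suminf) (use summable_ignore_initial_segment[OF sum, of M] in simp_all)
    also have "\<dots> \<le> (e / 2) powr p"
      using M by simp
    finally show ?thesis .
  qed
  then have "lp_norm p ?g \<le> e / 2"
    using e by (intro lp_memI(2)[OF p]) auto
  with e that[of M] show ?thesis
    by simp
qed

section \<open>Isometries of the p-summable sequences\<close>

text \<open>
  Both inequalities compare the numbers \<open>x / (x + y)\<close> and \<open>y / (x + y)\<close>, which lie strictly
  between 0 and 1 and have sum 1, with their powers.
\<close>

lemma powr_add_strict:
  fixes x y r :: real
  assumes "0 < x" and "0 < y"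
  shows "0 < r \<Longrightarrow> r < 1 \<Longrightarrow> (x + y) powr r < x powr r + y powr r"
    and "1 < r \<Longrightarrow> x powr r + y powr r < (x + y) powr r"
proof -
  have frac: "0 < x / (x + y)" "x / (x + y) < 1" "0 < y / (x + y)" "y / (x + y) < 1"
    using assms by simp_all
  have sum: "x / (x + y) + y / (x + y) = 1"
    using assms by (simp flip: add_divide_distrib)
  have eq: "(x + y) powr r * ((x / (x + y)) powr r + (y / (x + y)) powr r) = x powr r + y powr r"
    using assms by (simp add: powr_divide distrib_left)
  show "(x + y) powr r < x powr r + y powr r" if "0 < r" "r < 1"
  proof -
    have "1 < (x / (x + y)) powr r + (y / (x + y)) powr r"
      using powr_less_mono'[OF frac(1,2) that(2)] powr_less_mono'[OF frac(3,4) that(2)] assms sum by simp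
    then have "(x + y) powr r * 1 < (x + y) powr r * ((x / (x + y)) powr r + (y / (x + y)) powr r)"
      using assms by (intro mult_strict_left_mono) auto
    then show ?thesis
      unfolding eq by simp
  qed
  show "x powr r + y powr r < (x + y) powr r" if "1 < r"
  proof -
    have "(x / (x + y)) powr r + (y / (x + y)) powr r < 1"
      using powr_less_mono'[OF frac(1,2) that] powr_less_mono'[OF frac(3,4) that] assms sum by simp
    then have "(x + y) powr r * ((x / (x + y)) powr r + (y / (x + y)) powr r) < (x + y) powr r * 1"
      using assms by (intro mult_strict_left_mono) auto
    then show ?thesis
      unfolding eq by simp
  qed
qed

text \<open>
  For \<open>r \<le> 1\<close> this is the convex case for the exponent \<open>1 / r\<close> and the numbers \<open>a powr r\<close> and
  \<open>b powr r\<close>.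
\<close>

lemma powr_midpoint:
  fixes a b r :: real
  assumes "0 \<le> a" and "0 \<le> b"
  shows "1 \<le> r \<Longrightarrow> 2 * ((a + b) / 2) powr r \<le> a powr r + b powr r"
    and "0 < r \<Longrightarrow> r \<le> 1 \<Longrightarrow> a powr r + b powr r \<le> 2 * ((a + b) / 2) powr r"
proof -
  have mid: "2 * ((x + y) / 2) powr s \<le> x powr s + y powr s" if "0 \<le> x" "0 \<le> y" "1 \<le> s" for x y s :: real
    using convex_powr_nonneg[of s x y "1/2"] that by (simp add: field_simps)
  then show "1 \<le> r \<Longrightarrow> 2 * ((a + b) / 2) powr r \<le> a powr r + b powr r"
    using assms by blast
  assume r: "0 < r" "r \<le> 1"
  have "2 * ((a powr r + b powr r) / 2) powr (1 / r) \<le> (a powr r) powr (1 / r) + (b powr r) powr (1 / r)"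
    using r by (intro mid) auto
  then have "((a powr r + b powr r) / 2) powr (1 / r) \<le> (a + b) / 2"
    using assms r by (simp add: powr_powr)
  then have "(((a powr r + b powr r) / 2) powr (1 / r)) powr r \<le> ((a + b) / 2) powr r"
    using r by (intro powr_mono2) auto
  then show "a powr r + b powr r \<le> 2 * ((a + b) / 2) powr r"
    using r by (simp add: powr_powr)
qed

lemma cmod_powr_square: "cmod z powr p = ((cmod z)\<^sup>2) powr (p / 2)"
proof -
  have "((cmod z)\<^sup>2) powr (p / 2) = (cmod z powr 2) powr (p / 2)"
    by simp
  also have "\<dots> = cmod z powr p"
    by (subst powr_powr) simp
  finally show ?thesis by simp
qed

definition clarkson_gap :: "real \<Rightarrow> complex \<Rightarrow> complex \<Rightarrow> real" where
  "clarkson_gap p x y = (cmod (x + y) powr p + cmod (x - y) powr p - 2 * (cmod x powr p + cmod y powr p))"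

text \<open>
  Put \<open>r = p / 2\<close> and write each term as the \<open>r\<close>-th power of a square. The squares of \<open>\<bar>x + y\<bar>\<close>
  and \<open>\<bar>x - y\<bar>\<close> have mean \<open>\<bar>x\<bar>\<^sup>2 + \<bar>y\<bar>\<^sup>2\<close> by the parallelogram law. Concavity (for \<open>p < 2\<close>) or
  convexity (for \<open>p > 2\<close>) bounds the first two terms by the \<open>r\<close>-th power of this mean, and
  strict sub- or superadditivity separates it from the other two.
\<close>

lemma clarkson_gap_sign:
  assumes "0 < p" and "x \<noteq> 0" and "y \<noteq> 0"
  shows "p < 2 \<Longrightarrow> clarkson_gap p x y < 0" and "2 < p \<Longrightarrow> 0 < clarkson_gap p x y"
proof -
  have par: "((cmod (x + y))\<^sup>2 + (cmod (x - y))\<^sup>2) / 2 = (cmod x)\<^sup>2 + (cmod y)\<^sup>2"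
    unfolding cmod_power2 by (simp add: power2_eq_square algebra_simps)
  have pos: "0 < (cmod x)\<^sup>2" "0 < (cmod y)\<^sup>2"
    using assms by simp_all
  note strict = powr_add_strict[OF pos, of "p / 2"]
    and mid = powr_midpoint[of "(cmod (x + y))\<^sup>2" "(cmod (x - y))\<^sup>2" "p / 2", unfolded par]
  show "clarkson_gap p x y < 0" if "p < 2"
    using strict(1) mid(2) assms(1) that unfolding clarkson_gap_def cmod_powr_square by simp
  show "0 < clarkson_gap p x y" if "2 < p"
    using strict(2) mid(1) that unfolding clarkson_gap_def cmod_powr_square by simp
qed

lemma clarkson_gap_eq_0:
  assumes "x = 0 \<or> y = 0"
  shows "clarkson_gap p x y = 0"
  using assms by (auto simp: clarkson_gap_def)

text \<open>
  All coordinates contribute a gap of the same sign, so the total gap vanishes only if every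
  coordinate has gap 0. Disjointness of supports is thereby a property of norms of sums and
  differences.
\<close>

lemma disjoint_support_iff_norms:
  assumes p: "1 \<le> p" "p \<noteq> 2" and f: "f \<in> lp_carrier p" and g: "g \<in> lp_carrier p"
  shows "(\<forall>n. f n = 0 \<or> g n = 0) \<longleftrightarrow>
    lp_norm p (\<lambda>n. f n + g n) powr p + lp_norm p (\<lambda>n. f n - g n) powr p
      = 2 * (lp_norm p f powr p + lp_norm p g powr p)"
proof -
  let ?d = "\<lambda>n. clarkson_gap p (f n) (g n)"
  note mem = lp_add(1)[OF p(1) f g] lp_diff(1)[OF p(1) f g] f g
  note sums = mem[unfolded lp_carrier_iff, THEN summable_sums, folded lp_norm_powr[OF p(1) mem(1)]
    lp_norm_powr[OF p(1) mem(2)] lp_norm_powr[OF p(1) f] lp_norm_powr[OF p(1) g]]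
  have d: "?d sums (lp_norm p (\<lambda>n. f n + g n) powr p + lp_norm p (\<lambda>n. f n - g n) powr p
      - 2 * (lp_norm p f powr p + lp_norm p g powr p))"
    unfolding clarkson_gap_def
    by (intro sums_diff sums_add sums_mult sums)
  have "(\<forall>n. f n = 0 \<or> g n = 0) \<longleftrightarrow> suminf ?d = 0"
  proof
    assume "\<forall>n. f n = 0 \<or> g n = 0"
    then have "?d = (\<lambda>n. 0)"
      using clarkson_gap_eq_0 by blast
    then show "suminf ?d = 0"
      by simp
  next
    assume 0: "suminf ?d = 0"
    have sd: "summable ?d"
      using d by (rule sums_summable)
    have "\<forall>n. ?d n = 0"
    proof (cases "p < 2")
      case True
      have "suminf (\<lambda>n. - ?d n) = 0"
        using 0 suminf_minus[OF sd] by simp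
      moreover have "0 \<le> - ?d n" for n
        using clarkson_gap_sign(1)[of p "f n" "g n"] clarkson_gap_eq_0[of "f n" "g n" p] True p
        by (cases "f n = 0 \<or> g n = 0") auto
      ultimately have "\<forall>n. - ?d n = 0"
        using suminf_eq_zero_iff[OF summable_minus[OF sd]] by blast
      then show ?thesis by simp
    next
      case False
      then have "2 < p"
        using p by simp
      then have "0 \<le> ?d n" for n
        using clarkson_gap_sign(2)[of p "f n" "g n"] clarkson_gap_eq_0[of "f n" "g n" p] p
        by (cases "f n = 0 \<or> g n = 0") auto
      then show ?thesis
        using suminf_eq_zero_iff[OF sd] 0 by blast
    qed
    then have "f n = 0 \<or> g n = 0" for n
      using clarkson_gap_sign[of p "f n" "g n"] p by (cases "p < 2") auto
    then show "\<forall>n. f n = 0 \<or> g n = 0"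
      by blast
  qed
  then show ?thesis
    unfolding sums_unique[OF d, symmetric] by simp
qed

lemma std_basis_apply: "std_basis i n = (if n = i then 1 else 0)"
  by (simp add: std_basis_def)

lemma lp_single:
  assumes "1 \<le> p"
  shows "(\<lambda>n. if n = i then c else 0) \<in> lp_carrier p"
    and "lp_norm p (\<lambda>n. if n = i then c else 0) = cmod c"
proof -
  have eq: "(\<lambda>n. cmod (if n = i then c else 0) powr p) = (\<lambda>n. if n = i then cmod c powr p else 0)"
    by auto
  have "(\<lambda>n. cmod (if n = i then c else 0) powr p) sums (cmod c powr p)"
    unfolding eq by (rule sums_single)
  then show "(\<lambda>n. if n = i then c else 0) \<in> lp_carrier p"
    and "lp_norm p (\<lambda>n. if n = i then c else 0) = cmod c"
    using assms by (auto simp: lp_carrier_iff lp_norm_def sums_unique[symmetric] powr_powr dest: sums_summable)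
qed

lemma std_basis_lp:
  assumes "1 \<le> p"
  shows "std_basis i \<in> lp_carrier p" and "lp_norm p (std_basis i) = 1"
  using lp_single[OF assms, of i 1] by (simp_all add: std_basis_apply[abs_def])

lemma disjoint_summand_of_single:
  fixes f g :: "nat \<Rightarrow> complex"
  assumes "\<forall>n. f n = 0 \<or> g n = 0" and "\<And>n. n \<noteq> i \<Longrightarrow> f n + g n = 0"
  shows "f = (\<lambda>n. 0) \<or> g = (\<lambda>n. 0)"
proof -
  have "f n = 0 \<and> g n = 0" if "n \<noteq> i" for n
    using assms(1)[rule_format, of n] assms(2)[OF that] by auto
  then show ?thesis
    using assms(1)[rule_format, of i] by (metis (full_types))
qed

text \<open>
  Isometries preserve disjointness of supports in both directions. A nonzero vector is a
  multiple of a basis vector exactly if it is no sum of two nonzero vectors with disjoint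
  supports, so an onto isometry permutes the basis vectors up to unimodular factors (Banach,
  Lamperti).
\<close>

locale lp_isometry =
  fixes p :: real and T :: "(nat \<Rightarrow> complex) \<Rightarrow> nat \<Rightarrow> complex"
  assumes p: "1 \<le> p" "p \<noteq> 2"
    and T: "surjective_linear_isometry (lp_space p) (lp_space p) T"
begin

lemma T_mem: "x \<in> lp_carrier p \<Longrightarrow> T x \<in> lp_carrier p"
  using T by (auto simp: surjective_linear_isometry_def linear_isometry_def)

lemma T_add: "x \<in> lp_carrier p \<Longrightarrow> y \<in> lp_carrier p \<Longrightarrow> T (\<lambda>n. x n + y n) = (\<lambda>n. T x n + T y n)"
  using T by (simp add: surjective_linear_isometry_def linear_isometry_def lp_space_simps)

lemma T_scale: "x \<in> lp_carrier p \<Longrightarrow> T (\<lambda>n. a * x n) = (\<lambda>n. a * T x n)"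
  using T by (simp add: surjective_linear_isometry_def linear_isometry_def lp_space_simps)

lemma T_diff:
  assumes "x \<in> lp_carrier p" and "y \<in> lp_carrier p"
  shows "T (\<lambda>n. x n - y n) = (\<lambda>n. T x n - T y n)"
  using T_add[OF assms(1) lp_scale(1)[OF p(1) assms(2), of "-1"]] T_scale[OF assms(2), of "-1"] by simp

lemma T_0: "T (\<lambda>n. 0) = (\<lambda>n. 0)"
  using T_scale[OF lp_zero(1), of 0] by simp

lemma T_norm:
  assumes "x \<in> lp_carrier p"
  shows "lp_norm p (T x) = lp_norm p x"
proof -
  have "lp_norm p (T x \<ominus>\<^bsub>lp_space p\<^esub> T (\<lambda>n. 0)) = lp_norm p (x \<ominus>\<^bsub>lp_space p\<^esub> (\<lambda>n. 0))"
    using T assms lp_zero(1) unfolding surjective_linear_isometry_def linear_isometry_def by blast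
  then show ?thesis
    using assms by (simp add: lp_minus[OF p(1)] T_mem lp_zero(1) T_0)
qed

lemma T_inj:
  assumes "x \<in> lp_carrier p" and "T x = (\<lambda>n. 0)"
  shows "x = (\<lambda>n. 0)"
proof -
  have "lp_norm p x = 0"
    using T_norm[OF assms(1)] assms(2) lp_zero(2) by simp
  then have "x n = 0" for n
    using cmod_le_lp_norm[OF p(1) assms(1), of n] by simp
  then show ?thesis
    by (rule ext)
qed

lemma T_surj:
  assumes "y \<in> lp_carrier p"
  obtains x where "x \<in> lp_carrier p" and "T x = y"
proof -
  have "y \<in> T ` lp_carrier p"
    using T assms by (simp add: surjective_linear_isometry_def)
  with that show ?thesis
    by auto
qed

lemma T_disjoint:
  assumes x: "x \<in> lp_carrier p" and y: "y \<in> lp_carrier p"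
  shows "(\<forall>n. T x n = 0 \<or> T y n = 0) \<longleftrightarrow> (\<forall>n. x n = 0 \<or> y n = 0)"
  unfolding disjoint_support_iff_norms[OF p x y] disjoint_support_iff_norms[OF p T_mem[OF x] T_mem[OF y]]
  using T_norm[OF lp_add(1)[OF p(1) x y]] T_norm[OF lp_diff(1)[OF p(1) x y]]
  by (simp add: T_add T_diff T_norm x y)

text \<open>
  If \<open>x\<close> lives on one coordinate, split \<open>T x\<close> into its part on a coordinate where it does not
  vanish and the rest; the preimages have disjoint supports and sum \<open>x\<close>, so one of them is 0.
  The converse splits \<open>x\<close> instead.
\<close>

lemma T_single_iff:
  assumes x: "x \<in> lp_carrier p" and "x \<noteq> (\<lambda>n. 0)"
  shows "(\<exists>i. \<forall>n. n \<noteq> i \<longrightarrow> x n = 0) \<longleftrightarrow> (\<exists>i. \<forall>n. n \<noteq> i \<longrightarrow> T x n = 0)"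
proof
  assume "\<exists>i. \<forall>n. n \<noteq> i \<longrightarrow> x n = 0"
  then obtain j where j: "\<And>n. n \<noteq> j \<Longrightarrow> x n = 0"
    by blast
  have "T x \<noteq> (\<lambda>n. 0)"
    using T_inj[OF x] assms(2) by blast
  then obtain i where i: "T x i \<noteq> 0"
    by auto
  let ?g = "\<lambda>n. if n = i then T x i else 0"
  have g: "?g \<in> lp_carrier p"
    by (rule lp_single(1)[OF p(1)])
  obtain u where u: "u \<in> lp_carrier p" "T u = ?g"
    using T_surj[OF g] .
  have v: "(\<lambda>n. x n - u n) \<in> lp_carrier p"
    by (rule lp_diff(1)[OF p(1) x u(1)])
  have Tv: "T (\<lambda>n. x n - u n) = (\<lambda>n. T x n - ?g n)"
    using T_diff[OF x u(1)] u(2) by simp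
  have "\<forall>n. u n = 0 \<or> x n - u n = 0"
    unfolding T_disjoint[OF u(1) v, symmetric] Tv u(2) by simp
  then have "u = (\<lambda>n. 0) \<or> (\<lambda>n. x n - u n) = (\<lambda>n. 0)"
    by (rule disjoint_summand_of_single) (use j in auto)
  then show "\<exists>i. \<forall>n. n \<noteq> i \<longrightarrow> T x n = 0"
  proof
    assume "u = (\<lambda>n. 0)"
    then have "?g i = 0"
      using u(2) T_0 by metis
    with i show ?thesis by simp
  next
    assume "(\<lambda>n. x n - u n) = (\<lambda>n. 0)"
    then have "(\<lambda>n. T x n - ?g n) = (\<lambda>n. 0)"
      using Tv T_0 by simp
    then have "T x n - ?g n = 0" for n
      by (rule fun_cong)
    then show ?thesis
      by (metis diff_zero)
  qed
next
  assume "\<exists>i. \<forall>n. n \<noteq> i \<longrightarrow> T x n = 0"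
  then obtain i where i: "\<And>n. n \<noteq> i \<Longrightarrow> T x n = 0"
    by blast
  obtain j where j: "x j \<noteq> 0"
    using assms(2) by auto
  let ?u = "\<lambda>n. if n = j then x j else 0"
  have u: "?u \<in> lp_carrier p"
    by (rule lp_single(1)[OF p(1)])
  have v: "(\<lambda>n. x n - ?u n) \<in> lp_carrier p"
    by (rule lp_diff(1)[OF p(1) x u])
  have "\<forall>n. T ?u n = 0 \<or> T (\<lambda>n. x n - ?u n) n = 0"
    unfolding T_disjoint[OF u v] by simp
  then have "T ?u = (\<lambda>n. 0) \<or> T (\<lambda>n. x n - ?u n) = (\<lambda>n. 0)"
    by (rule disjoint_summand_of_single) (use i T_diff[OF x u] in auto)
  then have "?u = (\<lambda>n. 0) \<or> (\<lambda>n. x n - ?u n) = (\<lambda>n. 0)"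
    using T_inj[OF u] T_inj[OF v] by blast
  moreover have "?u j \<noteq> 0"
    using j by simp
  ultimately have "(\<lambda>n. x n - ?u n) = (\<lambda>n. 0)"
    by metis
  then have "x n - ?u n = 0" for n
    by (rule fun_cong)
  then show "\<exists>i. \<forall>n. n \<noteq> i \<longrightarrow> x n = 0"
    by (metis diff_zero)
qed

lemma T_basis:
  obtains i c where "cmod c = 1" and "T (std_basis j) = (\<lambda>n. if n = i then c else 0)"
proof -
  note e = std_basis_lp[OF p(1), of j]
  have "std_basis j j = 1"
    by (simp add: std_basis_apply)
  then have "std_basis j \<noteq> (\<lambda>n. 0)"
    by (metis zero_neq_one)
  moreover have "\<exists>i. \<forall>n. n \<noteq> i \<longrightarrow> std_basis j n = 0"
    by (auto simp: std_basis_apply)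
  ultimately obtain i where i: "\<And>n. n \<noteq> i \<Longrightarrow> T (std_basis j) n = 0"
    using T_single_iff[OF e(1)] by blast
  then have eq: "T (std_basis j) = (\<lambda>n. if n = i then T (std_basis j) i else 0)"
    by auto
  have "lp_norm p (T (std_basis j)) = cmod (T (std_basis j) i)"
    by (subst eq) (rule lp_single(2)[OF p(1)])
  then have "cmod (T (std_basis j) i) = 1"
    using T_norm[OF e(1)] e(2) by simp
  with eq that show ?thesis
    by blast
qed

lemma T_onto_basis:
  obtains j c where "cmod c = 1" and "T (std_basis j) = (\<lambda>n. if n = i then c else 0)"
proof -
  obtain x where x: "x \<in> lp_carrier p" "T x = std_basis i"
    using T_surj[OF std_basis_lp(1)[OF p(1)]] .
  have norm_x: "lp_norm p x = 1"
    using T_norm[OF x(1)] x(2) std_basis_lp(2)[OF p(1)] by simp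
  then have "x \<noteq> (\<lambda>n. 0)"
    using lp_zero(2)[of p] by auto
  moreover have "\<exists>i. \<forall>n. n \<noteq> i \<longrightarrow> T x n = 0"
    by (auto simp: x(2) std_basis_apply)
  ultimately obtain j where j: "\<And>n. n \<noteq> j \<Longrightarrow> x n = 0"
    using T_single_iff[OF x(1)] by blast
  then have eq: "x = (\<lambda>n. if n = j then x j else 0)"
    by auto
  have "lp_norm p x = cmod (x j)"
    by (subst eq) (rule lp_single(2)[OF p(1)])
  then have c: "cmod (x j) = 1"
    using norm_x by simp
  then have "x j \<noteq> 0"
    by auto
  then have "std_basis j = (\<lambda>n. inverse (x j) * x n)"
    using j by (auto simp: std_basis_apply)
  then have "T (std_basis j) = (\<lambda>n. if n = i then inverse (x j) else 0)"
    using T_scale[OF x(1), of "inverse (x j)"] x(2) by (auto simp: std_basis_apply)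
  moreover have "cmod (inverse (x j)) = 1"
    using c by (simp add: norm_inverse)
  ultimately show ?thesis
    using that by blast
qed

end

section \<open>Generators with split basis vectors\<close>

text \<open>
  A function \<open>h\<close> describes which coordinates are split: \<open>h k = Suc i\<close> says that coordinate \<open>k\<close>
  is the partner split off from coordinate \<open>i\<close>, and \<open>h k = 0\<close> that \<open>k\<close> is nobody's partner. Both
  members of such a pair are active.
\<close>

definition split_active :: "(nat \<Rightarrow> nat) \<Rightarrow> nat \<Rightarrow> bool" where
  "split_active h i \<longleftrightarrow> h i \<noteq> 0 \<or> (\<exists>k. h k = Suc i)"

definition split_scale :: "real \<Rightarrow> (nat \<Rightarrow> nat) \<Rightarrow> nat \<Rightarrow> real" where
  "split_scale p h i = (if split_active h i then 2 powr (- 1 / p) else 1)"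

text \<open>
  With \<open>\<delta> = 2 powr (- 1 / p)\<close>, the vector of index \<open>i\<close> is \<open>\<delta> (e\<^sub>i + e\<^sub>k)\<close> if \<open>k\<close> is the partner
  of \<open>i\<close>, it is \<open>\<delta> e\<^sub>i\<close> if \<open>i\<close> itself is a partner, and \<open>e\<^sub>i\<close> otherwise. The first and the last
  of these have norm 1.
\<close>

definition split_basis :: "real \<Rightarrow> (nat \<Rightarrow> nat) \<Rightarrow> nat \<Rightarrow> nat \<Rightarrow> complex" where
  "split_basis p h i n = (if n = i \<or> h n = Suc i then of_real (split_scale p h i) else 0)"

definition split_parent :: "(nat \<Rightarrow> nat) \<Rightarrow> (nat \<Rightarrow> 'a::zero) \<Rightarrow> nat \<Rightarrow> 'a" where
  "split_parent h z n = (if h n = 0 then 0 else z (h n - 1))"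

text \<open>
  The combination of the vectors \<open>split_basis p h i\<close> with coefficients \<open>z i\<close>, given by its
  coordinates: all factors \<open>\<delta>\<close> are pulled out, and what remains are sums of at most two
  coefficients.
\<close>

definition split_comb :: "real \<Rightarrow> (nat \<Rightarrow> nat) \<Rightarrow> (nat \<Rightarrow> complex) \<Rightarrow> nat \<Rightarrow> complex" where
  "split_comb p h z n = of_real (split_scale p h n) * (z n + split_parent h z n)"

text \<open>
  Twice the weight of index \<open>i\<close> in the norm of a combination of length \<open>L\<close>. An active pair
  contributes the weight 1/2 for each member; but if the partner of \<open>i\<close> has no index below \<open>L\<close>,
  then its coordinate carries the same value as coordinate \<open>i\<close>, and together they have the
  weight 1 of an unsplit vector. Only partners below \<open>L\<close> have to be known.
\<close>

definition split_weight :: "(nat \<Rightarrow> nat) \<Rightarrow> nat \<Rightarrow> nat \<Rightarrow> nat" where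
  "split_weight h L i = (if h i = 0 \<and> \<not> (\<exists>k<L. h k = Suc i) then 2 else 1)"

text \<open>
  The pairs of a coordinate and its partner are disjoint.
\<close>

definition splitting :: "(nat \<Rightarrow> nat) \<Rightarrow> bool" where
  "splitting h \<longleftrightarrow> (\<forall>k l. h k = h l \<longrightarrow> h k \<noteq> 0 \<longrightarrow> k = l) \<and> (\<forall>k i. h k = Suc i \<longrightarrow> h i = 0)"

lemma splitting_inj:
  assumes "splitting h" and "h k = Suc i" and "h l = Suc i"
  shows "k = l"
  using assms(1)[unfolded splitting_def, THEN conjunct1, rule_format, of k l] assms(2,3) by simp

lemma splitting_parent: "splitting h \<Longrightarrow> h k = Suc i \<Longrightarrow> h i = 0"
  unfolding splitting_def by (drule conjunct2) simp

lemma splitting_zero: "splitting (\<lambda>_. 0)"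
  by (simp add: splitting_def)

lemma split_basis_zero: "split_basis p (\<lambda>_. 0) = std_basis"
  by (intro ext) (simp add: split_basis_def std_basis_apply split_scale_def split_active_def)

lemma split_comb_scale: "split_comb p h (\<lambda>i. a * z i) = (\<lambda>n. a * split_comb p h z n)"
  by (intro ext) (simp add: split_comb_def split_parent_def algebra_simps)

lemma split_comb_diff: "split_comb p h (\<lambda>i. z i - w i) = (\<lambda>n. split_comb p h z n - split_comb p h w n)"
  by (intro ext) (simp add: split_comb_def split_parent_def algebra_simps)

lemma split_comb_zero: "split_comb p (\<lambda>_. 0) z = z"
  by (intro ext) (simp add: split_comb_def split_parent_def split_scale_def split_active_def)

lemma split_scale_pos: "0 < split_scale p h i"
  by (simp add: split_scale_def)

lemma split_scale_parent:
  assumes "h k = Suc i"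
  shows "split_scale p h i = split_scale p h k"
proof -
  have "split_active h i" and "split_active h k"
    unfolding split_active_def using assms by (blast, simp)
  then show ?thesis
    by (simp add: split_scale_def)
qed

lemma finite_split_children:
  assumes "splitting h"
  shows "finite {k. \<exists>i<L. h k = Suc i}"
proof -
  have "inj_on h {k. \<exists>i<L. h k = Suc i}"
  proof (rule inj_onI)
    fix k l assume k: "k \<in> {k. \<exists>i<L. h k = Suc i}" and eq: "h k = h l"
    from k obtain i where "h k = Suc i"
      by blast
    with eq show "k = l"
      by (intro splitting_inj[OF assms, of k i l]) simp_all
  qed
  moreover have "h ` {k. \<exists>i<L. h k = Suc i} \<subseteq> {..L}"
    by auto
  ultimately show ?thesis
    by (rule finite_imageD[OF finite_subset[OF _ finite_atMost], rotated])
qed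

lemma split_comb_apply:
  assumes h: "splitting h" and z: "\<And>i. L \<le> i \<Longrightarrow> z i = 0"
  shows "(\<Sum>i<L. z i * split_basis p h i n) = split_comb p h z n"
proof -
  have disj: "h n \<noteq> Suc n"
    using splitting_parent[OF h, of n n] by auto
  have "(\<Sum>i<L. z i * split_basis p h i n) =
      (\<Sum>i<L. (if n = i then z i * of_real (split_scale p h i) else 0)
        + (if h n = Suc i then z i * of_real (split_scale p h i) else 0))"
    using disj by (intro sum.cong) (auto simp: split_basis_def)
  also have "\<dots> = (\<Sum>i<L. if n = i then z i * of_real (split_scale p h i) else 0)
      + (\<Sum>i<L. if h n = Suc i then z i * of_real (split_scale p h i) else 0)"
    by (rule sum.distrib)
  also have "(\<Sum>i<L. if n = i then z i * of_real (split_scale p h i) else 0) = z n * of_real (split_scale p h n)"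
    using z[of n] by (cases "n < L") (simp_all add: not_less)
  also have "(\<Sum>i<L. if h n = Suc i then z i * of_real (split_scale p h i) else 0)
      = split_parent h z n * of_real (split_scale p h n)"
  proof (cases "h n")
    case (Suc j)
    then show ?thesis
      using z[of j] split_scale_parent[of h n j p, OF Suc]
      by (cases "j < L") (simp_all add: split_parent_def not_less)
  qed (simp add: split_parent_def)
  finally show ?thesis
    by (simp add: split_comb_def algebra_simps)
qed

lemma split_scale_powr:
  assumes "1 \<le> p"
  shows "2 * split_scale p h i powr p = (if split_active h i then 1 else 2)"
proof -
  have "(2 powr (- 1 / p)) powr p = (2 :: real) powr - 1"
    using assms by (subst powr_powr) simp
  then show ?thesis
    by (simp add: split_scale_def powr_minus)
qed

text \<open>
  The coordinates outside \<open>{..<L}\<close> that do not vanish belong to partners \<open>k\<close> of indices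
  \<open>i < L\<close>; each of them is moved to its \<open>i\<close>, where it completes the weight.
\<close>

lemma split_comb_mem_norm:
  assumes p: "1 \<le> p" and h: "splitting h" and z: "\<And>i. L \<le> i \<Longrightarrow> z i = (0::complex)"
  shows "split_comb p h z \<in> lp_carrier p"
    and "2 * lp_norm p (split_comb p h z) powr p = (\<Sum>i<L. real (split_weight h L i) * cmod (z i + split_parent h z i) powr p)"
proof -
  let ?g = "split_comb p h z"
  let ?C = "{k. L \<le> k \<and> (\<exists>i<L. h k = Suc i)}"
  let ?I = "{i. i < L \<and> (\<exists>k\<ge>L. h k = Suc i)}"
  have finC: "finite ?C"
    by (rule finite_subset[OF _ finite_split_children[OF h, of L]]) auto
  have supp: "?g n = 0" if "n \<notin> {..<L} \<union> ?C" for n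
  proof -
    have "L \<le> n"
      using that by auto
    moreover have "split_parent h z n = 0"
    proof (cases "h n")
      case (Suc i)
      then have "\<not> i < L"
        using that by auto
      with Suc show ?thesis
        by (simp add: split_parent_def z not_less)
    qed (simp add: split_parent_def)
    ultimately show ?thesis
      by (simp add: split_comb_def z)
  qed
  have sums: "(\<lambda>n. cmod (?g n) powr p) sums (\<Sum>n\<in>{..<L} \<union> ?C. cmod (?g n) powr p)"
    by (rule sums_finite) (use finC supp in auto)
  then show mem: "?g \<in> lp_carrier p"
    by (auto simp: lp_carrier_iff dest: sums_summable)
  have g_powr: "2 * cmod (?g n) powr p = (2 * split_scale p h n powr p) * cmod (z n + split_parent h z n) powr p" for n
    using split_scale_pos[of p h n] by (simp add: split_comb_def norm_mult powr_mult)
  have child: "2 * cmod (?g k) powr p = cmod (z (h k - 1) + split_parent h z (h k - 1)) powr p" if "k \<in> ?C" for k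
  proof -
    from that obtain i where i: "i < L" "h k = Suc i" "L \<le> k"
      by auto
    have "split_active h k"
      using i(2) by (simp add: split_active_def)
    then show ?thesis
      unfolding g_powr split_scale_powr[OF p]
      using i splitting_parent[OF h i(2)] by (simp add: z split_parent_def)
  qed
  have bij: "bij_betw (\<lambda>k. h k - 1) ?C ?I"
    unfolding bij_betw_def
  proof
    show "inj_on (\<lambda>k. h k - 1) ?C"
    proof (rule inj_onI)
      fix k l assume "k \<in> ?C" "l \<in> ?C" "h k - 1 = h l - 1"
      then obtain i where "h k = Suc i" "h l = Suc i"
        by auto
      then show "k = l"
        by (rule splitting_inj[OF h])
    qed
    show "(\<lambda>k. h k - 1) ` ?C = ?I"
    proof
      show "?I \<subseteq> (\<lambda>k. h k - 1) ` ?C"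
      proof
        fix i assume "i \<in> ?I"
        then obtain k where "i < L" "L \<le> k" "h k = Suc i"
          by auto
        then show "i \<in> (\<lambda>k. h k - 1) ` ?C"
          by (intro image_eqI[of _ _ k]) auto
      qed
    qed auto
  qed
  have "lp_norm p ?g powr p = (\<Sum>n\<in>{..<L} \<union> ?C. cmod (?g n) powr p)"
    using sums_unique[OF sums] by (simp add: lp_norm_powr[OF p mem])
  also have "\<dots> = (\<Sum>n<L. cmod (?g n) powr p) + (\<Sum>n\<in>?C. cmod (?g n) powr p)"
    using finC by (intro sum.union_disjoint) auto
  finally have "2 * lp_norm p ?g powr p = (\<Sum>n<L. 2 * cmod (?g n) powr p) + (\<Sum>n\<in>?C. 2 * cmod (?g n) powr p)"
    by (simp add: sum_distrib_left distrib_left)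
  also have "(\<Sum>n\<in>?C. 2 * cmod (?g n) powr p)
      = (\<Sum>k\<in>?C. cmod (z (h k - 1) + split_parent h z (h k - 1)) powr p)"
    by (rule sum.cong[OF refl child])
  also have "\<dots> = (\<Sum>i\<in>?I. cmod (z i + split_parent h z i) powr p)"
    by (rule sum.reindex_bij_betw[OF bij])
  also have "\<dots> = (\<Sum>i<L. of_bool (i \<in> ?I) * cmod (z i + split_parent h z i) powr p)"
    by (rule sum.mono_neutral_cong_left) auto
  also have "(\<Sum>n<L. 2 * cmod (?g n) powr p) + (\<Sum>i<L. of_bool (i \<in> ?I) * cmod (z i + split_parent h z i) powr p)
      = (\<Sum>i<L. (2 * split_scale p h i powr p + of_bool (i \<in> ?I)) * cmod (z i + split_parent h z i) powr p)"
    unfolding g_powr by (simp add: sum.distrib distrib_right)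
  also have "\<dots> = (\<Sum>i<L. real (split_weight h L i) * cmod (z i + split_parent h z i) powr p)"
  proof (rule sum.cong[OF refl])
    fix i assume "i \<in> {..<L}"
    then have "i < L" by simp
    have "2 * split_scale p h i powr p + of_bool (i \<in> ?I) = real (split_weight h L i)"
    proof (cases "\<exists>k. h k = Suc i")
      case True
      then obtain k where k: "h k = Suc i" ..
      have "h i = 0" "\<And>l. h l = Suc i \<longleftrightarrow> l = k"
        using splitting_parent[OF h k] splitting_inj[OF h] k by blast+
      then show ?thesis
        using \<open>i < L\<close> by (auto simp: split_scale_powr[OF p] split_active_def split_weight_def)
    next
      case False
      then show ?thesis
        by (auto simp: split_scale_powr[OF p] split_active_def split_weight_def)
    qed
    then show "(2 * split_scale p h i powr p + of_bool (i \<in> ?I)) * cmod (z i + split_parent h z i) powr p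
        = real (split_weight h L i) * cmod (z i + split_parent h z i) powr p"
      by simp
  qed
  finally show "2 * lp_norm p ?g powr p
      = (\<Sum>i<L. real (split_weight h L i) * cmod (z i + split_parent h z i) powr p)" .
qed

lemma split_comb_single:
  assumes "splitting h"
  shows "split_comb p h (\<lambda>i. if i = m then a else 0) = (\<lambda>n. a * split_basis p h m n)"
proof (rule ext)
  fix n
  have "(\<Sum>i<Suc m. (if i = m then a else 0) * split_basis p h i n) = split_comb p h (\<lambda>i. if i = m then a else 0) n"
    by (rule split_comb_apply[OF assms]) simp
  then show "split_comb p h (\<lambda>i. if i = m then a else 0) n = a * split_basis p h m n"
    by simp
qed

lemma split_basis_mem:
  assumes "1 \<le> p" and "splitting h"
  shows "split_basis p h i \<in> lp_carrier p"
proof -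
  have "split_comb p h (\<lambda>k. if k = i then 1 else 0) \<in> lp_carrier p"
    by (rule split_comb_mem_norm(1)[OF assms, of "Suc i"]) simp
  then show ?thesis
    by (simp add: split_comb_single[OF assms(2)])
qed

lemma lin_comb_lp:
  assumes p: "1 \<le> p" and F: "\<And>i. F i \<in> lp_carrier p"
  shows "lin_comb (lp_space p) F cs = (\<lambda>n. \<Sum>i<length cs. cs ! i * F i n)"
proof -
  interpret complex_normed_space "lp_space p"
    by (rule complex_normed_space_lp[OF p])
  have "(\<Oplus>\<^bsub>lp_space p\<^esub>i\<in>{..<k}. cs ! i \<odot>\<^bsub>lp_space p\<^esub> F i) = (\<lambda>n. \<Sum>i<k. cs ! i * F i n)" for k
  proof (induction k)
    case 0
    show ?case
      by (simp add: lp_space_simps)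
  next
    case (Suc k)
    have "(\<Oplus>\<^bsub>lp_space p\<^esub>i\<in>{..<Suc k}. cs ! i \<odot>\<^bsub>lp_space p\<^esub> F i)
        = cs ! k \<odot>\<^bsub>lp_space p\<^esub> F k \<oplus>\<^bsub>lp_space p\<^esub> (\<Oplus>\<^bsub>lp_space p\<^esub>i\<in>{..<k}. cs ! i \<odot>\<^bsub>lp_space p\<^esub> F i)"
      unfolding lessThan_Suc
      by (rule finsum_insert) (auto simp: lp_space_simps intro!: lp_scale(1)[OF p F])
    then show ?case
      unfolding Suc.IH by (simp add: lp_space_simps add.commute)
  qed
  then show ?thesis
    by (simp add: lin_comb_def)
qed

lemma decode_vec_lp:
  assumes p: "1 \<le> p" and F: "\<And>i. F i \<in> lp_carrier p"
  shows "decode_vec (lp_space p) F c = (\<lambda>n. \<Sum>i<c. decode_gauss_rat (code_nth c i) * F i n)"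
proof -
  have "decode_vec (lp_space p) F c =
      (\<lambda>n. \<Sum>i<length (list_decode c). decode_gauss_rat (code_nth c i) * F i n)"
    unfolding decode_vec_def lin_comb_lp[OF p F] by (intro ext sum.cong) (auto simp: code_nth_eq)
  also have "\<dots> = (\<lambda>n. \<Sum>i<c. decode_gauss_rat (code_nth c i) * F i n)"
    using length_list_decode_le[of c]
    by (intro ext sum.mono_neutral_left) (auto simp: code_nth_eq decode_gauss_rat_0)
  finally show ?thesis .
qed

lemma decode_vec_split:
  assumes p: "1 \<le> p" and h: "splitting h"
  shows "decode_vec (lp_space p) (split_basis p h) c = split_comb p h (\<lambda>i. decode_gauss_rat (code_nth c i))"
  unfolding decode_vec_lp[OF p split_basis_mem[OF p h]]
proof (intro ext)
  show "(\<Sum>i<c. decode_gauss_rat (code_nth c i) * split_basis p h i n)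
      = split_comb p h (\<lambda>i. decode_gauss_rat (code_nth c i)) n" for n
    by (rule split_comb_apply[OF h]) (simp add: code_nth_beyond decode_gauss_rat_0)
qed

text \<open>
  Solves \<open>split_comb p h z = f\<close>: a partner has to compensate the value that its parent leaves
  in its coordinate.
\<close>

definition split_coords :: "real \<Rightarrow> (nat \<Rightarrow> nat) \<Rightarrow> (nat \<Rightarrow> complex) \<Rightarrow> nat \<Rightarrow> complex" where
  "split_coords p h f n = (f n - split_parent h f n) / of_real (split_scale p h n)"

lemma split_comb_coords:
  assumes h: "splitting h"
  shows "split_comb p h (split_coords p h f) = f"
proof
  fix n
  have nz: "complex_of_real (split_scale p h i) \<noteq> 0" for i
    using split_scale_pos[of p h i] by simp
  show "split_comb p h (split_coords p h f) n = f n"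
  proof (cases "h n")
    case 0
    then show ?thesis
      using nz by (simp add: split_comb_def split_coords_def split_parent_def)
  next
    case (Suc i)
    have "split_parent h (split_coords p h f) n = f i / of_real (split_scale p h n)"
      using Suc splitting_parent[OF h Suc] split_scale_parent[of h n i p, OF Suc]
      by (simp add: split_parent_def split_coords_def)
    then show ?thesis
      using nz Suc by (simp add: split_comb_def split_coords_def split_parent_def field_simps)
  qed
qed

text \<open>
  The coefficients are those of \<open>v\<close>, except that the scale \<open>1 / \<delta>\<close> is replaced by \<open>s\<close>; if \<open>s\<close>
  approximates it, the combination approximates \<open>v\<close> coordinate by coordinate.
\<close>

lemma split_comb_rescaled:
  assumes h: "splitting h" and s: "\<And>k i. h k = Suc i \<Longrightarrow> s i = s k"
  shows "split_comb p h (\<lambda>k. of_real (s k) * (v k - split_parent h v k)) n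
    = of_real (split_scale p h n * s n) * v n"
proof (cases "h n")
  case 0
  then show ?thesis
    by (simp add: split_comb_def split_parent_def)
next
  case (Suc i)
  then have "h i = 0" "s i = s n"
    using splitting_parent[OF h Suc] s[OF Suc] by simp_all
  with Suc show ?thesis
    by (simp add: split_comb_def split_parent_def algebra_simps)
qed

text \<open>
  Finitely supported vectors are dense, and the coordinates of such a vector with respect to
  the generators vanish from some index on, as only finitely many partners are involved.
\<close>

lemma generating_set_split:
  assumes p: "1 \<le> p" and h: "splitting h"
  shows "generating_set (lp_space p) (split_basis p h)"
proof -
  interpret Metric_space "lp_carrier p" "vdist (lp_space p)"
    by (rule Metric_space_lp[OF p])
  note F = split_basis_mem[OF p h]
  have "\<exists>y\<in>range (lin_comb (lp_space p) (split_basis p h)). y \<in> mball f e"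
    if f: "f \<in> lp_carrier p" and e: "0 < e" for f e
  proof -
    obtain M where M: "lp_norm p (\<lambda>n. f n - (if n < M then f n else 0)) < e"
      using lp_truncate[OF p f e] .
    let ?g = "\<lambda>n. if n < M then f n else 0"
    obtain L where L: "\<forall>k\<in>{k. \<exists>i<M. h k = Suc i} \<union> {..<M}. k < L"
      using finite_UnI[OF finite_split_children[OF h, of M] finite_lessThan[of M]]
      unfolding finite_nat_set_iff_bounded by blast
    let ?z = "split_coords p h ?g"
    have z: "?z i = 0" if "L \<le> i" for i
    proof -
      have "\<not> i < M" "\<And>j. h i = Suc j \<Longrightarrow> \<not> j < M"
        using L that by (auto dest: leD)
      then show ?thesis
        by (cases "h i") (auto simp: split_coords_def split_parent_def)
    qed
    have "lin_comb (lp_space p) (split_basis p h) (map ?z [0..<L]) = (\<lambda>n. \<Sum>i<L. ?z i * split_basis p h i n)"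
      unfolding lin_comb_lp[OF p F] by (intro ext sum.cong) auto
    also have "\<dots> = split_comb p h ?z"
      by (intro ext split_comb_apply[OF h] z)
    also have "\<dots> = ?g"
      by (rule split_comb_coords[OF h])
    finally have eq: "lin_comb (lp_space p) (split_basis p h) (map ?z [0..<L]) = ?g" .
    have g: "?g \<in> lp_carrier p"
      unfolding lp_carrier_iff by (rule summable_finite[of "{..<M}"]) auto
    have "?g \<in> mball f e"
      using f g M by (simp add: vdist_lp[OF p f g])
    moreover have "?g \<in> range (lin_comb (lp_space p) (split_basis p h))"
      by (rule range_eqI[where x = "map ?z [0..<L]"]) (rule eq[symmetric])
    ultimately show ?thesis
      by blast
  qed
  then have "lp_carrier p \<subseteq> mtopology closure_of range (lin_comb (lp_space p) (split_basis p h))"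
    unfolding metric_closure_of by auto
  then show ?thesis
    unfolding generating_set_def using F closure_of_subset_topspace[of mtopology] by auto
qed

section \<open>Norms of combinations of the generators\<close>

lemma computable_split_parent_int [computable_intros]:
  assumes "computable X h" and "computable_int X (\<lambda>z. x (fst z) (snd z))" and "computable X n"
  shows "computable_int X (\<lambda>e. split_parent h (\<lambda>i. x i e) (n e))"
  unfolding split_parent_def
  by (intro computable_intros computable_compose[OF assms(1)] computable_int2[OF assms(2)] assms(3))

lemma computable_split_weight:
  assumes "computable X h" and "computable X L" and "computable X i"
  shows "computable X (\<lambda>e. split_weight h (L e) (i e))"
  unfolding split_weight_def
  by (intro computable_intros computable_compose[OF assms(1)] computable_compose[OF assms(3)] assms(2,3))

lemma approximable_powr:
  assumes "0 < \<rho>"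
    and "semidecidable {} (\<lambda>z. \<rho> * real (snd z) < real (fst z))"
    and "semidecidable {} (\<lambda>z. real (fst z) < \<rho> * real (snd z))"
    and "computable X y"
  shows "approximable X (\<lambda>e. real (y e) powr \<rho>)"
  using approximable_compose[OF approximable_nat_powr[OF assms(1-3)] assms(4)] .

definition int_vec :: "(nat \<Rightarrow> int) \<Rightarrow> (nat \<Rightarrow> int) \<Rightarrow> nat \<Rightarrow> complex" where
  "int_vec x y i = Complex (of_int (x i)) (of_int (y i))"

lemma split_parent_int_vec:
  "split_parent h (int_vec x y) i = Complex (of_int (split_parent h x i)) (of_int (split_parent h y i))"
  by (simp add: split_parent_def int_vec_def complex_eq_iff)

abbreviation center_code :: "nat \<Rightarrow> nat" where
  "center_code b \<equiv> fst (prod_decode b)"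

abbreviation radius_code :: "nat \<Rightarrow> nat" where
  "radius_code b \<equiv> snd (prod_decode b)"

abbreviation radius_num :: "nat \<Rightarrow> nat" where
  "radius_num b \<equiv> fst (prod_decode (radius_code b))"

abbreviation radius_den :: "nat \<Rightarrow> nat" where
  "radius_den b \<equiv> snd (prod_decode (radius_code b))"

locale computable_exponent =
  fixes p :: real
  assumes computable_p: "computable_real p" and p_ge_1: "1 \<le> p"
begin

abbreviation split_vec :: "(nat \<Rightarrow> nat) \<Rightarrow> nat \<Rightarrow> nat \<Rightarrow> complex" where
  "split_vec h \<equiv> decode_vec (lp_space p) (split_basis p h)"

abbreviation split_ball :: "(nat \<Rightarrow> nat) \<Rightarrow> nat \<Rightarrow> (nat \<Rightarrow> complex) set" where
  "split_ball h \<equiv> decode_ball (lp_space p) (split_basis p h)"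

abbreviation std_vec :: "nat \<Rightarrow> nat \<Rightarrow> complex" where
  "std_vec \<equiv> decode_vec (lp_space p) std_basis"

abbreviation std_ball :: "nat \<Rightarrow> (nat \<Rightarrow> complex) set" where
  "std_ball \<equiv> decode_ball (lp_space p) std_basis"

lemma norm_less_iff_powr:
  assumes "0 \<le> r" and "0 \<le> s"
  shows "r < s \<longleftrightarrow> r powr p < s powr p"
  using powr_less_mono2[of p r s] powr_mono2[of p s r] assms p_ge_1 by fastforce

text \<open>
  Both sides are raised to the power \<open>p\<close> and doubled. By the norm formula the left side becomes
  a finite sum of powers \<open>n powr (p / 2)\<close> of natural numbers with computable natural weights,
  which is approximable.
\<close>

lemma semidecidable_norm_less:
  fixes x y :: "nat \<Rightarrow> 'e::tuple \<Rightarrow> int"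
  assumes h: "splitting h" "computable X h"
    and x: "computable_int X (\<lambda>z. x (fst z) (snd z))" and y: "computable_int X (\<lambda>z. y (fst z) (snd z))"
    and L: "computable X L" and beyond: "\<And>i e. L e \<le> i \<Longrightarrow> x i e = 0 \<and> y i e = 0"
    and a: "computable X a" and b: "computable X b"
  shows "semidecidable X (\<lambda>e. real (b e) * lp_norm p (split_comb p h (int_vec (\<lambda>i. x i e) (\<lambda>i. y i e))) < real (a e))"
    and "semidecidable X (\<lambda>e. real (a e) < real (b e) * lp_norm p (split_comb p h (int_vec (\<lambda>i. x i e) (\<lambda>i. y i e))))"
proof -
  let ?N = "\<lambda>e. lp_norm p (split_comb p h (int_vec (\<lambda>i. x i e) (\<lambda>i. y i e)))"
  define X' where "X' i e = x i e + split_parent h (\<lambda>i. x i e) i" for i e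
  define Y' where "Y' i e = y i e + split_parent h (\<lambda>i. y i e) i" for i e
  define sq where "sq i e = nat (X' i e * X' i e + Y' i e * Y' i e)" for i e
  have rho: "0 < p / 2"
    using p_ge_1 by simp
  note cuts = computable_real_half_cuts[OF computable_p order_trans[OF zero_le_one p_ge_1]]
  have half: "real (m * m * n) powr (p / 2) = real m powr p * real n powr (p / 2)" for m n :: nat
  proof -
    have "real (m * m) powr (p / 2) = real m powr p"
      by (simp add: powr_mult flip: powr_add)
    then show ?thesis
      by (simp only: of_nat_mult[of "m * m" n] powr_mult of_nat_0_le_iff)
  qed
  have cmod_sq: "cmod (int_vec (\<lambda>i. x i e) (\<lambda>i. y i e) i + split_parent h (int_vec (\<lambda>i. x i e) (\<lambda>i. y i e)) i) powr p
      = real (sq i e) powr (p / 2)" for i e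
  proof -
    have "int_vec (\<lambda>i. x i e) (\<lambda>i. y i e) i + split_parent h (int_vec (\<lambda>i. x i e) (\<lambda>i. y i e)) i
        = Complex (of_int (X' i e)) (of_int (Y' i e))"
      unfolding split_parent_int_vec by (simp add: int_vec_def X'_def Y'_def complex_eq_iff)
    moreover have "(cmod (Complex (of_int (X' i e)) (of_int (Y' i e))))\<^sup>2 = real (sq i e)"
      unfolding cmod_power2 by (simp add: sq_def power2_eq_square)
    ultimately show ?thesis
      unfolding cmod_powr_square by simp
  qed
  have norm: "2 * ?N e powr p = (\<Sum>i<L e. real (split_weight h (L e) i) * real (sq i e) powr (p / 2))" for e
    unfolding cmod_sq[symmetric]
    by (rule split_comb_mem_norm(2)[OF p_ge_1 h(1)]) (use beyond in \<open>simp add: int_vec_def complex_eq_iff\<close>)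
  let ?S = "\<lambda>e. \<Sum>i<L e. real (split_weight h (L e) i) * real (b e * b e * sq i e) powr (p / 2)"
  let ?A = "\<lambda>e. real 2 * real (a e * a e * 1) powr (p / 2)"
  have S: "?S e = 2 * (real (b e) * ?N e) powr p" for e
  proof -
    have "?S e = real (b e) powr p * (2 * ?N e powr p)"
      unfolding norm half by (simp add: sum_distrib_left mult_ac)
    then show ?thesis
      by (simp add: powr_mult lp_norm_nonneg)
  qed
  have A: "?A e = 2 * real (a e) powr p" for e
    unfolding half by simp
  have sq: "computable X (\<lambda>z. sq (fst z) (snd z))"
    unfolding sq_def X'_def Y'_def
    by (intro computable_intros x y computable_int2[OF x] computable_int2[OF y] h(2))
  have approx_S: "approximable X ?S"
    by (intro approximable_sum approximable_mult_nat approximable_powr[OF rho cuts] computable_intros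
        computable_split_weight h(2) computable_compose[OF L] L computable_compose[OF b] sq)
  have approx_A: "approximable X ?A"
    by (intro approximable_mult_nat approximable_powr[OF rho cuts] computable_intros a)
  have iff: "?S e < ?A e \<longleftrightarrow> real (b e) * ?N e < real (a e)" "?A e < ?S e \<longleftrightarrow> real (a e) < real (b e) * ?N e" for e
    unfolding S A
    using norm_less_iff_powr[of "real (b e) * ?N e" "real (a e)"] norm_less_iff_powr[of "real (a e)" "real (b e) * ?N e"]
    by (simp_all add: lp_norm_nonneg)
  show "semidecidable X (\<lambda>e. real (b e) * ?N e < real (a e))"
    using semidecidable_less_approximable[OF approx_S approx_A] unfolding iff .
  show "semidecidable X (\<lambda>e. real (a e) < real (b e) * ?N e)"
    using semidecidable_less_approximable[OF approx_A approx_S] unfolding iff .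
qed

lemma split_comb_mem:
  assumes "splitting h" and "\<And>i. L \<le> i \<Longrightarrow> z i = 0"
  shows "split_comb p h z \<in> lp_carrier p"
  by (rule split_comb_mem_norm(1)[OF p_ge_1 assms])

lemma decode_vec_int_vec:
  assumes "splitting h"
  shows "of_nat (vec_den c) * split_vec h c n
    = split_comb p h (int_vec (vec_re c) (vec_im c)) n"
proof -
  have nz: "complex_of_nat (vec_den c) \<noteq> 0"
    using vec_den_pos[of c] by simp
  have "int_vec (vec_re c) (vec_im c) = (\<lambda>i. of_nat (vec_den c) * decode_gauss_rat (code_nth c i))"
    using nz by (intro ext) (simp add: decode_gauss_rat_code_nth int_vec_def)
  then show ?thesis
    unfolding decode_vec_split[OF p_ge_1 assms] by (simp only: split_comb_scale)
qed

lemma decode_vec_mem: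
  assumes "splitting h"
  shows "split_vec h c \<in> lp_carrier p"
  unfolding decode_vec_split[OF p_ge_1 assms]
  by (rule split_comb_mem[OF assms, of c]) (simp add: code_nth_beyond decode_gauss_rat_0)

lemma norm_decode_vec:
  assumes "splitting h"
  shows "real (vec_den c) * lp_norm p (split_vec h c)
    = lp_norm p (split_comb p h (int_vec (vec_re c) (vec_im c)))"
  unfolding decode_vec_int_vec[OF assms, symmetric, abs_def]
  using lp_scale(2)[OF p_ge_1 decode_vec_mem[OF assms], of "of_nat (vec_den c)"] by simp

text \<open>
  Norms are found by searching for a confirmed approximation with denominator \<open>2 ^ k\<close>. Whether
  an index is split is never decided here: only partners below the length of the combination
  enter.
\<close>

lemma computable_banach_space_split:
  assumes h: "splitting h" "computable {} h"
  shows "computable_banach_space (lp_space p) (split_basis p h)"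
proof -
  let ?v = "split_vec h"
  let ?N = "\<lambda>c. lp_norm p (split_comb p h (int_vec (vec_re c) (vec_im c)))"
  let ?R = "\<lambda>a z. real (2 ^ snd z) * ?N (fst z) < real (Suc a * vec_den (fst z)) \<and>
    (a = 0 \<or> real ((a - 1) * vec_den (fst z)) < real (2 ^ snd z) * ?N (fst z))"
  have less: "semidecidable {} (\<lambda>z. real (2 ^ snd (snd z)) * ?N (fst (snd z))
      < real (Suc (fst z) * vec_den (fst (snd z))))"
    by (rule semidecidable_norm_less(1)[OF h, where L = "\<lambda>z. fst (snd z)"])
      (intro computable_intros | simp add: vec_re_beyond vec_im_beyond)+
  have greater: "semidecidable {} (\<lambda>z. real ((fst z - 1) * vec_den (fst (snd z)))
      < real (2 ^ snd (snd z)) * ?N (fst (snd z)))"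
    by (rule semidecidable_norm_less(2)[OF h, where L = "\<lambda>z. fst (snd z)"])
      (intro computable_intros | simp add: vec_re_beyond vec_im_beyond)+
  have R: "semidecidable {} (\<lambda>z. ?R (fst z) (snd z))"
    by (intro semidecidable_conj semidecidable_disj less greater
        semidecidable_decidable[OF decidable_eq] computable_intros)
  have ex: "\<exists>a. ?R a z" for z
  proof -
    let ?t = "real (2 ^ snd z) * ?N (fst z) / real (vec_den (fst z))"
    have D: "0 < real (vec_den (fst z))"
      using vec_den_pos by simp
    have "0 \<le> ?t"
      by (simp add: lp_norm_nonneg)
    then have "?t < real (Suc (nat \<lfloor>?t\<rfloor>)) \<and> (nat \<lfloor>?t\<rfloor> = 0 \<or> real (nat \<lfloor>?t\<rfloor> - 1) < ?t)"
      by linarith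
    then obtain a where "?t < real (Suc a)" "a = 0 \<or> real (a - 1) < ?t"
      by blast
    then have "?R a z"
      unfolding pos_divide_less_eq[OF D] pos_less_divide_eq[OF D] of_nat_mult by blast
    then show ?thesis ..
  qed
  obtain g where g: "computable {} g" "\<And>z. ?R (g z) z"
    by (rule semidecidable_select[of "{}" ?R, OF R ex]) blast
  let ?q = "\<lambda>z. prod_encode (int_encode (int (g z)), int_encode (int (2 ^ snd z)))"
  have "computable {} ?q"
    by (intro computable_intros g(1))
  then obtain P where P: "\<And>z. runs {} P (entries z) (?q z)"
    unfolding computable_nat_iff by blast
  have "runs {} P [n, k] (?q (n, k)) \<and>
      \<bar>lp_norm p (?v n) - decode_rat (?q (n, k))\<bar> < 1 / 2 ^ k" for n k
  proof
    show "runs {} P [n, k] (?q (n, k))"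
      using P[of "(n, k)"] by (simp add: entries_prod_def entries_nat_def)
    have D: "0 < real (vec_den n)"
      using vec_den_pos by simp
    have N: "?N n = real (vec_den n) * lp_norm p (?v n)"
      by (rule norm_decode_vec[OF h(1), symmetric])
    have "real (2 ^ k) * (real (vec_den n) * lp_norm p (?v n)) < real (Suc (g (n, k)) * vec_den n)"
      and "g (n, k) = 0 \<or> real ((g (n, k) - 1) * vec_den n) < real (2 ^ k) * (real (vec_den n) * lp_norm p (?v n))"
      using g(2)[of "(n, k)"] unfolding fst_conv snd_conv N by blast+
    then have "real (vec_den n) * (2 ^ k * lp_norm p (?v n)) < real (vec_den n) * real (Suc (g (n, k)))"
      and "g (n, k) = 0 \<or> real (vec_den n) * real (g (n, k) - 1) < real (vec_den n) * (2 ^ k * lp_norm p (?v n))"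
      by (simp_all only: of_nat_mult of_nat_power of_nat_numeral mult.commute mult.left_commute)
    then have "2 ^ k * lp_norm p (?v n) < real (Suc (g (n, k)))"
      and "g (n, k) = 0 \<or> real (g (n, k) - 1) < 2 ^ k * lp_norm p (?v n)"
      using D by simp_all
    moreover have "0 \<le> 2 ^ k * lp_norm p (?v n)"
      by (simp add: lp_norm_nonneg)
    ultimately have "\<bar>2 ^ k * lp_norm p (?v n) - real (g (n, k))\<bar> < 1"
      by linarith
    then have "\<bar>2 ^ k * lp_norm p (?v n) - real (g (n, k))\<bar> / 2 ^ k < 1 / 2 ^ k"
      by (simp add: divide_strict_right_mono)
    moreover have "\<bar>2 ^ k * lp_norm p (?v n) - real (g (n, k))\<bar> / 2 ^ k
        = \<bar>lp_norm p (?v n) - real (g (n, k)) / 2 ^ k\<bar>"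
      by (simp add: field_simps flip: abs_divide[of _ "2 ^ k :: real", simplified])
    ultimately show "\<bar>lp_norm p (?v n) - decode_rat (?q (n, k))\<bar> < 1 / 2 ^ k"
      by (simp add: decode_rat_encode)
  qed
  then have "\<exists>P. \<forall>n k. \<exists>q. runs {} P [n, k] q \<and> \<bar>lp_norm p (?v n) - decode_rat q\<bar> < 1 / 2 ^ k"
    by blast
  then show ?thesis
    unfolding computable_banach_space_def effective_generating_set_def
    using complex_banach_space_lp[OF p_ge_1] generating_set_split[OF p_ge_1 h(1)] by blast
qed

section \<open>From an isometry to the split coordinates\<close>

lemma decode_ball_iff:
  assumes "splitting h"
  shows "f \<in> split_ball h b \<longleftrightarrow> f \<in> lp_carrier p \<and>
    lp_norm p (\<lambda>n. split_vec h (center_code b) n - f n)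
      < decode_pos_rat (radius_code b)"
proof -
  interpret Metric_space "lp_carrier p" "vdist (lp_space p)"
    by (rule Metric_space_lp[OF p_ge_1])
  show ?thesis
    using decode_vec_mem[OF assms, of "center_code b"]
    by (auto simp: decode_ball_def case_prod_unfold vdist_lp[OF p_ge_1])
qed

lemma semidecidable_basis_in_ball:
  "semidecidable X (\<lambda>z. std_basis (fst z) \<in> std_ball (snd z))"
proof -
  let ?re = "\<lambda>i j c. vec_re c i - (if i = j then int (vec_den c) else 0)"
  let ?N = "\<lambda>j c. lp_norm p (split_comb p (\<lambda>_. 0) (int_vec (\<lambda>i. ?re i j c) (vec_im c)))"
  have "std_basis j \<in> std_ball b \<longleftrightarrow>
      real (Suc (radius_den b)) * ?N j (center_code b)
        < real (Suc (radius_num b) * vec_den (center_code b))" for j b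
  proof -
    let ?c = "center_code b"
    let ?v = "std_vec ?c"
    let ?D = "vec_den ?c"
    have D: "0 < real ?D"
      using vec_den_pos by simp
    have v: "of_nat ?D * ?v n = int_vec (vec_re ?c) (vec_im ?c) n" for n
      using decode_vec_int_vec[OF splitting_zero, of ?c n] by (simp add: split_basis_zero split_comb_zero)
    have mem: "(\<lambda>n. ?v n - std_basis j n) \<in> lp_carrier p"
      using lp_diff(1)[OF p_ge_1 decode_vec_mem[OF splitting_zero, of ?c] std_basis_lp(1)[OF p_ge_1, of j]]
      by (simp add: split_basis_zero)
    have "split_comb p (\<lambda>_. 0) (int_vec (\<lambda>i. ?re i j ?c) (vec_im ?c))
        = (\<lambda>n. of_nat ?D * (?v n - std_basis j n))"
      unfolding split_comb_zero right_diff_distrib v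
      by (intro ext) (simp add: int_vec_def std_basis_apply complex_eq_iff)
    then have N: "?N j ?c = real ?D * lp_norm p (\<lambda>n. ?v n - std_basis j n)"
      using lp_scale(2)[OF p_ge_1 mem, of "of_nat ?D"] by simp
    let ?a = "real (Suc (radius_num b))"
    let ?b = "real (Suc (radius_den b))"
    have "std_basis j \<in> std_ball b \<longleftrightarrow>
        lp_norm p (\<lambda>n. ?v n - std_basis j n) * ?b < ?a"
      using decode_ball_iff[OF splitting_zero, of "std_basis j" b] std_basis_lp(1)[OF p_ge_1, of j]
      by (simp add: split_basis_zero decode_pos_rat_eq pos_less_divide_eq del: of_nat_Suc)
    also have "\<dots> \<longleftrightarrow> real ?D * (lp_norm p (\<lambda>n. ?v n - std_basis j n) * ?b) < real ?D * ?a"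
      using D by simp
    finally show ?thesis
      unfolding N of_nat_mult by (simp only: mult_ac)
  qed
  moreover have "semidecidable X (\<lambda>z. real (Suc (radius_den (snd z)))
        * ?N (fst z) (center_code (snd z))
        < real (Suc (radius_num (snd z)) * vec_den (center_code (snd z))))"
    by (rule semidecidable_norm_less(1)[OF splitting_zero computable_const,
          where L = "\<lambda>z. center_code (snd z) + Suc (fst z)"])
      (intro computable_intros | simp add: vec_re_beyond vec_im_beyond)+
  ultimately show ?thesis
    by simp
qed

text \<open>
  A test on the code \<open>b\<close> of a ball for being a small neighbourhood of a multiple of the
  generator \<open>m\<close> by a factor bounded away from 0. The factor can be taken to be the coefficient
  of the centre at \<open>m\<close>, so that the remaining condition says that the centre without this term
  is small.
\<close>

definition almost_multiple :: "(nat \<Rightarrow> nat) \<Rightarrow> nat \<Rightarrow> nat \<Rightarrow> bool" where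
  "almost_multiple h m b \<longleftrightarrow>
     (let c = center_code b; r = radius_code b; a = decode_gauss_rat (code_nth c m) in
     decode_pos_rat r \<le> 1 / 8 \<and> 1 / 2 \<le> cmod a \<and>
     lp_norm p (\<lambda>n. split_vec h c n - a * split_basis p h m n) < 1 / 8)"

text \<open>
  After multiplication by the common denominator the three conditions concern a ratio of
  natural numbers, the absolute value of a Gaussian integer, and the norm of a combination whose
  coefficient at \<open>m\<close> is replaced by 0.
\<close>

lemma semidecidable_almost_multiple:
  assumes h: "splitting h" "computable X h"
  shows "semidecidable X (\<lambda>z. almost_multiple h (fst z) (snd z))"
proof -
  let ?re = "\<lambda>i m c. if i = m then 0 else vec_re c i"
  let ?im = "\<lambda>i m c. if i = m then 0 else vec_im c i"
  let ?N = "\<lambda>m c. lp_norm p (split_comb p h (int_vec (\<lambda>i. ?re i m c) (\<lambda>i. ?im i m c)))"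
  have "almost_multiple h m b \<longleftrightarrow>
      8 * Suc (radius_num b) \<le> Suc (radius_den b) \<and>
      int (vec_den (center_code b) * vec_den (center_code b))
        \<le> int 4 * (vec_re (center_code b) m * vec_re (center_code b) m
          + vec_im (center_code b) m * vec_im (center_code b) m) \<and>
      real 8 * ?N m (center_code b) < real (vec_den (center_code b))" for m b
  proof -
    let ?c = "center_code b"
    let ?v = "split_vec h ?c"
    let ?D = "vec_den ?c"
    let ?a = "decode_gauss_rat (code_nth ?c m)"
    have D: "0 < real ?D"
      using vec_den_pos by simp
    then have nz: "complex_of_nat ?D \<noteq> 0"
      by simp
    have a: "of_nat ?D * ?a = int_vec (vec_re ?c) (vec_im ?c) m"
      using nz by (simp add: decode_gauss_rat_code_nth int_vec_def)
    have "(real ?D * cmod ?a)\<^sup>2 = real_of_int (vec_re ?c m * vec_re ?c m + vec_im ?c m * vec_im ?c m)"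
    proof -
      have "real ?D * cmod ?a = cmod (of_nat ?D * ?a)"
        by (simp add: norm_mult)
      then show ?thesis
        unfolding a int_vec_def by (simp add: cmod_power2) (simp add: power2_eq_square)
    qed
    then have sq: "4 * real_of_int (vec_re ?c m * vec_re ?c m + vec_im ?c m * vec_im ?c m) = (2 * (real ?D * cmod ?a))\<^sup>2"
      by (simp add: power_mult_distrib)
    have "1 / 2 \<le> cmod ?a \<longleftrightarrow> real ?D * 1 \<le> real ?D * (2 * cmod ?a)"
      using D by (subst mult_le_cancel_left_pos) auto
    also have "\<dots> \<longleftrightarrow> real ?D \<le> 2 * (real ?D * cmod ?a)"
      by (simp add: mult_ac)
    also have "\<dots> \<longleftrightarrow> (real ?D)\<^sup>2 \<le> (2 * (real ?D * cmod ?a))\<^sup>2"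
      by (subst power_mono_iff) auto
    also have "\<dots> \<longleftrightarrow> real_of_int (int (?D * ?D)) \<le> real_of_int (int 4 * (vec_re ?c m * vec_re ?c m + vec_im ?c m * vec_im ?c m))"
      unfolding sq[symmetric] by (simp add: power2_eq_square)
    finally have cmod_iff: "1 / 2 \<le> cmod ?a \<longleftrightarrow>
        int (?D * ?D) \<le> int 4 * (vec_re ?c m * vec_re ?c m + vec_im ?c m * vec_im ?c m)"
      by (simp only: of_int_le_iff)
    have mem: "(\<lambda>n. ?v n - ?a * split_basis p h m n) \<in> lp_carrier p"
      by (intro lp_diff(1) lp_scale(1) p_ge_1 decode_vec_mem h(1) split_basis_mem)
    have "int_vec (\<lambda>i. ?re i m ?c) (\<lambda>i. ?im i m ?c)
        = (\<lambda>i. int_vec (vec_re ?c) (vec_im ?c) i - (if i = m then of_nat ?D * ?a else 0))"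
      unfolding a by (intro ext) (simp add: int_vec_def complex_eq_iff)
    then have "split_comb p h (int_vec (\<lambda>i. ?re i m ?c) (\<lambda>i. ?im i m ?c))
        = (\<lambda>n. of_nat ?D * (?v n - ?a * split_basis p h m n))"
      unfolding right_diff_distrib decode_vec_int_vec[OF h(1)]
      by (simp add: split_comb_diff split_comb_single[OF h(1)] mult.assoc)
    then have "?N m ?c = real ?D * lp_norm p (\<lambda>n. ?v n - ?a * split_basis p h m n)"
      using lp_scale(2)[OF p_ge_1 mem, of "of_nat ?D"] by simp
    then have N_iff: "real 8 * ?N m ?c < real ?D \<longleftrightarrow> lp_norm p (\<lambda>n. ?v n - ?a * split_basis p h m n) < 1 / 8"
      using D by (auto simp: field_simps)
    have r_iff: "decode_pos_rat r \<le> 1 / 8 \<longleftrightarrow> 8 * Suc (fst (prod_decode r)) \<le> Suc (snd (prod_decode r))" for r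
    proof -
      have "decode_pos_rat r \<le> 1 / 8 \<longleftrightarrow> real (8 * Suc (fst (prod_decode r))) \<le> real (Suc (snd (prod_decode r)))"
        by (simp add: decode_pos_rat_eq divide_le_eq mult.commute)
      then show ?thesis
        by (simp only: of_nat_le_iff)
    qed
    show ?thesis
      unfolding almost_multiple_def Let_def N_iff cmod_iff r_iff ..
  qed
  moreover have "semidecidable X (\<lambda>z. real 8 * ?N (fst z) (center_code (snd z))
      < real (vec_den (center_code (snd z))))"
    by (rule semidecidable_norm_less(1)[OF h, where L = "\<lambda>z. center_code (snd z)"])
      (intro computable_intros | simp add: vec_re_beyond vec_im_beyond)+
  ultimately show ?thesis
    by (simp only:) (intro semidecidable_conj semidecidable_decidable[OF decidable_le]
        semidecidable_decidable[OF decidable_int_le] computable_intros)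
qed

text \<open>
  If \<open>m\<close> is not split, the generator is the basis vector \<open>e\<^sub>m\<close>, and every ball inside the ball
  of radius 1/32 about a unimodular multiple of it passes the test. A small set need not have a
  code with a small radius in a general metric space; in a normed space the radius is bounded by
  moving the centre by half the radius.
\<close>

lemma almost_multiple_inactive:
  assumes h: "splitting h" and m: "\<not> split_active h m"
    and norm_c: "cmod c = 1"
    and ball: "\<And>f. f \<in> split_ball h b \<Longrightarrow>
      lp_norm p (\<lambda>n. (if n = m then c else 0) - f n) < 1 / 32"
  shows "almost_multiple h m b"
proof -
  let ?w = "center_code b" and ?r = "decode_pos_rat (radius_code b)"
  let ?W = "split_vec h ?w"
  let ?e = "\<lambda>n. if n = m then c else 0"
  let ?a = "decode_gauss_rat (code_nth ?w m)"
  have W: "?W \<in> lp_carrier p"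
    by (rule decode_vec_mem[OF h])
  have e: "?e \<in> lp_carrier p"
    by (rule lp_single(1)[OF p_ge_1])
  have hm: "h m = 0" and no_child: "h n \<noteq> Suc m" for n
    using m by (auto simp: split_active_def)
  have scale: "split_scale p h m = 1"
    using m by (simp add: split_scale_def)
  have "?W \<in> split_ball h b"
    using W by (simp add: decode_ball_iff[OF h] lp_zero decode_pos_rat_pos)
  then have close: "lp_norm p (\<lambda>n. ?e n - ?W n) < 1 / 32"
    by (rule ball)
  have Wm: "?W m = ?a"
    by (simp add: decode_vec_split[OF p_ge_1 h] split_comb_def split_parent_def hm scale)
  have a: "cmod (c - ?a) < 1 / 32"
    using cmod_le_lp_norm[OF p_ge_1 lp_diff(1)[OF p_ge_1 e W], of m] close Wm by simp
  then have "1 / 2 \<le> cmod ?a"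
    using norm_c norm_triangle_ineq2[of c ?a] by simp
  moreover have "lp_norm p (\<lambda>n. ?W n - ?a * split_basis p h m n) < 1 / 8"
  proof -
    let ?d = "\<lambda>n. if n = m then c - ?a else 0"
    have d: "?d \<in> lp_carrier p" "lp_norm p ?d = cmod (c - ?a)"
      by (rule lp_single[OF p_ge_1])+
    have eq: "(\<lambda>n. ?W n - ?a * split_basis p h m n) = (\<lambda>n. ?d n - (?e n - ?W n))"
      using no_child by (auto simp: split_basis_def scale)
    show ?thesis
      unfolding eq
      using lp_diff(2)[OF p_ge_1 d(1) lp_diff(1)[OF p_ge_1 e W]] d(2) a close by linarith
  qed
  moreover have "?r \<le> 1 / 8"
  proof -
    let ?s = "\<lambda>n. if n = 0 then complex_of_real (?r / 2) else 0"
    have s: "?s \<in> lp_carrier p" "lp_norm p ?s = ?r / 2"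
      using lp_single[OF p_ge_1, of 0 "complex_of_real (?r / 2)"] decode_pos_rat_pos[of "radius_code b"] by auto
    have Ws: "(\<lambda>n. ?W n - ?s n) \<in> lp_carrier p"
      by (rule lp_diff(1)[OF p_ge_1 W s(1)])
    have "(\<lambda>n. ?W n - ?s n) \<in> split_ball h b"
      unfolding decode_ball_iff[OF h]
    proof
      have "lp_norm p (\<lambda>n. ?W n - (?W n - ?s n)) = ?r / 2"
        using s(2) by simp
      then show "lp_norm p (\<lambda>n. ?W n - (?W n - ?s n)) < ?r"
        using decode_pos_rat_pos[of "radius_code b"] by linarith
    qed (rule Ws)
    then have "lp_norm p (\<lambda>n. ?e n - (?W n - ?s n)) < 1 / 32"
      by (rule ball)
    moreover have "(\<lambda>n. (?e n - (?W n - ?s n)) - (?e n - ?W n)) = ?s"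
      by auto
    ultimately have "?r / 2 < 1 / 32 + 1 / 32"
      using lp_diff(2)[OF p_ge_1 lp_diff(1)[OF p_ge_1 e Ws] lp_diff(1)[OF p_ge_1 e W]] s(2) close by simp
    then show ?thesis
      by simp
  qed
  ultimately show ?thesis
    by (simp add: almost_multiple_def Let_def)
qed

text \<open>
  If \<open>m\<close> is split, every multiple of its generator by a factor of absolute value at least 1/2
  has absolute value at least 1/4 in two coordinates, since \<open>\<delta> \<ge> 1/2\<close>. A multiple of a basis
  vector vanishes in one of them, which is incompatible with two errors below 1/8.
\<close>

lemma not_almost_multiple_active:
  assumes h: "splitting h" and k: "h k = Suc m"
    and in_ball: "(\<lambda>n. if n = i then c else 0) \<in> split_ball h b"
  shows "\<not> almost_multiple h m b"
proof
  assume am: "almost_multiple h m b"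
  let ?w = "center_code b" and ?r = "decode_pos_rat (radius_code b)"
  let ?W = "split_vec h ?w"
  let ?e = "\<lambda>n. if n = i then c else 0"
  let ?a = "decode_gauss_rat (code_nth ?w m)"
  have r: "?r \<le> 1 / 8" and a: "1 / 2 \<le> cmod ?a"
    and rest: "lp_norm p (\<lambda>n. ?W n - ?a * split_basis p h m n) < 1 / 8"
    using am by (simp_all add: almost_multiple_def Let_def)
  have W: "?W \<in> lp_carrier p"
    by (rule decode_vec_mem[OF h])
  have e: "?e \<in> lp_carrier p"
    by (rule lp_single(1)[OF p_ge_1])
  have close: "lp_norm p (\<lambda>n. ?W n - ?e n) < 1 / 8"
    using in_ball r by (simp add: decode_ball_iff[OF h])
  have "m \<noteq> k"
    using splitting_parent[OF h k] k by auto
  then obtain n where n: "n \<noteq> i" "n = m \<or> n = k"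
    by metis
  then have "split_basis p h m n = of_real (split_scale p h m)"
    using k by (auto simp: split_basis_def)
  moreover have "1 / 2 \<le> split_scale p h m"
  proof -
    have "(2 :: real) powr - 1 \<le> 2 powr (- 1 / p)"
      using p_ge_1 by (intro powr_mono) (auto simp: field_simps)
    then show ?thesis
      using k by (auto simp: split_scale_def powr_minus)
  qed
  ultimately have "1 / 2 \<le> cmod (split_basis p h m n)"
    by simp
  then have "1 / 2 * (1 / 2) \<le> cmod (?a * split_basis p h m n)"
    unfolding norm_mult using a by (intro mult_mono) auto
  moreover have "cmod (?W n) < 1 / 8"
    using cmod_le_lp_norm[OF p_ge_1 lp_diff(1)[OF p_ge_1 W e], of n] close n(1) by simp
  moreover have "cmod (?W n - ?a * split_basis p h m n) < 1 / 8"
    using cmod_le_lp_norm[OF p_ge_1 lp_diff(1)[OF p_ge_1 W lp_scale(1)[OF p_ge_1 split_basis_mem[OF p_ge_1 h, of m], of ?a]], of n] rest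
    by simp
  ultimately show False
    using norm_triangle_ineq4[of "?W n" "?W n - ?a * split_basis p h m n"] by simp
qed

text \<open>
  A coordinate \<open>m\<close> is not split exactly if \<open>h m = 0\<close> and the isometry sends some basis vector,
  by the evidence of its program, into a ball that passes the test for \<open>m\<close>: the values at basis
  vectors are the unimodular multiples of all basis vectors. So being split and not being split
  are both semidecidable.
\<close>

lemma decidable_active_if_computes_isometry:
  assumes "p \<noteq> 2" and h: "splitting h" "computable X h"
    and T: "surjective_linear_isometry (lp_space p) (lp_space p) T"
    and comp: "oracle_computes_map X (lp_space p) std_basis (lp_space p) (split_basis p h) T"
  shows "decidable X (split_active h)"
proof -
  interpret lp_isometry p T
    by unfold_locales (use assms p_ge_1 in auto)
  interpret Metric_space "lp_carrier p" "vdist (lp_space p)"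
    by (rule Metric_space_lp[OF p_ge_1])
  obtain P where P: "\<forall>b b'. runs X P [b] b' \<longrightarrow>
        T ` std_ball b \<subseteq> split_ball h b'"
    "\<forall>f\<in>lp_carrier p. \<forall>N M. openin mtopology N \<longrightarrow> f \<in> N \<longrightarrow>
        openin mtopology M \<longrightarrow> T f \<in> M \<longrightarrow>
        (\<exists>b b'. f \<in> std_ball b \<and> std_ball b \<subseteq> N \<and>
          runs X P [b] b' \<and> split_ball h b' \<subseteq> M)"
    using comp unfolding oracle_computes_map_def by (elim exE conjE) (rule that)
  note sound = P(1)[rule_format] and complete = P(2)[rule_format]
  let ?R = "\<lambda>m. \<exists>j b b'. std_basis j \<in> std_ball b \<and> runs X P [b] b' \<and>
    almost_multiple h m b'"
  have iff: "\<not> split_active h m \<longleftrightarrow> h m = 0 \<and> ?R m" for m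
  proof
    assume m: "\<not> split_active h m"
    obtain j c where c: "cmod c = 1" and Tj: "T (std_basis j) = (\<lambda>n. if n = m then c else 0)"
      by (rule T_onto_basis)
    let ?e = "\<lambda>n. if n = m then c else 0"
    have e: "?e \<in> lp_carrier p"
      by (rule lp_single(1)[OF p_ge_1])
    have "std_basis j \<in> topspace mtopology" "T (std_basis j) \<in> mball ?e (1 / 32)"
      using e std_basis_lp(1)[OF p_ge_1, of j] by (simp_all add: Tj)
    from complete[OF std_basis_lp(1)[OF p_ge_1] openin_topspace this(1) openin_mball this(2)]
    obtain b b' where b: "std_basis j \<in> std_ball b" "runs X P [b] b'"
      "split_ball h b' \<subseteq> mball ?e (1 / 32)"
      by blast
    have "almost_multiple h m b'"
    proof (rule almost_multiple_inactive[OF h(1) m c])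
      fix f assume "f \<in> split_ball h b'"
      then have "f \<in> mball ?e (1 / 32)"
        using b(3) by blast
      then have "f \<in> lp_carrier p" "vdist (lp_space p) ?e f < 1 / 32"
        by simp_all
      then show "lp_norm p (\<lambda>n. ?e n - f n) < 1 / 32"
        using vdist_lp[OF p_ge_1 e] by simp
    qed
    moreover have "h m = 0"
      using m by (simp add: split_active_def)
    ultimately show "h m = 0 \<and> ?R m"
      using b(1,2) by blast
  next
    assume "h m = 0 \<and> ?R m"
    then obtain j b b' where hm: "h m = 0" and b: "std_basis j \<in> std_ball b"
      "runs X P [b] b'" "almost_multiple h m b'"
      by blast
    obtain i c where Tj: "T (std_basis j) = (\<lambda>n. if n = i then c else 0)"
      by (rule T_basis)
    have "T (std_basis j) \<in> split_ball h b'"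
      using sound[OF b(2)] imageI[OF b(1)] by (rule subsetD)
    then have in_ball: "(\<lambda>n. if n = i then c else 0) \<in> split_ball h b'"
      unfolding Tj .
    show "\<not> split_active h m"
    proof
      assume "split_active h m"
      with hm obtain k where "h k = Suc m"
        by (auto simp: split_active_def)
      from not_almost_multiple_active[OF h(1) this in_ball] b(3) show False
        by simp
    qed
  qed
  have co: "semidecidable X (\<lambda>m. \<not> split_active h m)"
    unfolding iff
    by (intro semidecidable_intros semidecidable_decidable[OF decidable_eq] computable_intros h(2)
        semidecidable2[OF semidecidable_basis_in_ball] semidecidable2[OF semidecidable_runs]
        semidecidable2[OF semidecidable_almost_multiple[OF h]])
  have "semidecidable X (split_active h)"
    unfolding split_active_def[abs_def]
    by (intro semidecidable_intros semidecidable_decidable[OF decidable_not] semidecidable_decidable[OF decidable_eq]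
        computable_intros h(2) computable_compose[OF h(2)])
  then show ?thesis
    using co by (rule decidable_if_semidecidable)
qed

end

section \<open>From the split coordinates to an isometry\<close>

definition gauss_code :: "int \<Rightarrow> int \<Rightarrow> nat \<Rightarrow> nat" where
  "gauss_code x y d = prod_encode (prod_encode (int_encode x, int_encode (int d)),
     prod_encode (int_encode y, int_encode (int d)))"

lemma decode_gauss_code:
  "decode_gauss_rat (gauss_code x y d) = Complex (of_int x) (of_int y) / of_nat d"
  by (simp add: gauss_code_def decode_gauss_rat_def decode_rat_encode complex_eq_iff)

lemma computable_gauss_code [computable_intros]:
  assumes "computable_int X x" and "computable_int X y" and "computable X d"
  shows "computable X (\<lambda>e. gauss_code (x e) (y e) (d e))"
  unfolding gauss_code_def by (intro computable_intros assms)

lemma decode_gauss_rat_dense: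
  assumes "0 < e"
  obtains n where "cmod (decode_gauss_rat n - z) < e"
proof -
  have dense: "\<exists>n. \<bar>decode_rat n - x\<bar> < e / 2" for x
  proof -
    have "x - e / 2 < x + e / 2"
      using assms by simp
    then obtain q where q: "q \<in> \<rat>" "x - e / 2 < q" "q < x + e / 2"
      using Rats_dense_in_real by blast
    then obtain n where "q = decode_rat n"
      using surj_of_rat_nat_to_rat_surj[OF q(1)] unfolding decode_rat_def by blast
    then have "\<bar>decode_rat n - x\<bar> < e / 2"
      using q(2,3) by linarith
    then show ?thesis ..
  qed
  obtain a b where a: "\<bar>decode_rat a - Re z\<bar> < e / 2" and b: "\<bar>decode_rat b - Im z\<bar> < e / 2"
    using dense by blast
  have "cmod (decode_gauss_rat (prod_encode (a, b)) - z)
      \<le> \<bar>decode_rat a - Re z\<bar> + \<bar>decode_rat b - Im z\<bar>"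
    using cmod_le[of "decode_gauss_rat (prod_encode (a, b)) - z"] by (simp add: decode_gauss_rat_def)
  then have "cmod (decode_gauss_rat (prod_encode (a, b)) - z) < e"
    using a b by linarith
  then show ?thesis
    by (rule that)
qed

context computable_exponent
begin

lemma decode_vec_std_basis: "std_vec c = (\<lambda>n. decode_gauss_rat (code_nth c n))"
  using decode_vec_split[OF p_ge_1 splitting_zero] by (simp add: split_basis_zero split_comb_zero)

lemma decode_vec_std_basis_mem: "std_vec c \<in> lp_carrier p"
  using decode_vec_mem[OF splitting_zero] by (simp add: split_basis_zero)

text \<open>
  After truncation to \<open>M\<close> coordinates, an error of \<open>e / 2 / Suc M\<close> in each of them is small
  enough.
\<close>

lemma rational_vectors_dense:
  assumes f: "f \<in> lp_carrier p" and e: "0 < e"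
  obtains c where "lp_norm p (\<lambda>n. std_vec c n - f n) < e"
proof -
  have "0 < e / 2"
    using e by simp
  from lp_truncate[OF p_ge_1 f this] obtain M
    where M: "lp_norm p (\<lambda>n. f n - (if n < M then f n else 0)) < e / 2" .
  let ?g = "\<lambda>n. if n < M then f n else 0"
  let ?d = "e / 2 / real (Suc M)"
  have d: "0 < ?d"
    using e by simp
  have "\<exists>k. cmod (decode_gauss_rat k - f n) < ?d" for n
    using decode_gauss_rat_dense[OF d] by blast
  then obtain k where k: "\<And>n. cmod (decode_gauss_rat (k n) - f n) < ?d"
    by metis
  let ?c = "list_encode (map k [0..<M])"
  let ?v = "std_vec ?c"
  have diff: "?v n - ?g n = (if n < M then decode_gauss_rat (k n) - f n else 0)" for n
    by (simp add: decode_vec_std_basis code_nth_list_encode_map decode_gauss_rat_0)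
  have "(\<Sum>n<K. cmod (?v n - ?g n) powr p) \<le> (e / 2) powr p" for K
  proof -
    have "(\<Sum>n<K. cmod (?v n - ?g n) powr p) \<le> (\<Sum>n<K. if n < M then ?d powr p else 0)"
      unfolding diff using p_ge_1 less_imp_le[OF k] by (intro sum_mono) (auto intro!: powr_mono2)
    also have "\<dots> \<le> (\<Sum>n\<in>{..<K} \<union> {..<M}. if n < M then ?d powr p else 0)"
      by (rule sum_mono2) auto
    also have "\<dots> = (\<Sum>n<M. ?d powr p)"
      by (rule sum.mono_neutral_cong_right) auto
    also have "\<dots> = real M * ((e / 2) powr p / real (Suc M) powr p)"
      by (simp only: powr_divide[of "e / 2" "real (Suc M)"] sum_constant card_lessThan)
    also have "\<dots> = (e / 2) powr p * (real M / real (Suc M) powr p)"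
      by simp
    also have "\<dots> \<le> (e / 2) powr p * 1"
    proof (intro mult_left_mono)
      have "real M \<le> real (Suc M) powr 1"
        by simp
      also have "\<dots> \<le> real (Suc M) powr p"
        using p_ge_1 by (intro powr_mono) auto
      finally show "real M / real (Suc M) powr p \<le> 1"
        by (simp add: divide_le_eq)
    qed simp
    finally show ?thesis by simp
  qed
  then have vg: "(\<lambda>n. ?v n - ?g n) \<in> lp_carrier p" "lp_norm p (\<lambda>n. ?v n - ?g n) \<le> e / 2"
    using lp_memI[OF p_ge_1, of "e / 2" "\<lambda>n. ?v n - ?g n"] e by auto
  have g: "?g \<in> lp_carrier p"
    unfolding lp_carrier_iff by (rule summable_finite[of "{..<M}"]) auto
  have "(\<lambda>n. ?v n - f n) = (\<lambda>n. (?v n - ?g n) - (f n - ?g n))"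
    by auto
  then have "lp_norm p (\<lambda>n. ?v n - f n) < e"
    using lp_diff(2)[OF p_ge_1 vg(1) lp_diff(1)[OF p_ge_1 f g]] vg(2) M by simp
  then show ?thesis
    by (rule that)
qed

text \<open>
  The number is the norm of the sum of the first two basis vectors.
\<close>

lemma computable_root_of_2:
  obtains A where "computable X A"
    and "\<And>K. \<bar>real (A K) / real (Suc K) - 2 powr (1 / p)\<bar> \<le> 1 / real (Suc K)"
proof -
  let ?x = "\<lambda>i::nat. if i < 2 then int 1 else 0" and ?y = "\<lambda>i::nat. 0::int"
  have norm: "lp_norm p (split_comb p (\<lambda>_. 0) (int_vec ?x ?y)) = 2 powr (1 / p)"
  proof -
    have "(\<lambda>n. cmod (int_vec ?x ?y n) powr p) sums (\<Sum>n<2. cmod (int_vec ?x ?y n) powr p)"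
      by (rule sums_finite) (auto simp: int_vec_def Complex_eq_0)
    moreover have "(\<Sum>n<2. cmod (int_vec ?x ?y n) powr p) = 2"
      by (simp add: int_vec_def lessThan_nat_numeral cmod_def)
    ultimately show ?thesis
      unfolding split_comb_zero lp_norm_def by (simp add: sums_unique[symmetric])
  qed
  let ?R = "\<lambda>a K. real (Suc K) * 2 powr (1 / p) < real (Suc a) \<and>
    (a = 0 \<or> real (a - 1) < real (Suc K) * 2 powr (1 / p))"
  have less: "semidecidable X (\<lambda>z. real (Suc (snd z)) * 2 powr (1 / p) < real (Suc (fst z)))"
    unfolding norm[symmetric]
    by (rule semidecidable_norm_less(1)[OF splitting_zero computable_const, where L = "\<lambda>_. 2"])
      (intro computable_intros | simp)+
  have greater: "semidecidable X (\<lambda>z. real (fst z - 1) < real (Suc (snd z)) * 2 powr (1 / p))"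
    unfolding norm[symmetric]
    by (rule semidecidable_norm_less(2)[OF splitting_zero computable_const, where L = "\<lambda>_. 2"])
      (intro computable_intros | simp)+
  have R: "semidecidable X (\<lambda>z. ?R (fst z) (snd z))"
    by (intro semidecidable_conj semidecidable_disj less greater
        semidecidable_decidable[OF decidable_eq] computable_intros)
  have ex: "\<exists>a. ?R a K" for K
  proof -
    have "0 \<le> real (Suc K) * 2 powr (1 / p)"
      by simp
    then have "?R (nat \<lfloor>real (Suc K) * 2 powr (1 / p)\<rfloor>) K"
      by linarith
    then show ?thesis ..
  qed
  obtain A where A: "computable X A" "\<And>K. ?R (A K) K"
    by (rule semidecidable_select[of X ?R, OF R ex]) blast
  have "\<bar>real (A K) / real (Suc K) - 2 powr (1 / p)\<bar> \<le> 1 / real (Suc K)" for K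
  proof -
    have "0 \<le> real (Suc K) * 2 powr (1 / p)"
      by simp
    then have "\<bar>real (A K) - real (Suc K) * 2 powr (1 / p)\<bar> \<le> 1"
      using A(2)[of K] by linarith
    then have "\<bar>real (A K) - real (Suc K) * 2 powr (1 / p)\<bar> / real (Suc K) \<le> 1 / real (Suc K)"
      by (rule divide_right_mono) simp
    moreover have "\<bar>real (A K) - real (Suc K) * 2 powr (1 / p)\<bar> / real (Suc K)
        = \<bar>(real (A K) - real (Suc K) * 2 powr (1 / p)) / real (Suc K)\<bar>"
      by simp
    ultimately show ?thesis
      by (simp add: diff_divide_distrib)
  qed
  with A(1) that show ?thesis
    by blast
qed

text \<open>
  If the oracle knows which coordinates have partners, it finds the partners, and thereby the
  coordinates of a vector with respect to the generators; they involve the scale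
  \<open>1 / \<delta> = 2 powr (1 / p)\<close>, which is replaced by a rational approximation. A ball of radius \<open>r\<close>
  about \<open>v\<close> is sent to the ball of radius \<open>2 r\<close> about a combination of generators at distance
  less than \<open>r\<close> from \<open>v\<close>.
\<close>

lemma oracle_computes_id:
  assumes h: "splitting h" "computable X h" and parents: "decidable X (\<lambda>i. \<exists>k. h k = Suc i)"
  shows "oracle_computes_map X (lp_space p) std_basis (lp_space p) (split_basis p h) (\<lambda>f. f)"
proof -
  obtain A where A: "computable X A"
    "\<And>K. \<bar>real (A K) / real (Suc K) - 2 powr (1 / p)\<bar> \<le> 1 / real (Suc K)"
    by (rule computable_root_of_2[where X = X]) blast
  let ?N = "\<lambda>c. lp_norm p (split_comb p (\<lambda>_. 0) (int_vec (vec_re c) (vec_im c)))"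
  obtain B where B: "computable X B" "\<And>c. real 1 * ?N c < real (B c)"
  proof (rule semidecidable_select[of X "\<lambda>b c. real 1 * ?N c < real b"])
    show "semidecidable X (\<lambda>z. real 1 * ?N (snd z) < real (fst z))"
      by (rule semidecidable_norm_less(1)[OF splitting_zero computable_const, where L = "\<lambda>z. snd z"])
        (intro computable_intros | simp add: vec_re_beyond vec_im_beyond)+
    show "\<exists>b. real 1 * ?N c < real b" for c
      by (rule reals_Archimedean2)
  qed blast
  \<comment> \<open>coordinates without a partner get the default value 0, so that the search ends\<close>
  define child where "child i = (LEAST k. h k = Suc i \<or> \<not> (\<exists>k. h k = Suc i))" for i
  have comp_child: "computable X child"
    unfolding child_def[abs_def]
    by (intro computable_Least computable_intros computable_compose[OF h(2)] decidable_compose[OF parents]) blast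
  have child: "child i = k" if "h k = Suc i" for i k
    unfolding child_def
  proof (rule Least_equality)
    fix l assume l: "h l = Suc i \<or> \<not> (\<exists>k. h k = Suc i)"
    have "\<exists>k. h k = Suc i"
      using that by (rule exI)
    with l have "h l = Suc i"
      by simp
    with that have "k = l"
      by (rule splitting_inj[OF h(1)])
    then show "k \<le> l"
      by simp
  qed (rule disjI1[OF that])
  have active: "decidable X (split_active h)"
    unfolding split_active_def[abs_def] by (intro computable_intros h(2) parents)
  \<comment> \<open>every coefficient of the result has its index below \<open>L c\<close>: an index below \<open>c\<close> or the partner of one\<close>
  define L where "L c = c + (\<Sum>i<c. Suc (child i))" for c
  define S where "S K k = (if split_active h k then A K else Suc K)" for K k
  define W where "W c K = list_encode (map (\<lambda>k.
      gauss_code (int (S K k) * (vec_re c k - split_parent h (vec_re c) k))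
        (int (S K k) * (vec_im c k - split_parent h (vec_im c) k)) (Suc K * vec_den c)) [0..<L c])" for c K
  \<comment> \<open>\<open>B\<close> bounds the norm of the centre and the radius is at least \<open>1 / Suc (radius_den b)\<close>, so an error of \<open>1 / Suc (K b)\<close> in the scale is small enough\<close>
  define K where "K b = B (center_code b) * Suc (radius_den b)" for b
  \<comment> \<open>the numerator of the radius is coded by its predecessor: \<open>2 * Suc a = Suc (Suc (2 * a))\<close>\<close>
  define out where "out b = prod_encode (W (center_code b) (K b),
      prod_encode (Suc (2 * radius_num b), radius_den b))" for b
  have comp_W: "computable X (\<lambda>z. W (fst z) (snd z))"
    unfolding W_def S_def L_def
    by (intro computable_intros computable_compose[OF comp_child] decidable_compose[OF active]
        computable_compose[OF A(1)] h(2))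
  have comp_K: "computable X K"
    unfolding K_def[abs_def] by (intro computable_intros computable_compose[OF B(1)])
  have "computable X out"
    unfolding out_def[abs_def]
    by (intro computable_intros computable2[OF comp_W] comp_K)
  then obtain P where P: "\<And>b. runs X P [b] (out b)"
    unfolding computable_nat_iff entries_nat_def by blast
  have close: "lp_norm p (\<lambda>n. split_vec h (W c k) n - std_vec c n)
      \<le> 1 / real (Suc k) * lp_norm p (std_vec c)" for c k
  proof (rule lp_norm_le_scaled[OF p_ge_1 decode_vec_std_basis_mem])
    let ?v = "\<lambda>n. decode_gauss_rat (code_nth c n)"
    let ?s = "\<lambda>n. real (S k n) / real (Suc k)"
    have D: "complex_of_nat (vec_den c) \<noteq> 0"
      using vec_den_pos[of c] by simp
    have v0: "?v n = 0" if "c \<le> n" for n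
      using that by (simp add: code_nth_beyond decode_gauss_rat_0)
    have coef: "decode_gauss_rat (code_nth (W c k) n) = of_real (?s n) * (?v n - split_parent h ?v n)" for n
    proof (cases "n < L c")
      case True
      have "?v n - split_parent h ?v n = Complex (of_int (vec_re c n - split_parent h (vec_re c) n))
          (of_int (vec_im c n - split_parent h (vec_im c) n)) / of_nat (vec_den c)"
        by (simp add: decode_gauss_rat_code_nth split_parent_def complex_eq_iff diff_divide_distrib)
      moreover have "decode_gauss_rat (code_nth (W c k) n)
          = Complex (of_int (int (S k n) * (vec_re c n - split_parent h (vec_re c) n)))
              (of_int (int (S k n) * (vec_im c n - split_parent h (vec_im c) n))) / of_nat (Suc k * vec_den c)"
        using True by (simp only: W_def code_nth_list_encode_map decode_gauss_code if_True)
      moreover have "Complex (of_int (int s * x)) (of_int (int s * y)) = of_nat s * Complex (of_int x) (of_int y)"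
        for s x y
        by (simp add: complex_eq_iff)
      ultimately show ?thesis
        by (simp only: of_nat_mult of_real_divide of_real_of_nat_eq times_divide_times_eq)
    next
      case False
      have "split_parent h ?v n = 0"
      proof (cases "h n")
        case (Suc i)
        have "c \<le> i"
        proof (rule ccontr)
          assume "\<not> c \<le> i"
          then have "Suc (child i) \<le> (\<Sum>i<c. Suc (child i))"
            by (intro member_le_sum) auto
          with False show False
            using child[OF Suc] by (simp add: L_def)
        qed
        with Suc v0 show ?thesis
          by (simp add: split_parent_def)
      qed (simp add: split_parent_def)
      moreover have "?v n = 0"
        using False by (intro v0) (simp add: L_def)
      ultimately show ?thesis
        using False by (simp add: W_def code_nth_list_encode_map decode_gauss_rat_0)
    qed
    fix n
    have "?s i = ?s j" if "h j = Suc i" for i j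
    proof -
      have "split_active h i" "split_active h j"
        using that by (auto simp: split_active_def)
      then show ?thesis
        by (simp add: S_def)
    qed
    then have "split_vec h (W c k) n = of_real (split_scale p h n * ?s n) * ?v n"
      unfolding decode_vec_split[OF p_ge_1 h(1)] coef by (rule split_comb_rescaled[OF h(1)])
    then have "split_vec h (W c k) n - std_vec c n
        = of_real (split_scale p h n * ?s n - 1) * ?v n"
      by (simp add: decode_vec_std_basis algebra_simps)
    moreover have "\<bar>split_scale p h n * ?s n - 1\<bar> \<le> 1 / real (Suc k)"
    proof (cases "split_active h n")
      case True
      have "split_scale p h n * ?s n - 1 = 2 powr (- 1 / p) * (real (A k) / real (Suc k) - 2 powr (1 / p))"
        using True by (simp add: split_scale_def S_def right_diff_distrib flip: powr_add)
      then have "\<bar>split_scale p h n * ?s n - 1\<bar>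
          = 2 powr (- 1 / p) * \<bar>real (A k) / real (Suc k) - 2 powr (1 / p)\<bar>"
        by (simp add: abs_mult)
      also have "\<dots> \<le> 2 powr (- 1 / p) * (1 / real (Suc k))"
        by (rule mult_left_mono[OF A(2)]) simp
      also have "\<dots> \<le> 1 * (1 / real (Suc k))"
      proof (rule mult_right_mono)
        have "(2 :: real) powr (- 1 / p) \<le> 2 powr 0"
          using p_ge_1 by (intro powr_mono) auto
        then show "(2 :: real) powr (- 1 / p) \<le> 1"
          by simp
      qed simp
      finally show ?thesis by simp
    next
      case False
      then show ?thesis
        by (simp add: split_scale_def S_def)
    qed
    ultimately show "cmod (split_vec h (W c k) n - std_vec c n)
        \<le> 1 / real (Suc k) * cmod (std_vec c n)"
      by (simp only: norm_mult norm_of_real decode_vec_std_basis) (rule mult_right_mono, auto)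
  qed simp
  have out_center: "center_code (out b) = W (center_code b) (K b)" for b
    by (simp add: out_def)
  have out_radius: "decode_pos_rat (radius_code (out b)) = 2 * decode_pos_rat (radius_code b)" for b
    by (simp add: out_def decode_pos_rat_eq field_simps)
  have near: "lp_norm p (\<lambda>n. split_vec h (center_code (out b)) n
      - std_vec (center_code b) n) < decode_pos_rat (radius_code b)" for b
  proof -
    let ?c = "center_code b"
    let ?q = "radius_den b"
    let ?v = "std_vec ?c"
    have "1 * lp_norm p ?v \<le> real (vec_den ?c) * lp_norm p ?v"
      using vec_den_pos[of ?c] by (intro mult_right_mono) (auto simp: lp_norm_nonneg)
    also have "\<dots> = ?N ?c"
      using norm_decode_vec[OF splitting_zero] by (simp add: split_basis_zero)
    also have "\<dots> < real (B ?c)"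
      using B(2)[of ?c] by simp
    finally have v: "lp_norm p ?v < real (B ?c)"
      by simp
    have "1 / real (Suc (K b)) * lp_norm p ?v \<le> 1 / real (Suc (K b)) * real (B ?c)"
      using v by (intro mult_left_mono) auto
    also have "\<dots> < 1 / real (Suc ?q)"
    proof -
      have "B ?c * Suc ?q < Suc (K b)"
        by (simp add: K_def)
      then have "real (B ?c) * real (Suc ?q) < real (Suc (K b))"
        unfolding of_nat_mult[symmetric] by (rule of_nat_less_iff[THEN iffD2])
      then show ?thesis
        by (simp add: field_simps del: of_nat_Suc)
    qed
    also have "\<dots> \<le> decode_pos_rat (radius_code b)"
      unfolding decode_pos_rat_eq by (rule divide_right_mono) auto
    finally show ?thesis
      unfolding out_center using close[of ?c "K b"] by linarith
  qed
  have ball0: "f \<in> std_ball b \<longleftrightarrow> f \<in> lp_carrier p \<and>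
      lp_norm p (\<lambda>n. std_vec (center_code b) n - f n)
      < decode_pos_rat (radius_code b)" for f b
    using decode_ball_iff[OF splitting_zero] by (simp add: split_basis_zero)
  interpret Metric_space "lp_carrier p" "vdist (lp_space p)"
    by (rule Metric_space_lp[OF p_ge_1])
  have sound: "std_ball b \<subseteq> split_ball h (out b)" for b
  proof
    fix f assume f: "f \<in> std_ball b"
    let ?v = "std_vec (center_code b)"
    let ?w = "split_vec h (center_code (out b))"
    have mem: "f \<in> lp_carrier p" "?v \<in> lp_carrier p" "?w \<in> lp_carrier p"
      using f decode_vec_std_basis_mem decode_vec_mem[OF h(1)] by (auto simp: ball0)
    have eq: "(\<lambda>n. ?w n - f n) = (\<lambda>n. (?w n - ?v n) + (?v n - f n))"
      by auto
    have "lp_norm p (\<lambda>n. ?w n - f n) \<le> lp_norm p (\<lambda>n. ?w n - ?v n) + lp_norm p (\<lambda>n. ?v n - f n)"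
      unfolding eq by (intro lp_add(2) p_ge_1 lp_diff(1) mem)
    also have "\<dots> < 2 * decode_pos_rat (radius_code b)"
      using near[of b] f by (simp add: ball0)
    finally show "f \<in> split_ball h (out b)"
      by (simp add: decode_ball_iff[OF h(1)] mem out_radius)
  qed
  have fine: "\<exists>b. f \<in> std_ball b \<and> std_ball b \<subseteq> N \<and>
      split_ball h (out b) \<subseteq> M"
    if f: "f \<in> lp_carrier p" and N: "openin mtopology N" "f \<in> N" and M: "openin mtopology M" "f \<in> M" for f N M
  proof -
    obtain d where d: "0 < d" "mball f d \<subseteq> N"
      using N unfolding openin_mtopology by meson
    obtain e where e: "0 < e" "mball f e \<subseteq> M"
      using M unfolding openin_mtopology by meson
    obtain q where q: "inverse (real (Suc q)) < min d e / 4"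
      using reals_Archimedean[of "min d e / 4"] d(1) e(1) by auto
    let ?r = "inverse (real (Suc q))"
    have r: "0 < ?r"
      by simp
    obtain c where c: "lp_norm p (\<lambda>n. std_vec c n - f n) < ?r"
      using rational_vectors_dense[OF f r] .
    let ?b = "prod_encode (c, prod_encode (0, q))"
    have b: "center_code ?b = c" "decode_pos_rat (radius_code ?b) = ?r"
      by (simp_all add: decode_pos_rat_eq inverse_eq_divide)
    have small: "vdist (lp_space p) f x < 4 * ?r"
      if "x \<in> split_ball h (out ?b)" for x
    proof -
      let ?w = "split_vec h (center_code (out ?b))"
      have x: "x \<in> lp_carrier p" "lp_norm p (\<lambda>n. ?w n - x n) < 2 * ?r"
        using that unfolding decode_ball_iff[OF h(1)] out_radius b(2) by blast+
      have "f \<in> split_ball h (out ?b)"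
        using f c by (intro subsetD[OF sound]) (simp only: ball0 b)
      then have "lp_norm p (\<lambda>n. ?w n - f n) < 2 * ?r"
        unfolding decode_ball_iff[OF h(1)] out_radius b(2) by blast
      moreover have w: "?w \<in> lp_carrier p"
        by (rule decode_vec_mem[OF h(1)])
      moreover have eq: "(\<lambda>n. f n - x n) = (\<lambda>n. (?w n - x n) - (?w n - f n))"
        by auto
      ultimately show ?thesis
        unfolding vdist_lp[OF p_ge_1 f x(1)] eq
        using lp_diff(2)[OF p_ge_1 lp_diff(1)[OF p_ge_1 w x(1)] lp_diff(1)[OF p_ge_1 w f]] x(2) by linarith
    qed
    have sub: "split_ball h (out ?b) \<subseteq> mball f (min d e)"
    proof
      fix x assume x: "x \<in> split_ball h (out ?b)"
      then have "x \<in> lp_carrier p"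
        by (simp add: decode_ball_iff[OF h(1)])
      with f small[OF x] q show "x \<in> mball f (min d e)"
        by simp
    qed
    have "mball f (min d e) \<subseteq> N" "mball f (min d e) \<subseteq> M"
      using d(2) e(2) mball_subset_concentric[of "min d e" d f] mball_subset_concentric[of "min d e" e f] by auto
    moreover have "f \<in> std_ball ?b"
      using f c by (simp only: ball0 b)
    ultimately show ?thesis
      using sub sound[of ?b] by (meson order_trans)
  qed
  show ?thesis
    unfolding oracle_computes_map_def
  proof (intro exI[of _ P] conjI allI impI ballI)
    fix b b' assume "runs X P [b] b'"
    then have "b' = out b"
      using P runs_deterministic by blast
    then show "(\<lambda>f. f) ` std_ball b \<subseteq> split_ball h b'"
      using sound by simp
  next
    fix f N M
    assume "f \<in> lp_carrier p" "openin mtopology N" "f \<in> N" "openin mtopology M" "f \<in> M"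
    from fine[OF this] P show "\<exists>b b'. f \<in> std_ball b \<and>
        std_ball b \<subseteq> N \<and> runs X P [b] b' \<and>
        split_ball h b' \<subseteq> M"
      by blast
  qed
qed

end

section \<open>Splitting along an enumeration\<close>

text \<open>
  Coordinate \<open>2 c\<close> acquires a partner when \<open>c\<close> is confirmed to be in the set; the partner is an
  odd number that encodes \<open>c\<close> and the first stage of confirmation. Being the partner of a given
  coordinate is decidable, having a partner is as hard as the set.
\<close>

lemma enumeration_splitting:
  assumes "ce_set C"
  obtains h where "splitting h" and "computable {} h"
    and "\<And>i. (\<exists>k. h k = Suc i) \<longleftrightarrow> i mod 2 = 0 \<and> i div 2 \<in> C" and "\<And>c. h (2 * c) = 0"
proof -
  obtain P where P: "C = {n. \<exists>y. runs {} P [n] y}"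
    using assms unfolding ce_set_def by blast
  have "semidecidable {} (\<lambda>n. \<exists>y. runs {} P [n] y)"
    by (intro semidecidable_intros semidecidable2[OF semidecidable_runs] computable_intros)
  then obtain Q where Q: "decidable {} (\<lambda>z. Q (fst z) (snd z))"
    "\<And>n. (\<exists>y. runs {} P [n] y) \<longleftrightarrow> (\<exists>s::nat. Q s n)"
    unfolding semidecidable_def by blast
  define new where "new s c \<longleftrightarrow> Q s c \<and> \<not> (\<exists>t<s. Q t c)" for s c
  have new_unique: "s = t" if "new s c" "new t c" for s t c
    using that unfolding new_def by (meson linorder_neqE_nat)
  have C_iff: "c \<in> C \<longleftrightarrow> (\<exists>s. new s c)" for c
    unfolding P mem_Collect_eq Q(2) new_def using exists_least_iff[of "\<lambda>s. Q s c"] by blast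
  define h where "h k = (if k mod 2 = 1 \<and> new (fst (prod_decode (k div 2))) (snd (prod_decode (k div 2)))
    then Suc (2 * snd (prod_decode (k div 2))) else 0)" for k
  have comp_new: "decidable {} (\<lambda>z. new (fst z) (snd z))"
    unfolding new_def by (intro computable_intros Q(1) decidable2[OF Q(1)])
  have comp_h: "computable {} h"
    unfolding h_def[abs_def] by (intro computable_intros decidable2[OF comp_new])
  have h_iff: "h k = Suc i \<longleftrightarrow> (\<exists>s c. i = 2 * c \<and> new s c \<and> k = Suc (2 * prod_encode (s, c)))" for k i
  proof
    assume "h k = Suc i"
    then have k: "k mod 2 = 1" "new (fst (prod_decode (k div 2))) (snd (prod_decode (k div 2)))"
      and i: "i = 2 * snd (prod_decode (k div 2))"
      by (simp_all add: h_def split: if_splits)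
    have "k = Suc (2 * prod_encode (fst (prod_decode (k div 2)), snd (prod_decode (k div 2))))"
      using k(1) by (simp only: prod.collapse prod_decode_inverse) presburger
    with k(2) i show "\<exists>s c. i = 2 * c \<and> new s c \<and> k = Suc (2 * prod_encode (s, c))"
      by blast
  next
    assume "\<exists>s c. i = 2 * c \<and> new s c \<and> k = Suc (2 * prod_encode (s, c))"
    then show "h k = Suc i"
      by (auto simp: h_def)
  qed
  have even: "h (2 * c) = 0" for c
    by (simp add: h_def)
  have splitting: "splitting h"
    unfolding splitting_def
  proof (intro conjI allI impI)
    fix k l assume eq: "h k = h l" "h k \<noteq> 0"
    then obtain i where "h k = Suc i" "h l = Suc i"
      by (metis not0_implies_Suc)
    then obtain s c t d where "i = 2 * c" "new s c" "k = Suc (2 * prod_encode (s, c))"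
      "i = 2 * d" "new t d" "l = Suc (2 * prod_encode (t, d))"
      unfolding h_iff by blast
    then show "k = l"
      using new_unique[of s c t] by simp
  next
    fix k i assume "h k = Suc i"
    then obtain c where "i = 2 * c"
      unfolding h_iff by blast
    then show "h i = 0"
      using even by simp
  qed
  have parent: "(\<exists>k. h k = Suc i) \<longleftrightarrow> i mod 2 = 0 \<and> i div 2 \<in> C" for i
  proof
    assume "\<exists>k. h k = Suc i"
    then obtain s c where "i = 2 * c" "new s c"
      unfolding h_iff by blast
    then show "i mod 2 = 0 \<and> i div 2 \<in> C"
      unfolding C_iff by auto
  next
    assume i: "i mod 2 = 0 \<and> i div 2 \<in> C"
    then obtain s where "new s (i div 2)"
      unfolding C_iff by blast
    moreover have "i = 2 * (i div 2)"
      using mult_div_mod_eq[of 2 i] i by simp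
    ultimately show "\<exists>k. h k = Suc i"
      unfolding h_iff by blast
  qed
  show ?thesis
    by (rule that[OF splitting comp_h parent even])
qed

lemma surjective_linear_isometry_id: "surjective_linear_isometry V V (\<lambda>f. f)"
  by (simp add: surjective_linear_isometry_def linear_isometry_def)

theorem theorem2p4:
  fixes p :: real and C :: "nat set"
  assumes "computable_real p" and "1 \<le> p" and "p \<noteq> 2"
    and "ce_set C"
  shows "\<exists>(B :: (nat \<Rightarrow> complex) normed_space) F.
    computable_banach_space B F \<and>
    (\<exists>T. surjective_linear_isometry (lp_space p) B T \<and>
         oracle_computes_map C (lp_space p) std_basis B F T) \<and>
    (\<forall>X. (\<exists>T. surjective_linear_isometry (lp_space p) B T \<and>
              oracle_computes_map X (lp_space p) std_basis B F T) \<longrightarrow>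
         oracle_computes_set X C)"
proof -
  interpret computable_exponent p
    by unfold_locales (rule assms)+
  obtain h where h: "splitting h" "computable {} h"
    and parent: "\<And>i. (\<exists>k. h k = Suc i) \<longleftrightarrow> i mod 2 = 0 \<and> i div 2 \<in> C" and even: "\<And>c. h (2 * c) = 0"
    by (rule enumeration_splitting[OF assms(4)]) blast
  have h_any: "computable X h" for X
    using h(2) by (rule computable_any_oracle)
  have upper: "oracle_computes_map C (lp_space p) std_basis (lp_space p) (split_basis p h) (\<lambda>f. f)"
  proof (rule oracle_computes_id[OF h(1) h_any])
    show "decidable C (\<lambda>i. \<exists>k. h k = Suc i)"
      unfolding parent by (intro computable_intros)
  qed
  have lower: "oracle_computes_set X C"
    if T: "surjective_linear_isometry (lp_space p) (lp_space p) T"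
      "oracle_computes_map X (lp_space p) std_basis (lp_space p) (split_basis p h) T" for X T
  proof -
    have "decidable X (split_active h)"
      using assms(3) h(1) h_any T by (rule decidable_active_if_computes_isometry)
    then have "decidable X (\<lambda>c. split_active h (2 * c))"
      by (rule decidable_compose) (intro computable_intros)
    moreover have "split_active h (2 * c) \<longleftrightarrow> c \<in> C" for c
      unfolding split_active_def parent even by simp
    ultimately have "decidable X (\<lambda>c. c \<in> C)"
      by simp
    then obtain P where P: "\<And>c. runs X P [c] (of_bool (c \<in> C))"
      unfolding decidable_def computable_nat_iff entries_nat_def by blast
    then have "runs X P [c] (if c \<in> C then 1 else 0)" for c
      using P[of c] by (cases "c \<in> C") simp_all
    then show ?thesis
      unfolding oracle_computes_set_def by blast
  qed
  show ?thesis
  proof (intro exI[of _ "lp_space p"] exI[of _ "split_basis p h"] conjI)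
    show "computable_banach_space (lp_space p) (split_basis p h)"
      by (rule computable_banach_space_split[OF h])
    show "\<exists>T. surjective_linear_isometry (lp_space p) (lp_space p) T \<and>
        oracle_computes_map C (lp_space p) std_basis (lp_space p) (split_basis p h) T"
      using surjective_linear_isometry_id upper by (intro exI conjI)
    show "\<forall>X. (\<exists>T. surjective_linear_isometry (lp_space p) (lp_space p) T \<and>
        oracle_computes_map X (lp_space p) std_basis (lp_space p) (split_basis p h) T) \<longrightarrow> oracle_computes_set X C"
      by (intro allI impI, elim exE conjE) (rule lower)
  qed
qed

end
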